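(* Let $X=(X_t)_{t\in\mathbb R}$ be an RSMPR process with correlation indices $\{\alpha_n\}$ (defined in the context), with $EX_0=EX_0^3=0$ and $EX_0^2=1$, and let $v$ be the cardinality of the support of its stationary measure. Then $X$ is a quadratic harness if and only if there is $\alpha>0$ such that $\alpha_n=n\alpha$ for all $1\le n<v$, and there exists $q\in[-1,1]$ such that: i) if $q=-1$, $X$ is the two-point symmetric Markov chain $2$SMC$(\alpha)$; ii) if $q=1$, $X$ is an Ornstein–Uhlenbeck process with $\operatorname{cov}(X_s,X_t)=\exp(-\alpha|t-s|)EX_0^2$; iii) if $q\in(-1,1)$, $X$ is a $(q,\alpha)$-Ornstein–Uhlenbeck process.
   Context: Let $X=(X_t)_{t\in\mathbb R}$ be a real Markov process, $\mathcal F_{\le s}=\sigma(X_r:r\le s)$, $\mathcal F_{s,u}=\sigma(X_r:r\notin(s,u))$; $\mu$ is the law of $X_0$, $v\in\mathbb N\cup\{\infty\}$ is the number of points in $\operatorname{supp}\mu$. Equalities between random variables are almost sure. $X$ is an SMPR process (stationary Markov process with polynomial regression) if: (a) it is stationary: $X_t\sim\mu$ for all $t$, and the conditional law of $X_{t}$ given $X_s=y$, $s<t$, depends only on $y$ and $t-s$; (b) all moments of $X_0$ are finite and $\mu$ is identifiable by its moments; (c) (totally linearly dependent, TLD) for all $0<n\le v-1$ and all distinct $s_1,\dots,s_n$ the matrix $[\operatorname{cov}(X_{s_i},X_{s_j})]$ is non-singular; (d) (mean-square continuous, MSC) for all $m,j\ge 0$ the quantity $E X_t^mX_s^j$ is a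 function of $|t-s|$, continuous at least at $0$; (e) for all $1\le n<v$ and $s<t$, $E(X_t^n|\mathcal F_{\le s})=Q_n(X_s,t-s)$ where $Q_n(x,\tau)=\sum_{j=0}^n\gamma_{n,j}(\tau)x^j$ is a polynomial in $x$ of degree exactly $n$; (f) for each $n<v$ the lower triangular $(n+1)\times(n+1)$ matrices $A_n(t)$ with entries $\gamma_{i,j}(t)$, $0\le j\le i\le n$, $\gamma_{0,0}=1$, are diagonalizable. Then $A_n(t)=V_n\Lambda_n(t)V_n^{-1}$ with $V_n$ lower triangular not depending on $t$ and $\Lambda_n(t)=\mathrm{diag}\{1,e^{-\alpha_1t},\dots,e^{-\alpha_nt}\}$. Consequently there are real numbers $\alpha_n$ ($\alpha_0=0$), called correlation indices, and monic polynomials $p_n$ with $\deg p_n=n$, $0\le n<v$, with $E(p_n(X_t)|\mathcal F_{\le s})=e^{-\alpha_n(t-s)}p_n(X_s)$ for $s<t$. The process is called regular (RSMPR) if the polynomials $p_n$ are orthogonal with respect to $\mu$. For $r\in\mathbb N$, $X$ is an $r$-harness if for all $s<t<u$, $E(X_t^r|\mathcal F_{s,u})$ is a polynomial of degree $r$ in $X_s$ and $X_u$ (with non-random coefficients depending on $s,t,u$). A quadratic harness is a process that is an $r$-harness for both $r=1$ and $r=2$. $2$SMC$(\alpha)$, $\alpha>0$: the stationary Markov process with values in $\{-1,1\}$, $P(X_0=1)=P(X_0=-1)=1/2$, and for $s<t$: $P(X_t=1|X_s=1)=P(X_t=-1|X_s=-1)=\frac12+\frac12e^{-\alpha(t-s)}$,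 $P(X_t=1|X_s=-1)=P(X_t=-1|X_s=1)=\frac12-\frac12e^{-\alpha(t-s)}$. Ornstein–Uhlenbeck process: stationary centered Gaussian process with covariance $EX_0^2\exp(-\alpha|t-s|)$, $\alpha>0$. $(q,\alpha)$-Ornstein–Uhlenbeck process, $q\in(-1,1)$, $\alpha>0$: let $[0]_q=0$, $[n]_q=1+q+\dots+q^{n-1}$, $[n]_q!=\prod_{i=1}^n[i]_q$, $[0]_q!=1$, and let the $q$-Hermite polynomials be given by $H_{-1}(x|q)=0$, $H_0(x|q)=1$, $xH_n(x|q)=H_{n+1}(x|q)+[n]_qH_{n-1}(x|q)$. The process is the stationary Markov process whose marginal law is the probability measure with density $f_N(x|q)$ on $[-2/\sqrt{1-q},2/\sqrt{1-q}]$ with respect to which the $q$-Hermite polynomials are orthogonal, and whose transition law from $X_s=y$ to $X_t$, $s<t$, has density $f_{CN}(x|y,\rho,q)=f_N(x|q)\sum_{n\ge0}\rho^nH_n(x|q)H_n(y|q)/[n]_q!$ with $\rho=e^{-\alpha(t-s)}$.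
   Formalization: Regular is read as: every choice of monic p_n satisfying the defining relations is orthogonal, which forces distinct correlation indices; otherwise X_t = X_0 = ±1 (constant in time, α_1 = 0) would be a counterexample. *)

theory Defs
  imports
    "HOL-Probability.Probability"
    "HOL-Computational_Algebra.Polynomial"
    "HOL-Library.Extended_Nat"
    "Jordan_Normal_Form.Matrix"
begin

section \<open>Moments, supports and generated sigma-algebras\<close>

definition covariance :: "'a measure \<Rightarrow> ('a \<Rightarrow> real) \<Rightarrow> ('a \<Rightarrow> real) \<Rightarrow> real" where
  "covariance M Y Z =
     (\<integral>\<omega>. (Y \<omega> - (\<integral>\<omega>'. Y \<omega>' \<partial>M)) * (Z \<omega> - (\<integral>\<omega>'. Z \<omega>' \<partial>M)) \<partial>M)"

definition measure_support :: "real measure \<Rightarrow> real set" where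
  "measure_support \<mu> = {x. \<forall>U. open U \<and> x \<in> U \<longrightarrow> emeasure \<mu> U > 0}"

definition identified_by_moments :: "real measure \<Rightarrow> bool" where
  "identified_by_moments \<mu> \<longleftrightarrow>
     (\<forall>\<nu>. prob_space \<nu> \<and> sets \<nu> = sets borel \<and>
        (\<forall>n::nat. integrable \<nu> (\<lambda>x. x ^ n) \<and> (\<integral>x. x ^ n \<partial>\<nu>) = (\<integral>x. x ^ n \<partial>\<mu>))
        \<longrightarrow> \<nu> = \<mu>)"

definition diagonalizable :: "real mat \<Rightarrow> bool" where
  "diagonalizable A \<longleftrightarrow> (\<exists>D. diagonal_mat D \<and> similar_mat A D)"

definition marginal :: "'a measure \<Rightarrow> (real \<Rightarrow> 'a \<Rightarrow> real) \<Rightarrow> real measure" where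
  "marginal M X = distr M borel (X 0)"

definition support_size :: "'a measure \<Rightarrow> (real \<Rightarrow> 'a \<Rightarrow> real) \<Rightarrow> enat" where
  "support_size M X =
     (if finite (measure_support (marginal M X))
      then enat (card (measure_support (marginal M X))) else \<infinity>)"

definition sigma_gen :: "'a measure \<Rightarrow> (real \<Rightarrow> 'a \<Rightarrow> real) \<Rightarrow> real set \<Rightarrow> 'a measure" where
  "sigma_gen M X T = sigma (space M) {X r -` B \<inter> space M | r B. r \<in> T \<and> B \<in> sets borel}"

section \<open>Stationary Markov processes\<close>

definition cond_law ::
  "'a measure \<Rightarrow> (real \<Rightarrow> 'a \<Rightarrow> real) \<Rightarrow> real \<Rightarrow> real \<Rightarrow> (real \<Rightarrow> real measure) \<Rightarrow> bool" where
  "cond_law M X s t \<kappa> \<longleftrightarrow>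
     (\<forall>B\<in>sets borel. AE \<omega> in M.
        real_cond_exp M (sigma_gen M X {s}) (\<lambda>\<omega>'. indicator B (X t \<omega>')) \<omega>
          = measure (\<kappa> (X s \<omega>)) B)"

definition markov_process :: "'a measure \<Rightarrow> (real \<Rightarrow> 'a \<Rightarrow> real) \<Rightarrow> bool" where
  "markov_process M X \<longleftrightarrow>
     prob_space M \<and> (\<forall>t. X t \<in> borel_measurable M) \<and>
     (\<forall>s t. s < t \<longrightarrow> (\<forall>B\<in>sets borel. AE \<omega> in M.
        real_cond_exp M (sigma_gen M X {..s}) (\<lambda>\<omega>'. indicator B (X t \<omega>')) \<omega>
          = real_cond_exp M (sigma_gen M X {s}) (\<lambda>\<omega>'. indicator B (X t \<omega>')) \<omega>))"

definition stationary_markov :: "'a measure \<Rightarrow> (real \<Rightarrow> 'a \<Rightarrow> real) \<Rightarrow> bool" where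
  "stationary_markov M X \<longleftrightarrow>
     markov_process M X \<and>
     (\<forall>t. distr M borel (X t) = marginal M X) \<and>
     (\<exists>\<kappa>. \<forall>\<tau>>0. \<kappa> \<tau> \<in> borel \<rightarrow>\<^sub>M prob_algebra borel \<and>
        (\<forall>s t. s < t \<and> t - s = \<tau> \<longrightarrow> cond_law M X s t (\<kappa> \<tau>)))"

section \<open>Stationary Markov processes with polynomial regression\<close>

definition TLD :: "'a measure \<Rightarrow> (real \<Rightarrow> 'a \<Rightarrow> real) \<Rightarrow> bool" where
  "TLD M X \<longleftrightarrow>
     (\<forall>n::nat. 0 < n \<and> enat n \<le> support_size M X - 1 \<longrightarrow>
        (\<forall>s::nat \<Rightarrow> real. inj_on s {..<n} \<longrightarrow>
           invertible_mat (mat n n (\<lambda>(i, j). covariance M (X (s i)) (X (s j))))))"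

definition MSC :: "'a measure \<Rightarrow> (real \<Rightarrow> 'a \<Rightarrow> real) \<Rightarrow> bool" where
  "MSC M X \<longleftrightarrow>
     (\<forall>m j::nat. \<exists>g::real \<Rightarrow> real.
        (\<forall>s t. (\<integral>\<omega>. X t \<omega> ^ m * X s \<omega> ^ j \<partial>M) = g \<bar>t - s\<bar>) \<and>
        continuous (at 0 within {0..}) g)"

text \<open>The coefficients \<open>\<gamma> n j \<tau>\<close> are unique, because \<open>1, x, \<dots>, x\<^sup>n\<close> are linearly independent
  on a set of more than \<open>n\<close> points.\<close>

definition regression_coefficients ::
  "'a measure \<Rightarrow> (real \<Rightarrow> 'a \<Rightarrow> real) \<Rightarrow> (nat \<Rightarrow> nat \<Rightarrow> real \<Rightarrow> real) \<Rightarrow> bool" where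
  "regression_coefficients M X \<gamma> \<longleftrightarrow>
     (\<forall>\<tau>>0. \<gamma> 0 0 \<tau> = 1) \<and>
     (\<forall>n::nat. 1 \<le> n \<and> enat n < support_size M X \<longrightarrow>
        (\<forall>\<tau>>0. \<gamma> n n \<tau> \<noteq> 0) \<and>
        (\<forall>s t. s < t \<longrightarrow> (AE \<omega> in M.
           real_cond_exp M (sigma_gen M X {..s}) (\<lambda>\<omega>'. X t \<omega>' ^ n) \<omega>
             = (\<Sum>j\<le>n. \<gamma> n j (t - s) * X s \<omega> ^ j))))"

definition regression_matrix :: "(nat \<Rightarrow> nat \<Rightarrow> real \<Rightarrow> real) \<Rightarrow> nat \<Rightarrow> real \<Rightarrow> real mat" where
  "regression_matrix \<gamma> n \<tau> =
     mat (n + 1) (n + 1) (\<lambda>(i, j). if j \<le> i then \<gamma> i j \<tau> else 0)"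

definition SMPR :: "'a measure \<Rightarrow> (real \<Rightarrow> 'a \<Rightarrow> real) \<Rightarrow> bool" where
  "SMPR M X \<longleftrightarrow>
     stationary_markov M X \<and>
     (\<forall>n::nat. integrable M (\<lambda>\<omega>. X 0 \<omega> ^ n)) \<and>
     identified_by_moments (marginal M X) \<and>
     TLD M X \<and>
     MSC M X \<and>
     (\<exists>\<gamma>. regression_coefficients M X \<gamma> \<and>
        (\<forall>n::nat. enat n < support_size M X \<longrightarrow>
           (\<forall>\<tau>>0. diagonalizable (regression_matrix \<gamma> n \<tau>))))"

definition correlation_system ::
  "'a measure \<Rightarrow> (real \<Rightarrow> 'a \<Rightarrow> real) \<Rightarrow> (nat \<Rightarrow> real) \<Rightarrow> (nat \<Rightarrow> real poly) \<Rightarrow> bool" where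
  "correlation_system M X \<alpha> p \<longleftrightarrow>
     \<alpha> 0 = 0 \<and>
     (\<forall>n::nat. enat n < support_size M X \<longrightarrow>
        degree (p n) = n \<and> lead_coeff (p n) = 1 \<and>
        (\<forall>s t. s < t \<longrightarrow> (AE \<omega> in M.
           real_cond_exp M (sigma_gen M X {..s}) (\<lambda>\<omega>'. poly (p n) (X t \<omega>')) \<omega>
             = exp (- \<alpha> n * (t - s)) * poly (p n) (X s \<omega>))))"

definition orthogonal_system ::
  "'a measure \<Rightarrow> (real \<Rightarrow> 'a \<Rightarrow> real) \<Rightarrow> (nat \<Rightarrow> real poly) \<Rightarrow> bool" where
  "orthogonal_system M X p \<longleftrightarrow>
     (\<forall>m n::nat. enat m < support_size M X \<and> enat n < support_size M X \<and> m \<noteq> n \<longrightarrow>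
        (\<integral>x. poly (p m) x * poly (p n) x \<partial>(marginal M X)) = 0)"

text \<open>The indices \<open>\<alpha> n\<close>, \<open>n < support_size M X\<close>, are determined by the process, but the
  polynomials are not when two indices coincide: if \<open>\<alpha> i = \<alpha> j\<close> with \<open>i < j\<close>, then \<open>p j\<close> may be
  replaced by \<open>p j + c p i\<close> for any \<open>c\<close>. Regularity asks that whatever polynomials satisfy the
  defining relations are orthogonal; this excludes such coincidences, for instance a process that
  is constant in time or one of the form \<open>R \<epsilon>\<^sub>t\<close> with \<open>R > 0\<close> random, independent of a symmetric
  two-point chain \<open>\<epsilon>\<close>.\<close>

definition RSMPR :: "'a measure \<Rightarrow> (real \<Rightarrow> 'a \<Rightarrow> real) \<Rightarrow> (nat \<Rightarrow> real) \<Rightarrow> bool" where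
  "RSMPR M X \<alpha> \<longleftrightarrow>
     SMPR M X \<and>
     (\<exists>p. correlation_system M X \<alpha> p) \<and>
     (\<forall>p. correlation_system M X \<alpha> p \<longrightarrow> orthogonal_system M X p)"

section \<open>Harnesses\<close>

text \<open>The degree is that of the polynomial expression; on a finite support several expressions
  represent the same function (on \<open>{-1, 1}\<close> the constant 1 is also \<open>x\<^sup>2\<close>).\<close>

definition r_harness :: "nat \<Rightarrow> 'a measure \<Rightarrow> (real \<Rightarrow> 'a \<Rightarrow> real) \<Rightarrow> bool" where
  "r_harness r M X \<longleftrightarrow>
     (\<forall>s t u. s < t \<and> t < u \<longrightarrow>
        (\<exists>c::nat \<Rightarrow> nat \<Rightarrow> real.
           (\<exists>i\<le>r. c i (r - i) \<noteq> 0) \<and>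
           (AE \<omega> in M.
              real_cond_exp M (sigma_gen M X (- {s<..<u})) (\<lambda>\<omega>'. X t \<omega>' ^ r) \<omega>
                = (\<Sum>i\<le>r. \<Sum>j\<le>r - i. c i j * X s \<omega> ^ i * X u \<omega> ^ j))))"

definition quadratic_harness :: "'a measure \<Rightarrow> (real \<Rightarrow> 'a \<Rightarrow> real) \<Rightarrow> bool" where
  "quadratic_harness M X \<longleftrightarrow> r_harness 1 M X \<and> r_harness 2 M X"

section \<open>The three families of processes\<close>

definition two_point_SMC :: "real \<Rightarrow> 'a measure \<Rightarrow> (real \<Rightarrow> 'a \<Rightarrow> real) \<Rightarrow> bool" where
  "two_point_SMC a M X \<longleftrightarrow>
     stationary_markov M X \<and>
     (\<forall>t. AE \<omega> in M. X t \<omega> \<in> {-1, 1}) \<and>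
     \<P>(\<omega> in M. X 0 \<omega> = 1) = 1 / 2 \<and>
     \<P>(\<omega> in M. X 0 \<omega> = -1) = 1 / 2 \<and>
     (\<forall>s t. s < t \<longrightarrow>
        \<P>(\<omega> in M. X t \<omega> = 1 \<bar> X s \<omega> = 1) = 1 / 2 + exp (- a * (t - s)) / 2 \<and>
        \<P>(\<omega> in M. X t \<omega> = -1 \<bar> X s \<omega> = -1) = 1 / 2 + exp (- a * (t - s)) / 2 \<and>
        \<P>(\<omega> in M. X t \<omega> = 1 \<bar> X s \<omega> = -1) = 1 / 2 - exp (- a * (t - s)) / 2 \<and>
        \<P>(\<omega> in M. X t \<omega> = -1 \<bar> X s \<omega> = 1) = 1 / 2 - exp (- a * (t - s)) / 2)"

definition gaussian_law :: "real measure \<Rightarrow> bool" where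
  "gaussian_law \<nu> \<longleftrightarrow>
     (\<exists>m. \<nu> = return borel m) \<or>
     (\<exists>m \<sigma>. \<sigma> > 0 \<and> \<nu> = density lborel (\<lambda>x. ennreal (normal_density m \<sigma> x)))"

definition gaussian_process :: "'a measure \<Rightarrow> (real \<Rightarrow> 'a \<Rightarrow> real) \<Rightarrow> bool" where
  "gaussian_process M X \<longleftrightarrow>
     prob_space M \<and> (\<forall>t. X t \<in> borel_measurable M) \<and>
     (\<forall>T c. finite T \<longrightarrow> gaussian_law (distr M borel (\<lambda>\<omega>. \<Sum>t\<in>T. c t * X t \<omega>)))"

text \<open>A centered Gaussian process whose covariance depends on \<open>\<bar>t - s\<bar>\<close> only is stationary.\<close>

definition ornstein_uhlenbeck :: "real \<Rightarrow> 'a measure \<Rightarrow> (real \<Rightarrow> 'a \<Rightarrow> real) \<Rightarrow> bool" where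
  "ornstein_uhlenbeck a M X \<longleftrightarrow>
     gaussian_process M X \<and>
     (\<forall>t. (\<integral>\<omega>. X t \<omega> \<partial>M) = 0) \<and>
     (\<forall>s t. covariance M (X s) (X t) = exp (- a * \<bar>t - s\<bar>) * (\<integral>\<omega>. (X 0 \<omega>)\<^sup>2 \<partial>M))"

definition q_int :: "real \<Rightarrow> nat \<Rightarrow> real" where
  "q_int q n = (\<Sum>i<n. q ^ i)"

definition q_fact :: "real \<Rightarrow> nat \<Rightarrow> real" where
  "q_fact q n = (\<Prod>i=1..n. q_int q i)"

fun q_hermite :: "real \<Rightarrow> nat \<Rightarrow> real \<Rightarrow> real" where
  "q_hermite q 0 x = 1"
| "q_hermite q (Suc 0) x = x"
| "q_hermite q (Suc (Suc n)) x =
     x * q_hermite q (Suc n) x - q_int q (Suc n) * q_hermite q n x"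

text \<open>The interval is bounded, so the orthogonality measure is unique and \<open>f\<close> is determined up to
  a Lebesgue null set.\<close>

definition q_normal_density :: "real \<Rightarrow> (real \<Rightarrow> real) \<Rightarrow> bool" where
  "q_normal_density q f \<longleftrightarrow>
     f \<in> borel_measurable borel \<and>
     (\<forall>x. 0 \<le> f x) \<and>
     (\<forall>x. x \<notin> {- 2 / sqrt (1 - q) .. 2 / sqrt (1 - q)} \<longrightarrow> f x = 0) \<and>
     prob_space (density lborel (\<lambda>x. ennreal (f x))) \<and>
     (\<forall>m n. m \<noteq> n \<longrightarrow> (\<integral>x. f x * (q_hermite q m x * q_hermite q n x) \<partial>lborel) = 0)"

definition q_cond_density ::
  "real \<Rightarrow> (real \<Rightarrow> real) \<Rightarrow> real \<Rightarrow> real \<Rightarrow> real \<Rightarrow> real" where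
  "q_cond_density q f \<rho> y x =
     f x * (\<Sum>n. \<rho> ^ n * q_hermite q n x * q_hermite q n y / q_fact q n)"

definition q_ornstein_uhlenbeck ::
  "real \<Rightarrow> real \<Rightarrow> 'a measure \<Rightarrow> (real \<Rightarrow> 'a \<Rightarrow> real) \<Rightarrow> bool" where
  "q_ornstein_uhlenbeck q a M X \<longleftrightarrow>
     stationary_markov M X \<and>
     (\<exists>f. q_normal_density q f \<and>
        marginal M X = density lborel (\<lambda>x. ennreal (f x)) \<and>
        (\<forall>s t. s < t \<longrightarrow>
           cond_law M X s t
             (\<lambda>y. density lborel (\<lambda>x. ennreal (q_cond_density q f (exp (- a * (t - s))) y x)))))"

end

theory Submission
  imports Defs
begin

text \<open>
  Regression of the process on its past is encoded by the orthogonal polynomials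
  \<open>p\<^sub>n\<close>, which are eigenfunctions with eigenvalue \<open>exp (- \<alpha>\<^sub>n \<tau>)\<close>, and by the recurrence
  \<open>x p\<^sub>n = p\<^sub>n\<^sub>+\<^sub>1 + a\<^sub>n p\<^sub>n + b\<^sub>n p\<^sub>n\<^sub>-\<^sub>1\<close>. Testing the two harness conditions against
  \<open>p\<^sub>m (X\<^sub>s) p\<^sub>n (X\<^sub>u)\<close> turns them into algebraic equations: the linear one gives
  \<open>\<alpha>\<^sub>n\<^sub>+\<^sub>1 = \<alpha>\<^sub>n \<plusminus> \<alpha>\<^sub>1\<close> and \<open>a\<^sub>n = 0\<close>, the quadratic one gives \<open>b\<^sub>n\<^sub>+\<^sub>1 = 1 + q b\<^sub>n\<close>, so that the
  \<open>p\<^sub>n\<close> are the q-Hermite polynomials. The value \<open>q > 1\<close> is excluded by a negative conditional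
  norm, and a finite support with at least three points because \<open>[n]\<^sub>q\<close> never vanishes for
  \<open>q > -1\<close>.

  Since \<open>[n]\<^sub>q \<le> n\<close>, all exponential moments are finite, and moments determine everything: the
  law of the pair \<open>(X\<^sub>s, X\<^sub>t)\<close>, hence the three families, and, conversely, the bridge, because the
  harness identities hold when tested against polynomials of \<open>X\<^sub>u\<close>. The martingale property of
  the \<open>p\<^sub>n\<close> carries the latter from \<open>X\<^sub>u\<close> to all later times.
\<close>

text \<open>Both directions meet in the locale \<open>q_process\<close>: the q-Hermite polynomials
  are eigenfunctions with exponents n\<alpha>, and those of positive degree have mean zero. For each
  of the three families the marginal law determines the orthogonal polynomials, and the given
  indices then fix their regression.

  A finite support would break this uniform picture. It is absorbed by working modulo functions that
  vanish almost surely, since a null function is an eigenfunction for every exponent. Thus q = -1 is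
  an ordinary case: [2]_q = 0 makes all q-Hermite polynomials of degree at least 2 null on {-1, 1}.

  Regularity enters as distinctness of the indices: if two of them agreed, p_j + p_i could replace
  p_j and orthogonality would fail. This decides the sign in the relation between successive
  indices, because a downward step would repeat an earlier index.

  Conditional expectations are used in weak form, tested against past variables with moments of all
  orders. The harness conditions become identities between numbers, and no exceptional sets have to
  be collected.\<close>

hide_const (open) Module.smult

section \<open>Random variables with moments of all orders\<close>

text \<open>Unlike integrability, this class is closed under products: |f g|^n is at most |f|^(2n) +
  |g|^(2n). Every product of polynomials, indicators and exponentials below is integrable by closure
  alone.\<close>

definition all_moments :: "'a measure \<Rightarrow> ('a \<Rightarrow> real) \<Rightarrow> bool" where
  "all_moments M f \<longleftrightarrow> f \<in> borel_measurable M \<and> (\<forall>n::nat. integrable M (\<lambda>\<omega>. \<bar>f \<omega>\<bar> ^ n))"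

lemma all_momentsD: "all_moments M f \<Longrightarrow> f \<in> borel_measurable M"
  by (simp add: all_moments_def)

lemma all_moments_integrable_power:
  assumes "all_moments M f" shows "integrable M (\<lambda>\<omega>. f \<omega> ^ n)"
proof (rule Bochner_Integration.integrable_bound)
  show "integrable M (\<lambda>\<omega>. \<bar>f \<omega>\<bar> ^ n)" using assms by (simp add: all_moments_def)
qed (use assms in \<open>auto simp: all_moments_def power_abs\<close>)

lemma all_moments_integrable: "all_moments M f \<Longrightarrow> integrable M f"
  using all_moments_integrable_power[of M f 1] by simp

lemma all_moments_bounded:
  assumes "finite_measure M" "f \<in> borel_measurable M" "\<And>\<omega>. \<bar>f \<omega>\<bar> \<le> B"
  shows "all_moments M f"
  unfolding all_moments_def
proof (intro conjI allI)
  interpret finite_measure M by fact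
  fix n :: nat
  have [measurable]: "f \<in> borel_measurable M" by fact
  show "integrable M (\<lambda>\<omega>. \<bar>f \<omega>\<bar> ^ n)"
    by (rule integrable_const_bound[where B="B ^ n"])
       (use assms in \<open>auto intro!: power_mono\<close>)
qed (use assms in auto)

lemma all_moments_const: "finite_measure M \<Longrightarrow> all_moments M (\<lambda>_. c)"
  by (rule all_moments_bounded[where B="\<bar>c\<bar>"]) auto

lemma all_moments_indicator:
  "finite_measure M \<Longrightarrow> A \<in> sets M \<Longrightarrow> all_moments M (indicator A)"
  by (rule all_moments_bounded[where B=1]) (auto simp: indicator_def)

lemma all_moments_mult:
  assumes "all_moments M f" "all_moments M g"
  shows "all_moments M (\<lambda>\<omega>. f \<omega> * g \<omega>)"
  unfolding all_moments_def
proof (intro conjI allI)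
  have [measurable]: "f \<in> borel_measurable M" "g \<in> borel_measurable M"
    using assms by (auto simp: all_moments_def)
  show "(\<lambda>\<omega>. f \<omega> * g \<omega>) \<in> borel_measurable M" by simp
  fix n :: nat
  have "integrable M (\<lambda>\<omega>. \<bar>f \<omega>\<bar> ^ (2 * n) + \<bar>g \<omega>\<bar> ^ (2 * n))"
    using assms by (auto simp: all_moments_def)
  then show "integrable M (\<lambda>\<omega>. \<bar>f \<omega> * g \<omega>\<bar> ^ n)"
  proof (rule Bochner_Integration.integrable_bound)
    show "AE \<omega> in M. norm (\<bar>f \<omega> * g \<omega>\<bar> ^ n) \<le> norm (\<bar>f \<omega>\<bar> ^ (2 * n) + \<bar>g \<omega>\<bar> ^ (2 * n))"
    proof (rule AE_I2)
      fix \<omega>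
      define a b where "a = \<bar>f \<omega>\<bar> ^ n" and "b = \<bar>g \<omega>\<bar> ^ n"
      have nn: "0 \<le> a" "0 \<le> b" by (auto simp: a_def b_def)
      have "0 \<le> (a - b)\<^sup>2" by simp
      then have "a * b \<le> a\<^sup>2 + b\<^sup>2"
        using nn mult_nonneg_nonneg[OF nn] unfolding power2_diff by linarith
      then show "norm (\<bar>f \<omega> * g \<omega>\<bar> ^ n) \<le> norm (\<bar>f \<omega>\<bar> ^ (2 * n) + \<bar>g \<omega>\<bar> ^ (2 * n))"
        by (simp add: a_def b_def abs_mult power_mult_distrib power_mult[symmetric] mult.commute)
    qed
  qed simp
qed

lemma all_moments_add:
  assumes "all_moments M f" "all_moments M g"
  shows "all_moments M (\<lambda>\<omega>. f \<omega> + g \<omega>)"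
  unfolding all_moments_def
proof (intro conjI allI)
  have [measurable]: "f \<in> borel_measurable M" "g \<in> borel_measurable M"
    using assms by (auto simp: all_moments_def)
  show "(\<lambda>\<omega>. f \<omega> + g \<omega>) \<in> borel_measurable M" by simp
  fix n :: nat
  have "integrable M (\<lambda>\<omega>. 2 ^ n * (\<bar>f \<omega>\<bar> ^ n + \<bar>g \<omega>\<bar> ^ n))"
    using assms by (auto simp: all_moments_def)
  then show "integrable M (\<lambda>\<omega>. \<bar>f \<omega> + g \<omega>\<bar> ^ n)"
  proof (rule Bochner_Integration.integrable_bound)
    show "AE \<omega> in M. norm (\<bar>f \<omega> + g \<omega>\<bar> ^ n) \<le> norm (2 ^ n * (\<bar>f \<omega>\<bar> ^ n + \<bar>g \<omega>\<bar> ^ n))"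
    proof (rule AE_I2)
      fix \<omega>
      define a b where "a = \<bar>f \<omega>\<bar>" and "b = \<bar>g \<omega>\<bar>"
      have nn: "0 \<le> a" "0 \<le> b" by (auto simp: a_def b_def)
      have "\<bar>f \<omega> + g \<omega>\<bar> ^ n \<le> (2 * max a b) ^ n"
        by (rule power_mono) (auto simp: a_def b_def)
      also have "\<dots> = 2 ^ n * (max a b) ^ n" by (simp add: power_mult_distrib)
      also have "\<dots> \<le> 2 ^ n * (a ^ n + b ^ n)"
        using nn by (intro mult_left_mono) (auto simp: max_def)
      finally show "norm (\<bar>f \<omega> + g \<omega>\<bar> ^ n) \<le> norm (2 ^ n * (\<bar>f \<omega>\<bar> ^ n + \<bar>g \<omega>\<bar> ^ n))"
        by (simp add: a_def b_def)
    qed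
  qed simp
qed

lemma all_moments_cmult:
  assumes "all_moments M f" shows "all_moments M (\<lambda>\<omega>. c * f \<omega>)"
  using assms unfolding all_moments_def
  by (auto simp: abs_mult power_mult_distrib)

lemma all_moments_uminus:
  "all_moments M f \<Longrightarrow> all_moments M (\<lambda>\<omega>. - f \<omega>)"
  using all_moments_cmult[of M f "-1"] by simp

lemma all_moments_diff:
  assumes "all_moments M f" "all_moments M g"
  shows "all_moments M (\<lambda>\<omega>. f \<omega> - g \<omega>)"
  using all_moments_add[OF assms(1) all_moments_uminus[OF assms(2)]] by simp

lemma all_moments_power:
  assumes "finite_measure M" "all_moments M f" shows "all_moments M (\<lambda>\<omega>. f \<omega> ^ k)"
proof (induction k)
  case (Suc k)
  then show ?case using all_moments_mult[OF assms(2)] by simp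
qed (simp add: all_moments_const assms)

lemma all_moments_sum:
  assumes "finite_measure M" "\<And>i. i \<in> I \<Longrightarrow> all_moments M (f i)"
  shows "all_moments M (\<lambda>\<omega>. \<Sum>i\<in>I. f i \<omega>)"
  using assms(2)
proof (induction I rule: infinite_finite_induct)
  case (insert x F)
  then show ?case using all_moments_add[of M "f x"] by simp
qed (simp_all add: all_moments_const assms)

lemma all_moments_poly:
  assumes "finite_measure M" "all_moments M f" shows "all_moments M (\<lambda>\<omega>. poly p (f \<omega>))"
proof (induction p)
  case (pCons a p)
  then show ?case
    using all_moments_add[OF all_moments_const[OF assms(1)] all_moments_mult[OF assms(2)]] by simp
qed (simp add: all_moments_const assms)

section \<open>Laws determined by their moments\<close>

text \<open>The uniform majorant that lets the exponential series be integrated term by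
  term.\<close>

lemma exp_partial_sum_norm_le:
  fixes z :: complex
  shows "norm (\<Sum>k<n. z ^ k / fact k) \<le> exp (norm z)"
proof -
  have "norm (\<Sum>k<n. z ^ k / fact k) \<le> (\<Sum>k<n. norm z ^ k / fact k)"
    by (rule order_trans[OF norm_sum]) (simp add: norm_divide norm_power)
  also have "\<dots> \<le> exp (norm z)"
    unfolding exp_def scaleR_conv_of_real
    by (simp add: divide_inverse mult.commute)
       (rule sum_le_suminf, use summable_exp[of "norm z"] in \<open>auto simp: mult.commute\<close>)
  finally show ?thesis .
qed

lemma integrable_mult_power_of_exp:
  fixes X Y :: "'a \<Rightarrow> real"
  assumes [measurable]: "X \<in> borel_measurable M" "Y \<in> borel_measurable M"
    and ex: "\<And>c. integrable M (\<lambda>\<omega>. Y \<omega> * exp (c * \<bar>X \<omega>\<bar>))"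
  shows "integrable M (\<lambda>\<omega>. Y \<omega> * X \<omega> ^ n)"
  proof (rule Bochner_Integration.integrable_bound)
    show "integrable M (\<lambda>\<omega>. fact n * (Y \<omega> * exp (1 * \<bar>X \<omega>\<bar>)))"
      by (intro integrable_mult_right ex)
    show "AE \<omega> in M. norm (Y \<omega> * X \<omega> ^ n) \<le> norm (fact n * (Y \<omega> * exp (1 * \<bar>X \<omega>\<bar>)))"
    proof (rule AE_I2)
      fix \<omega>
      have "\<bar>X \<omega>\<bar> ^ n / fact n \<le> exp \<bar>X \<omega>\<bar>"
      proof -
        have "(\<Sum>k\<in>{n}. \<bar>X \<omega>\<bar> ^ k / fact k) \<le> (\<Sum>k. \<bar>X \<omega>\<bar> ^ k / fact k)"
          by (rule sum_le_suminf) (use summable_exp[of "\<bar>X \<omega>\<bar>"] in \<open>auto simp: divide_inverse mult.commute\<close>)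
        then show ?thesis unfolding exp_def by (simp add: divide_inverse mult.commute)
      qed
      then have "\<bar>X \<omega>\<bar> ^ n \<le> fact n * exp \<bar>X \<omega>\<bar>" by (simp add: field_simps)
      then have "\<bar>Y \<omega>\<bar> * \<bar>X \<omega>\<bar> ^ n \<le> \<bar>Y \<omega>\<bar> * (fact n * exp \<bar>X \<omega>\<bar>)"
        by (intro mult_left_mono) auto
      then show "norm (Y \<omega> * X \<omega> ^ n) \<le> norm (fact n * (Y \<omega> * exp (1 * \<bar>X \<omega>\<bar>)))"
        by (simp add: abs_mult power_abs ac_simps)
    qed
  qed simp

text \<open>With all exponential moments, the Fourier transform of the signed law with weight
  \<open>Y\<close> is a power series in the weighted moments, so these moments determine it.
  Absolute summability is recorded for a Cauchy product with a Gaussian factor later on.\<close>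

lemma (in prob_space) char_moment_series:
  fixes X Y :: "'a \<Rightarrow> real"
  assumes [measurable]: "random_variable borel X" "random_variable borel Y"
    and ex: "\<And>c. integrable M (\<lambda>\<omega>. Y \<omega> * exp (c * \<bar>X \<omega>\<bar>))"
  shows "(\<lambda>k. (\<i> * of_real t) ^ k / fact k * of_real (expectation (\<lambda>\<omega>. Y \<omega> * X \<omega> ^ k))) sums
      (CLINT \<omega>|M. of_real (Y \<omega>) * iexp (t * X \<omega>))"
    and "summable (\<lambda>k. norm ((\<i> * of_real t) ^ k / fact k * complex_of_real (expectation (\<lambda>\<omega>. Y \<omega> * X \<omega> ^ k))))"
proof -
  note Xn = integrable_mult_power_of_exp[OF assms(1,2) ex]
  let ?s = "\<lambda>N \<omega>. of_real (Y \<omega>) * (\<Sum>k<N. (\<i> * of_real (t * X \<omega>)) ^ k / fact k)"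
  have sN: "?s N = (\<lambda>\<omega>. \<Sum>k<N. ((\<i> * of_real t) ^ k / fact k) * of_real (Y \<omega> * X \<omega> ^ k))" for N
    by (rule ext) (simp add: sum_distrib_left power_mult_distrib field_simps)
  have s0: "integral\<^sup>L M (?s N) = (\<Sum>k<N. (\<i> * of_real t) ^ k / fact k * of_real (expectation (\<lambda>\<omega>. Y \<omega> * X \<omega> ^ k)))" for N
    unfolding sN
    by (subst Bochner_Integration.integral_sum)
       (auto simp: Xn simp del: of_real_mult of_real_power intro!: integrable_mult_right integrable_of_real)
  have "(\<lambda>N. integral\<^sup>L M (?s N)) \<longlonglongrightarrow> (CLINT \<omega>|M. of_real (Y \<omega>) * iexp (t * X \<omega>))"
  proof (rule integral_dominated_convergence[where w="\<lambda>\<omega>. \<bar>Y \<omega> * exp (\<bar>t\<bar> * \<bar>X \<omega>\<bar>)\<bar>"])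
    show "integrable M (\<lambda>\<omega>. \<bar>Y \<omega> * exp (\<bar>t\<bar> * \<bar>X \<omega>\<bar>)\<bar>)" by (intro integrable_abs ex)
    show "AE \<omega> in M. (\<lambda>N. ?s N \<omega>) \<longlonglongrightarrow> of_real (Y \<omega>) * iexp (t * X \<omega>)"
    proof (rule AE_I2)
      fix \<omega>
      have "(\<lambda>k. (\<i> * of_real (t * X \<omega>)) ^ k / fact k) sums iexp (t * X \<omega>)"
        using exp_converges[of "\<i> * complex_of_real (t * X \<omega>)"]
        by (simp add: scaleR_conv_of_real divide_inverse mult.commute)
      then show "(\<lambda>N. ?s N \<omega>) \<longlonglongrightarrow> of_real (Y \<omega>) * iexp (t * X \<omega>)"
        unfolding sums_def by (intro tendsto_mult tendsto_const)
    qed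
    show "AE \<omega> in M. norm (?s N \<omega>) \<le> \<bar>Y \<omega> * exp (\<bar>t\<bar> * \<bar>X \<omega>\<bar>)\<bar>" for N
    proof (rule AE_I2)
      fix \<omega>
      show "norm (?s N \<omega>) \<le> \<bar>Y \<omega> * exp (\<bar>t\<bar> * \<bar>X \<omega>\<bar>)\<bar>"
        using exp_partial_sum_norm_le[where z="\<i> * of_real (t * X \<omega>)" and n=N]
        by (auto simp: norm_mult abs_mult intro!: mult_left_mono)
    qed
  qed measurable
  then show "(\<lambda>k. (\<i> * of_real t) ^ k / fact k * of_real (expectation (\<lambda>\<omega>. Y \<omega> * X \<omega> ^ k))) sums
      (CLINT \<omega>|M. of_real (Y \<omega>) * iexp (t * X \<omega>))"
    unfolding s0 sums_def .
  show "summable (\<lambda>k. norm ((\<i> * of_real t) ^ k / fact k * complex_of_real (expectation (\<lambda>\<omega>. Y \<omega> * X \<omega> ^ k))))"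
  proof (rule summableI_nonneg_bounded)
    fix n
    have i: "integrable M (\<lambda>\<omega>. \<bar>t\<bar> ^ k / fact k * \<bar>Y \<omega> * X \<omega> ^ k\<bar>)" for k
      by (intro integrable_mult_right integrable_abs Xn)
    have "(\<Sum>k<n. norm ((\<i> * of_real t) ^ k / fact k * complex_of_real (expectation (\<lambda>\<omega>. Y \<omega> * X \<omega> ^ k))))
      \<le> (\<Sum>k<n. expectation (\<lambda>\<omega>. \<bar>t\<bar> ^ k / fact k * \<bar>Y \<omega> * X \<omega> ^ k\<bar>))"
    proof (rule sum_mono)
      fix k
      have "\<bar>expectation (\<lambda>\<omega>. Y \<omega> * X \<omega> ^ k)\<bar> \<le> expectation (\<lambda>\<omega>. \<bar>Y \<omega> * X \<omega> ^ k\<bar>)"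
        by (rule integral_abs_bound)
      then have "\<bar>t\<bar> ^ k / fact k * \<bar>expectation (\<lambda>\<omega>. Y \<omega> * X \<omega> ^ k)\<bar> \<le> \<bar>t\<bar> ^ k / fact k * expectation (\<lambda>\<omega>. \<bar>Y \<omega> * X \<omega> ^ k\<bar>)"
        by (intro mult_left_mono) auto
      then show "norm ((\<i> * of_real t) ^ k / fact k * complex_of_real (expectation (\<lambda>\<omega>. Y \<omega> * X \<omega> ^ k)))
         \<le> expectation (\<lambda>\<omega>. \<bar>t\<bar> ^ k / fact k * \<bar>Y \<omega> * X \<omega> ^ k\<bar>)"
        by (simp add: norm_mult norm_divide norm_power)
    qed
    also have "\<dots> = expectation (\<lambda>\<omega>. \<Sum>k<n. \<bar>t\<bar> ^ k / fact k * \<bar>Y \<omega> * X \<omega> ^ k\<bar>)"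
      using i by (subst Bochner_Integration.integral_sum) auto
    also have "\<dots> \<le> expectation (\<lambda>\<omega>. \<bar>Y \<omega> * exp (\<bar>t\<bar> * \<bar>X \<omega>\<bar>)\<bar>)"
    proof (rule integral_mono)
      show "integrable M (\<lambda>\<omega>. \<bar>Y \<omega> * exp (\<bar>t\<bar> * \<bar>X \<omega>\<bar>)\<bar>)" by (intro integrable_abs ex)
      fix \<omega>
      have "(\<Sum>k<n. \<bar>t\<bar> ^ k / fact k * \<bar>Y \<omega> * X \<omega> ^ k\<bar>) = \<bar>Y \<omega>\<bar> * (\<Sum>k<n. (\<bar>t\<bar> * \<bar>X \<omega>\<bar>) ^ k / fact k)"
        by (simp add: sum_distrib_left abs_mult power_abs power_mult_distrib field_simps)
      also have "(\<Sum>k<n. (\<bar>t\<bar> * \<bar>X \<omega>\<bar>) ^ k / fact k) \<le> exp (\<bar>t\<bar> * \<bar>X \<omega>\<bar>)"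
        unfolding exp_def
        by (simp add: divide_inverse mult.commute)
          (rule sum_le_suminf, use summable_exp[of "\<bar>t\<bar> * \<bar>X \<omega>\<bar>"] in \<open>auto simp: mult.commute\<close>)
      finally show "(\<Sum>k<n. \<bar>t\<bar> ^ k / fact k * \<bar>Y \<omega> * X \<omega> ^ k\<bar>) \<le> \<bar>Y \<omega> * exp (\<bar>t\<bar> * \<bar>X \<omega>\<bar>)\<bar>"
        by (simp add: abs_mult mult_left_mono)
    qed (use i in auto)
    finally show "(\<Sum>k<n. norm ((\<i> * of_real t) ^ k / fact k * complex_of_real (expectation (\<lambda>\<omega>. Y \<omega> * X \<omega> ^ k))))
      \<le> expectation (\<lambda>\<omega>. \<bar>Y \<omega> * exp (\<bar>t\<bar> * \<bar>X \<omega>\<bar>)\<bar>)" .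
  qed simp
qed

text \<open>Levy uniqueness for a signed weight. The positive and negative parts of \<open>Y\<close>
  have the same transform, hence at t = 0 the same mass; divided by this mass they become
  probability weights with equal laws of \<open>X\<close>.\<close>

lemma (in prob_space) restricted_integral_zero_of_char:
  fixes X Y :: "'a \<Rightarrow> real"
  assumes [measurable]: "random_variable borel X" and Y: "integrable M Y"
    and ch: "\<And>t. (CLINT \<omega>|M. of_real (Y \<omega>) * iexp (t * X \<omega>)) = 0"
    and B[measurable]: "B \<in> sets borel"
  shows "expectation (\<lambda>\<omega>. Y \<omega> * indicator B (X \<omega>)) = 0"
proof -
  have [measurable]: "random_variable borel Y" using Y by simp
  define P N where "P = (\<lambda>\<omega>. max (Y \<omega>) 0)" and "N = (\<lambda>\<omega>. max (- Y \<omega>) 0)"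
  have [measurable]: "random_variable borel P" "random_variable borel N"
    by (simp_all add: P_def N_def)
  have PN: "Y \<omega> = P \<omega> - N \<omega>" "0 \<le> P \<omega>" "0 \<le> N \<omega>" for \<omega>
    by (auto simp: P_def N_def)
  have iP: "integrable M P" and iN: "integrable M N"
    unfolding P_def N_def using Y by (auto intro!: integrable_max)
  define m where "m = expectation P"
  have iw: "integrable M (\<lambda>\<omega>. of_real (F \<omega>) * iexp (t * X \<omega>))" if "integrable M F" for F t
    by (rule Bochner_Integration.integrable_bound[OF that]) (use that in \<open>auto simp: norm_mult\<close>)
  have chPN: "(CLINT \<omega>|M. of_real (P \<omega>) * iexp (t * X \<omega>)) = (CLINT \<omega>|M. of_real (N \<omega>) * iexp (t * X \<omega>))" for t
  proof -
    have "0 = (CLINT \<omega>|M. of_real (P \<omega>) * iexp (t * X \<omega>) - of_real (N \<omega>) * iexp (t * X \<omega>))"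
      unfolding ch[of t, symmetric] by (rule Bochner_Integration.integral_cong) (simp_all add: PN(1) algebra_simps)
    then show ?thesis using Bochner_Integration.integral_diff[OF iw[OF iP, of t] iw[OF iN, of t]] by simp
  qed
  have mN: "expectation N = m"
    using chPN[of 0] by (simp add: m_def)
  have ind: "integrable M (\<lambda>\<omega>. F \<omega> * indicator B (X \<omega>))" if "integrable M F" for F :: "'a \<Rightarrow> real"
    by (rule Bochner_Integration.integrable_bound[OF that]) (use that in \<open>auto simp: indicator_def\<close>)
  have "expectation (\<lambda>\<omega>. P \<omega> * indicator B (X \<omega>)) = expectation (\<lambda>\<omega>. N \<omega> * indicator B (X \<omega>))"
  \<comment> \<open>With mass zero there is nothing to normalize, but then both parts vanish almost
    surely.\<close>
  proof (cases "m = 0")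
    case True
    have "AE \<omega> in M. P \<omega> = 0" "AE \<omega> in M. N \<omega> = 0"
      using True mN integral_nonneg_eq_0_iff_AE[OF iP] integral_nonneg_eq_0_iff_AE[OF iN] PN
      by (auto simp: m_def)
    then have "AE \<omega> in M. P \<omega> * indicator B (X \<omega>) = N \<omega> * indicator B (X \<omega>)" by eventually_elim simp
    then show ?thesis by (intro integral_cong_AE) measurable
  next
    case False
    then have m: "0 < m" using PN(2) by (simp add: m_def order_less_le integral_nonneg)
    define Q where "Q F = distr (density M (\<lambda>\<omega>. ennreal (F \<omega> / m))) borel X" for F
    have Q: "real_distribution (Q F)" "char (Q F) t = (CLINT \<omega>|M. of_real (F \<omega>) * iexp (t * X \<omega>)) / of_real m"
      "measure (Q F) B = expectation (\<lambda>\<omega>. F \<omega> * indicator B (X \<omega>)) / m"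
      if F[measurable]: "random_variable borel F" "\<And>\<omega>. 0 \<le> F \<omega>" "integrable M F" "expectation F = m" for F t
    proof -
      have Fm: "AE \<omega> in M. 0 \<le> F \<omega> / m" using F m by simp
      have "emeasure (density M (\<lambda>\<omega>. ennreal (F \<omega> / m))) (space M) = (\<integral>\<^sup>+\<omega>. ennreal (F \<omega> / m) \<partial>M)"
        by (subst emeasure_density) (auto intro!: nn_integral_cong)
      also have "\<dots> = 1"
        using F m by (subst nn_integral_eq_integral) auto
      finally interpret D: prob_space "density M (\<lambda>\<omega>. ennreal (F \<omega> / m))"
        by (intro prob_spaceI) simp
      have mX: "X \<in> measurable (density M (\<lambda>\<omega>. ennreal (F \<omega> / m))) borel" by simp
      show "real_distribution (Q F)" unfolding Q_def
        by (rule D.real_distribution_distr) (rule mX)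
      show "char (Q F) t = (CLINT \<omega>|M. of_real (F \<omega>) * iexp (t * X \<omega>)) / of_real m"
        unfolding char_def Q_def
        by (subst integral_distr[OF mX], simp, subst integral_density[OF _ _ Fm])
           (simp_all add: scaleR_conv_of_real times_divide_eq_left)
      have "measure (Q F) B = (\<integral>x. indicator B x \<partial>(Q F))" by (simp add: Q_def)
      also have "\<dots> = expectation (\<lambda>\<omega>. F \<omega> * indicator B (X \<omega>)) / m"
        unfolding Q_def
        by (subst integral_distr[OF mX], simp, subst integral_density[OF _ _ Fm])
           (simp_all add: times_divide_eq_left)
      finally show "measure (Q F) B = expectation (\<lambda>\<omega>. F \<omega> * indicator B (X \<omega>)) / m" .
    qed
    have "Q P = Q N"
    proof (rule Levy_uniqueness)
      show "char (Q P) = char (Q N)"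
        using Q(2)[of P] Q(2)[of N] PN iP iN mN chPN by (simp add: fun_eq_iff m_def[symmetric])
    qed (use Q(1)[of P] Q(1)[of N] PN iP iN mN in \<open>simp_all add: m_def[symmetric]\<close>)
    moreover have "measure (Q P) B = expectation (\<lambda>\<omega>. P \<omega> * indicator B (X \<omega>)) / m"
      by (rule Q(3)) (simp_all add: PN iP m_def)
    moreover have "measure (Q N) B = expectation (\<lambda>\<omega>. N \<omega> * indicator B (X \<omega>)) / m"
      by (rule Q(3)) (simp_all add: PN iN mN)
    ultimately have "expectation (\<lambda>\<omega>. P \<omega> * indicator B (X \<omega>)) / m = expectation (\<lambda>\<omega>. N \<omega> * indicator B (X \<omega>)) / m"
      by (simp only:)
    then show ?thesis using m by simp
  qed
  then show ?thesis
    by (simp add: PN(1) left_diff_distrib ind iP iN)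
qed

text \<open>The weight may change sign on purpose: it will be the difference between a random
  variable and its conjectured conditional expectation, or a series whose sign is not known in
  advance.\<close>

lemma (in prob_space) restricted_integral_zero_of_moments:
  fixes X Y :: "'a \<Rightarrow> real"
  assumes [measurable]: "random_variable borel X" "random_variable borel Y"
    and ex: "\<And>c. integrable M (\<lambda>\<omega>. Y \<omega> * exp (c * \<bar>X \<omega>\<bar>))"
    and mom: "\<And>n. expectation (\<lambda>\<omega>. Y \<omega> * X \<omega> ^ n) = 0"
    and B[measurable]: "B \<in> sets borel"
  shows "expectation (\<lambda>\<omega>. Y \<omega> * indicator B (X \<omega>)) = 0"
proof (rule restricted_integral_zero_of_char)
  show "integrable M Y" using ex[of 0] by simp
  show "(CLINT \<omega>|M. of_real (Y \<omega>) * iexp (t * X \<omega>)) = 0" for t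
    using char_moment_series(1)[OF assms(1,2) ex, of t] by (simp add: mom sums_iff)
qed (rule assms)+

lemma restricted_integral_eq_of_moments:
  fixes X1 Y1 :: "'a \<Rightarrow> real" and X2 Y2 :: "'b \<Rightarrow> real"
  assumes "prob_space M1" "prob_space M2"
    and [measurable]: "X1 \<in> borel_measurable M1" "Y1 \<in> borel_measurable M1"
      "X2 \<in> borel_measurable M2" "Y2 \<in> borel_measurable M2"
    and ex1: "\<And>c. integrable M1 (\<lambda>\<omega>. Y1 \<omega> * exp (c * \<bar>X1 \<omega>\<bar>))"
    and ex2: "\<And>c. integrable M2 (\<lambda>\<omega>. Y2 \<omega> * exp (c * \<bar>X2 \<omega>\<bar>))"
    and mom: "\<And>n. (\<integral>\<omega>. Y1 \<omega> * X1 \<omega> ^ n \<partial>M1) = (\<integral>\<omega>. Y2 \<omega> * X2 \<omega> ^ n \<partial>M2)"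
    and B[measurable]: "B \<in> sets borel"
  shows "(\<integral>\<omega>. Y1 \<omega> * indicator B (X1 \<omega>) \<partial>M1) = (\<integral>\<omega>. Y2 \<omega> * indicator B (X2 \<omega>) \<partial>M2)"
proof -
  \<comment> \<open>A fair coin chooses one of the two spaces; giving the second a negative sign turns the claim
     into a statement about a single random variable.\<close>
  let ?b = "measure_pmf (bernoulli_pmf (1/2))"
  interpret M1: prob_space M1 by fact
  interpret M2: prob_space M2 by fact
  interpret P: pair_prob_space M1 M2 ..
  interpret W: pair_prob_space ?b "M1 \<Otimes>\<^sub>M M2" ..
  let ?W = "?b \<Otimes>\<^sub>M (M1 \<Otimes>\<^sub>M M2)"
  define mix :: "('a \<Rightarrow> real) \<Rightarrow> ('b \<Rightarrow> real) \<Rightarrow> bool \<times> 'a \<times> 'b \<Rightarrow> real" where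
    "mix f g = (\<lambda>(b, x, y). if b then f x else g y)" for f g
  have pb: "Measurable.pred ?W fst" by (rule measurable_compose[OF measurable_fst]) simp
  have mix_meas[measurable]: "mix f g \<in> borel_measurable ?W"
    if [measurable]: "f \<in> borel_measurable M1" "g \<in> borel_measurable M2" for f g
    unfolding mix_def case_prod_beta by (rule measurable_If) (use pb in \<open>simp_all add: pred_def\<close>)
  have i1: "integrable (M1 \<Otimes>\<^sub>M M2) (\<lambda>z. f (fst z))" "(\<integral>z. f (fst z) \<partial>(M1 \<Otimes>\<^sub>M M2)) = (\<integral>x. f x \<partial>M1)"
    if "integrable M1 f" for f :: "'a \<Rightarrow> real"
    using that integrable_distr_eq[of fst "M1 \<Otimes>\<^sub>M M2" M1 f] integral_distr[of fst "M1 \<Otimes>\<^sub>M M2" M1 f]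
    by (auto simp: M2.distr_pair_fst)
  have sn: "distr (M1 \<Otimes>\<^sub>M M2) M2 snd = M2"
  proof -
    interpret Q: pair_prob_space M2 M1 ..
    have "M2 = distr (M2 \<Otimes>\<^sub>M M1) M2 fst" by (simp add: M1.distr_pair_fst)
    also have "\<dots> = distr (distr (M1 \<Otimes>\<^sub>M M2) (M2 \<Otimes>\<^sub>M M1) (\<lambda>(x, y). (y, x))) M2 fst"
      by (simp add: Q.distr_pair_swap[symmetric])
    also have "\<dots> = distr (M1 \<Otimes>\<^sub>M M2) M2 snd"
      by (subst distr_distr) (auto simp: comp_def case_prod_beta)
    finally show ?thesis by simp
  qed
  have i2: "integrable (M1 \<Otimes>\<^sub>M M2) (\<lambda>z. f (snd z))" "(\<integral>z. f (snd z) \<partial>(M1 \<Otimes>\<^sub>M M2)) = (\<integral>x. f x \<partial>M2)"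
    if "integrable M2 f" for f :: "'b \<Rightarrow> real"
    using that integrable_distr_eq[of snd "M1 \<Otimes>\<^sub>M M2" M2 f] integral_distr[of snd "M1 \<Otimes>\<^sub>M M2" M2 f]
    by (auto simp: sn)
  have mix_int: "integrable ?W (mix f g)" if "integrable M1 f" "integrable M2 g" for f g
  proof (rule W.Fubini_integrable)
    show "mix f g \<in> borel_measurable ?W" using that by (intro mix_meas) auto
    show "integrable ?b (\<lambda>x. \<integral>y. norm (mix f g (x, y)) \<partial>(M1 \<Otimes>\<^sub>M M2))"
      by (rule integrable_measure_pmf_finite) simp
    have "integrable (M1 \<Otimes>\<^sub>M M2) (\<lambda>y. mix f g (x, y))" for x
      using i1(1)[OF that(1)] i2(1)[OF that(2)] by (cases x) (simp_all add: mix_def case_prod_beta)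
    then show "AE x in ?b. integrable (M1 \<Otimes>\<^sub>M M2) (\<lambda>y. mix f g (x, y))" by simp
  qed
  have mix_val: "integral\<^sup>L ?W (mix f g) = (integral\<^sup>L M1 f + integral\<^sup>L M2 g) / 2"
    if "integrable M1 f" "integrable M2 g" for f g
    using i1(2)[OF that(1)] i2(2)[OF that(2)]
    by (subst W.integral_fst'[OF mix_int[OF that], symmetric])
       (simp add: mix_def case_prod_beta integral_bernoulli_pmf field_simps)
  define X where "X = mix X1 X2"
  define Y where "Y = mix Y1 (\<lambda>x. - Y2 x)"
  have [measurable]: "X \<in> borel_measurable ?W" "Y \<in> borel_measurable ?W"
    by (simp_all add: X_def Y_def)
  have YX: "(\<lambda>\<omega>. Y \<omega> * h (X \<omega>)) = mix (\<lambda>x. Y1 x * h (X1 x)) (\<lambda>x. - (Y2 x * h (X2 x)))" for h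
    by (auto simp: X_def Y_def mix_def fun_eq_iff)
  have zero: "W.expectation (\<lambda>\<omega>. Y \<omega> * indicator B (X \<omega>)) = 0"
  proof (rule W.restricted_integral_zero_of_moments)
    show "integrable ?W (\<lambda>\<omega>. Y \<omega> * exp (c * \<bar>X \<omega>\<bar>))" for c
      unfolding YX[of "\<lambda>x. exp (c * \<bar>x\<bar>)"]
      using ex1[of c] ex2[of c] by (intro mix_int integrable_minus)
    show "W.expectation (\<lambda>\<omega>. Y \<omega> * X \<omega> ^ n) = 0" for n
      unfolding YX[of "\<lambda>x. x ^ n"]
      using integrable_mult_power_of_exp[OF assms(3,4) ex1, of n] integrable_mult_power_of_exp[OF assms(5,6) ex2, of n]
      by (subst mix_val) (simp_all add: mom)
  qed simp_all
  have i: "integrable M1 (\<lambda>\<omega>. Y1 \<omega> * indicator B (X1 \<omega>))" "integrable M2 (\<lambda>\<omega>. Y2 \<omega> * indicator B (X2 \<omega>))"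
    using ex1[of 0] ex2[of 0] by (auto elim!: Bochner_Integration.integrable_bound simp: indicator_def)
  show ?thesis
    using zero i unfolding YX[of "indicator B"]
    by (subst (asm) mix_val) simp_all
qed

section \<open>The support of a measure on the line\<close>

text \<open>By second countability the open null sets are covered by countably many null basis sets,
  and a point outside all of these lies in the support.\<close>

lemma AE_measure_support:
  assumes "sets \<mu> = sets borel"
  shows "AE x in \<mu>. x \<in> measure_support \<mu>"
proof -
  obtain \<B> :: "real set set" where B: "countable \<B>" "topological_basis \<B>"
    using ex_countable_basis by blast
  have "AE x in \<mu>. \<forall>U\<in>{U\<in>\<B>. emeasure \<mu> U = 0}. x \<notin> U"
  proof (subst AE_ball_countable)
    show "countable {U \<in> \<B>. emeasure \<mu> U = 0}" using B(1) by simp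
    show "\<forall>U\<in>{U \<in> \<B>. emeasure \<mu> U = 0}. AE x in \<mu>. x \<notin> U"
      using topological_basis_open[OF B(2)] by (auto intro!: AE_not_in simp: null_sets_def assms)
  qed
  then show ?thesis
  proof eventually_elim
    case (elim x)
    show ?case unfolding measure_support_def
    proof (intro CollectI allI impI)
      fix U :: "real set" assume U: "open U \<and> x \<in> U"
      then obtain V where V: "V \<in> \<B>" "x \<in> V" "V \<subseteq> U"
        using B(2) by (auto elim: topological_basisE)
      then have "emeasure \<mu> V \<noteq> 0" using elim by auto
      moreover have "emeasure \<mu> V \<le> emeasure \<mu> U"
        using V U by (intro emeasure_mono) (auto simp: assms)
      ultimately show "0 < emeasure \<mu> U" by (auto simp: less_le)
    qed
  qed
qed

lemma measure_support_subset_closed: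
  assumes "sets \<mu> = sets borel" "closed C" "AE x in \<mu>. x \<in> C"
  shows "measure_support \<mu> \<subseteq> C"
proof
  fix x assume x: "x \<in> measure_support \<mu>"
  show "x \<in> C"
  proof (rule ccontr)
    assume "x \<notin> C"
    then have "emeasure \<mu> (- C) > 0" using x assms(2) by (auto simp: measure_support_def)
    moreover have "emeasure \<mu> (- C) = 0"
    proof -
      have "{x \<in> space \<mu>. x \<notin> C} = - C" using sets_eq_imp_space_eq[OF assms(1)] by auto
      then show ?thesis
        using assms(2,3) by (subst (asm) AE_iff_measurable[where N="- C"]) (auto simp: assms(1))
    qed
    ultimately show False by simp
  qed
qed

section \<open>Generated sigma-algebras and processes with stationary marginals\<close>

lemma subalgebra_sigma_gen:
  assumes "\<And>t. X t \<in> borel_measurable M" shows "subalgebra M (sigma_gen M X T)"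
  unfolding subalgebra_def sigma_gen_def
  using assms by (auto intro!: sets.sigma_sets_subset measurable_sets simp: sets_measure_of_conv)

lemma sigma_gen_generators: "{X r -` B \<inter> space M | r B. r \<in> T \<and> B \<in> sets borel} \<subseteq> Pow (space M)"
  by auto

lemma space_sigma_gen [simp]: "space (sigma_gen M X T) = space M"
  by (simp add: sigma_gen_def space_measure_of_conv)

lemma sets_sigma_gen:
  "sets (sigma_gen M X T) = sigma_sets (space M) {X r -` B \<inter> space M | r B. r \<in> T \<and> B \<in> sets borel}"
  unfolding sigma_gen_def by (rule sets_measure_of) (rule sigma_gen_generators)

lemma measurable_sigma_gen_component:
  assumes "r \<in> T" shows "X r \<in> borel_measurable (sigma_gen M X T)"
proof (rule measurableI)
  fix B :: "real set" assume "B \<in> sets borel"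
  then show "X r -` B \<inter> space (sigma_gen M X T) \<in> sets (sigma_gen M X T)"
    using assms by (auto simp: sets_sigma_gen)
qed simp

lemma measurable_sigma_gen_mono:
  assumes "f \<in> borel_measurable (sigma_gen M X S)" "S \<subseteq> T"
  shows "f \<in> borel_measurable (sigma_gen M X T)"
proof -
  have "sets (sigma_gen M X S) \<subseteq> sets (sigma_gen M X T)"
    unfolding sets_sigma_gen by (rule sigma_sets_mono') (use assms(2) in blast)
  then show ?thesis using assms(1) by (auto simp: measurable_def)
qed

lemma sigma_finite_subalgebra_sigma_gen:
  assumes "prob_space M" "\<And>t. X t \<in> borel_measurable M"
  shows "sigma_finite_subalgebra M (sigma_gen M X T)"
proof -
  interpret prob_space M by fact
  show ?thesis
    by (rule finite_measure_subalgebra_is_sigma_finite)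
       (unfold_locales, rule subalgebra_sigma_gen[OF assms(2)])
qed

text \<open>One-dimensional stationarity only; different times will be linked solely through
  \<open>eigenfunction\<close>.\<close>

locale stationary_moments = prob_space M for M :: "'a measure" +
  fixes X :: "real \<Rightarrow> 'a \<Rightarrow> real"
  assumes X_measurable [measurable]: "\<And>t. X t \<in> borel_measurable M"
    and moments: "\<And>n::nat. integrable M (\<lambda>\<omega>. X 0 \<omega> ^ n)"
    and stationary: "\<And>t. distr M borel (X t) = distr M borel (X 0)"
begin

abbreviation "past s \<equiv> sigma_gen M X {..s}"

lemma subalgebra_past: "subalgebra M (sigma_gen M X T)"
  by (rule subalgebra_sigma_gen) simp

lemma past_measurable_M: "Z \<in> borel_measurable (sigma_gen M X T) \<Longrightarrow> Z \<in> borel_measurable M"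
  by (rule measurable_from_subalg[OF subalgebra_past])

lemma past_mono: "Z \<in> borel_measurable (past s) \<Longrightarrow> s \<le> t \<Longrightarrow> Z \<in> borel_measurable (past t)"
  by (erule measurable_sigma_gen_mono) auto

lemma X_past [simp]: "r \<le> s \<Longrightarrow> X r \<in> borel_measurable (past s)"
  by (rule measurable_sigma_gen_component) simp

lemma expectation_stationary:
  fixes g :: "real \<Rightarrow> real"
  assumes [measurable]: "g \<in> borel_measurable borel"
  shows "expectation (\<lambda>\<omega>. g (X t \<omega>)) = expectation (\<lambda>\<omega>. g (X 0 \<omega>))"
  using integral_distr[of "X t" M borel g] integral_distr[of "X 0" M borel g] stationary[of t] by simp

lemma integrable_stationary:
  fixes g :: "real \<Rightarrow> real"
  assumes [measurable]: "g \<in> borel_measurable borel"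
  shows "integrable M (\<lambda>\<omega>. g (X t \<omega>)) \<longleftrightarrow> integrable M (\<lambda>\<omega>. g (X 0 \<omega>))"
  using integrable_distr_eq[of "X t" M borel g] integrable_distr_eq[of "X 0" M borel g] stationary[of t] by simp

lemma AE_stationary:
  assumes "{x. P x} \<in> sets borel"
  shows "(AE \<omega> in M. P (X t \<omega>)) \<longleftrightarrow> (AE \<omega> in M. P (X 0 \<omega>))"
proof -
  have a: "(AE x in distr M borel (X r). P x) \<longleftrightarrow> (AE \<omega> in M. P (X r \<omega>))" for r
    using assms by (intro AE_distr_iff) auto
  show ?thesis unfolding a[symmetric] stationary[of t] ..
qed

lemma AE_marginal_iff:
  assumes "{x. P x} \<in> sets borel"
  shows "(AE x in marginal M X. P x) \<longleftrightarrow> (AE \<omega> in M. P (X 0 \<omega>))"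
  unfolding marginal_def using assms by (subst AE_distr_iff) auto

lemma all_moments_stationary:
  assumes [measurable]: "g \<in> borel_measurable borel" and am: "all_moments M (\<lambda>\<omega>. g (X 0 \<omega>))"
  shows "all_moments M (\<lambda>\<omega>. g (X t \<omega>))"
proof -
  have "integrable M (\<lambda>\<omega>. \<bar>g (X t \<omega>)\<bar> ^ n)" for n
    using integrable_stationary[of "\<lambda>x. \<bar>g x\<bar> ^ n" t] am by (simp add: all_moments_def)
  then show ?thesis by (simp add: all_moments_def)
qed

lemma all_moments_X: "all_moments M (X t)"
proof -
  have "integrable M (\<lambda>\<omega>. \<bar>X 0 \<omega>\<bar> ^ n)" for n
    using integrable_abs[OF moments[of n]] by (simp add: power_abs)
  then have "all_moments M (X 0)" by (simp add: all_moments_def)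
  then show ?thesis using all_moments_stationary[of "\<lambda>x. x"] by simp
qed

lemmas am_intros = all_moments_add all_moments_diff all_moments_mult all_moments_cmult all_moments_uminus
  all_moments_const[OF finite_measure_axioms] all_moments_power[OF finite_measure_axioms]
  all_moments_sum[OF finite_measure_axioms] all_moments_poly[OF finite_measure_axioms] all_moments_X

text \<open>The weak form of E(g(X_t) | past of s) = exp(-c (t - s)) g(X_s). The test variable
  ranges over the whole past and not just over functions of X_s; this is what later extends bridge
  identities to arbitrary past events.\<close>

definition eigenfunction :: "(real \<Rightarrow> real) \<Rightarrow> real \<Rightarrow> bool" where
  "eigenfunction g c \<longleftrightarrow> g \<in> borel_measurable borel \<and> all_moments M (\<lambda>\<omega>. g (X 0 \<omega>)) \<and>
     (\<forall>s t Z. s < t \<longrightarrow> Z \<in> borel_measurable (past s) \<longrightarrow> all_moments M Z \<longrightarrow>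
        expectation (\<lambda>\<omega>. Z \<omega> * g (X t \<omega>)) = exp (- c * (t - s)) * expectation (\<lambda>\<omega>. Z \<omega> * g (X s \<omega>)))"

lemma eigenfunction_all_moments:
  assumes "eigenfunction g c" shows "all_moments M (\<lambda>\<omega>. g (X t \<omega>))"
  using assms all_moments_stationary[of g] by (simp add: eigenfunction_def)

lemma eigenfunction_step:
  assumes "eigenfunction g c" "s \<le> t" "Z \<in> borel_measurable (past s)" "all_moments M Z"
  shows "expectation (\<lambda>\<omega>. Z \<omega> * g (X t \<omega>)) = exp (- c * (t - s)) * expectation (\<lambda>\<omega>. Z \<omega> * g (X s \<omega>))"
  using assms by (cases "s = t") (auto simp: eigenfunction_def)

lemma eigenfunction_of_cond_exp:
  assumes g[measurable]: "g \<in> borel_measurable borel" and am: "all_moments M (\<lambda>\<omega>. g (X 0 \<omega>))"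
    and ce: "\<And>s t. s < t \<Longrightarrow> AE \<omega> in M. real_cond_exp M (past s) (\<lambda>\<omega>. g (X t \<omega>)) \<omega> = exp (- c * (t - s)) * g (X s \<omega>)"
  shows "eigenfunction g c"
  unfolding eigenfunction_def
proof (intro conjI allI impI g am)
  fix s t :: real and Z assume st: "s < t" and Z: "Z \<in> borel_measurable (past s)" "all_moments M Z"
  interpret F: sigma_finite_subalgebra M "past s"
    by (rule sigma_finite_subalgebra_sigma_gen) (use prob_space_axioms in auto)
  have [measurable]: "Z \<in> borel_measurable M" using Z(1) by (rule past_measurable_M)
  have "all_moments M (\<lambda>\<omega>. g (X t \<omega>))" by (rule all_moments_stationary[OF g am])
  then have "integrable M (\<lambda>\<omega>. Z \<omega> * g (X t \<omega>))"
    by (intro all_moments_integrable all_moments_mult Z)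
  then have "expectation (\<lambda>\<omega>. Z \<omega> * g (X t \<omega>)) =
      expectation (\<lambda>\<omega>. Z \<omega> * real_cond_exp M (past s) (\<lambda>\<omega>. g (X t \<omega>)) \<omega>)"
    by (intro F.real_cond_exp_intg(2)[symmetric] Z) measurable
  also have "\<dots> = expectation (\<lambda>\<omega>. exp (- c * (t - s)) * (Z \<omega> * g (X s \<omega>)))"
  proof (rule integral_cong_AE)
    show "(\<lambda>\<omega>. Z \<omega> * real_cond_exp M (past s) (\<lambda>\<omega>. g (X t \<omega>)) \<omega>) \<in> borel_measurable M"
      by (intro borel_measurable_times borel_measurable_cond_exp2) fact
    show "AE \<omega> in M. Z \<omega> * real_cond_exp M (past s) (\<lambda>\<omega>. g (X t \<omega>)) \<omega> = exp (- c * (t - s)) * (Z \<omega> * g (X s \<omega>))"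
      using ce[OF st] by eventually_elim simp
  qed measurable
  finally show "expectation (\<lambda>\<omega>. Z \<omega> * g (X t \<omega>)) = exp (- c * (t - s)) * expectation (\<lambda>\<omega>. Z \<omega> * g (X s \<omega>))"
    by simp
qed

text \<open>By stationarity an almost sure identity at time 0 holds at every time. This allows the
  orthogonal polynomials to be exchanged for q-Hermite polynomials that agree with them on the
  support only.\<close>

lemma eigenfunction_cong_AE:
  assumes "eigenfunction g c" and h[measurable]: "h \<in> borel_measurable borel"
    and ae: "AE \<omega> in M. g (X 0 \<omega>) = h (X 0 \<omega>)"
  shows "eigenfunction h c"
proof -
  have [measurable]: "g \<in> borel_measurable borel" using assms(1) by (simp add: eigenfunction_def)
  have aet: "AE \<omega> in M. g (X t \<omega>) = h (X t \<omega>)" for t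
    using ae by (subst AE_stationary[of "\<lambda>x. g x = h x"]) auto
  show ?thesis unfolding eigenfunction_def
  proof (intro conjI allI impI h)
    have "integrable M (\<lambda>\<omega>. \<bar>h (X 0 \<omega>)\<bar> ^ n)" for n
    proof (rule integrable_cong_AE_imp)
      show "integrable M (\<lambda>\<omega>. \<bar>g (X 0 \<omega>)\<bar> ^ n)" using assms(1) by (auto simp: eigenfunction_def all_moments_def)
      show "AE \<omega> in M. \<bar>g (X 0 \<omega>)\<bar> ^ n = \<bar>h (X 0 \<omega>)\<bar> ^ n" using ae by eventually_elim simp
    qed simp
    then show "all_moments M (\<lambda>\<omega>. h (X 0 \<omega>))" by (auto simp: all_moments_def)
    fix s t :: real and Z assume st: "s < t" and Z: "Z \<in> borel_measurable (past s)" "all_moments M Z"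
    have [measurable]: "Z \<in> borel_measurable M" using Z(1) by (rule past_measurable_M)
    have "expectation (\<lambda>\<omega>. Z \<omega> * h (X r \<omega>)) = expectation (\<lambda>\<omega>. Z \<omega> * g (X r \<omega>))" for r
    proof (rule integral_cong_AE)
      show "AE \<omega> in M. Z \<omega> * h (X r \<omega>) = Z \<omega> * g (X r \<omega>)"
        using aet[of r] by eventually_elim simp
    qed measurable
    then show "expectation (\<lambda>\<omega>. Z \<omega> * h (X t \<omega>)) = exp (- c * (t - s)) * expectation (\<lambda>\<omega>. Z \<omega> * h (X s \<omega>))"
      using eigenfunction_step[OF assms(1), of s t Z] st Z by simp
  qed
qed

text \<open>Zero has every exponent, so from the support size on the indices can be continued at
  will.\<close>

lemma eigenfunction_null: "eigenfunction (\<lambda>_. 0) c"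
  by (simp add: eigenfunction_def all_moments_const[OF finite_measure_axioms])

end

text \<open>The recurrence is an almost sure identity so that it makes sense beyond a finite
  support. At n = 0 the truncated index \<open>n - 1\<close> is harmless because of
  \<open>b 0 = 0\<close>.\<close>

locale jacobi_process = stationary_moments +
  fixes P :: "nat \<Rightarrow> real \<Rightarrow> real" and ev :: "nat \<Rightarrow> real" and a b :: "nat \<Rightarrow> real"
  assumes eigen: "\<And>n. eigenfunction (P n) (ev n)"
    and recurrence: "\<And>n. AE \<omega> in M. X 0 \<omega> * P n (X 0 \<omega>) =
        P (Suc n) (X 0 \<omega>) + a n * P n (X 0 \<omega>) + b n * P (n - 1) (X 0 \<omega>)"
    and b_0 [simp]: "b 0 = 0"
begin

lemma P_measurable [measurable]: "P n \<in> borel_measurable borel"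
  using eigen[of n] by (simp add: eigenfunction_def)

lemma P_all_moments: "all_moments M (\<lambda>\<omega>. P n (X t \<omega>))"
  by (rule eigenfunction_all_moments[OF eigen])

lemma recurrence_t: "AE \<omega> in M. X t \<omega> * P n (X t \<omega>) =
    P (Suc n) (X t \<omega>) + a n * P n (X t \<omega>) + b n * P (n - 1) (X t \<omega>)"
  using recurrence[of n]
  by (subst AE_stationary[of "\<lambda>x. x * P n x = P (Suc n) x + a n * P n x + b n * P (n - 1) x"]) auto

lemma mult_X:
  assumes "all_moments M Z"
  shows "expectation (\<lambda>\<omega>. Z \<omega> * X t \<omega> * P n (X t \<omega>)) =
     expectation (\<lambda>\<omega>. Z \<omega> * P (Suc n) (X t \<omega>)) + a n * expectation (\<lambda>\<omega>. Z \<omega> * P n (X t \<omega>))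
      + b n * expectation (\<lambda>\<omega>. Z \<omega> * P (n - 1) (X t \<omega>))"
proof -
  have [measurable]: "Z \<in> borel_measurable M" using assms by (rule all_momentsD)
  have i: "integrable M (\<lambda>\<omega>. Z \<omega> * P k (X t \<omega>))" for k
    by (intro all_moments_integrable all_moments_mult assms P_all_moments)
  have "expectation (\<lambda>\<omega>. Z \<omega> * X t \<omega> * P n (X t \<omega>)) =
    expectation (\<lambda>\<omega>. Z \<omega> * P (Suc n) (X t \<omega>) + a n * (Z \<omega> * P n (X t \<omega>)) + b n * (Z \<omega> * P (n - 1) (X t \<omega>)))"
  proof (rule integral_cong_AE)
    show "AE \<omega> in M. Z \<omega> * X t \<omega> * P n (X t \<omega>) =
        Z \<omega> * P (Suc n) (X t \<omega>) + a n * (Z \<omega> * P n (X t \<omega>)) + b n * (Z \<omega> * P (n - 1) (X t \<omega>))"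
      using recurrence_t[of t n]
    proof eventually_elim
      case (elim \<omega>)
      have "Z \<omega> * X t \<omega> * P n (X t \<omega>) = Z \<omega> * (X t \<omega> * P n (X t \<omega>))" by simp
      then show ?case unfolding elim by (simp add: algebra_simps)
    qed
  qed measurable
  also have "\<dots> = expectation (\<lambda>\<omega>. Z \<omega> * P (Suc n) (X t \<omega>)) + a n * expectation (\<lambda>\<omega>. Z \<omega> * P n (X t \<omega>))
      + b n * expectation (\<lambda>\<omega>. Z \<omega> * P (n - 1) (X t \<omega>))"
    by (simp add: i)
  finally show ?thesis .
qed

lemma step:
  assumes "s \<le> t" "Z \<in> borel_measurable (past s)" "all_moments M Z"
  shows "expectation (\<lambda>\<omega>. Z \<omega> * P n (X t \<omega>)) = exp (- ev n * (t - s)) * expectation (\<lambda>\<omega>. Z \<omega> * P n (X s \<omega>))"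
  by (rule eigenfunction_step[OF eigen assms])

lemma step_X:
  assumes "s \<le> t" "Z \<in> borel_measurable (past s)" "all_moments M Z"
  shows "expectation (\<lambda>\<omega>. Z \<omega> * X t \<omega> * P n (X t \<omega>)) =
     exp (- ev (Suc n) * (t - s)) * expectation (\<lambda>\<omega>. Z \<omega> * P (Suc n) (X s \<omega>))
     + a n * (exp (- ev n * (t - s)) * expectation (\<lambda>\<omega>. Z \<omega> * P n (X s \<omega>)))
     + b n * (exp (- ev (n - 1) * (t - s)) * expectation (\<lambda>\<omega>. Z \<omega> * P (n - 1) (X s \<omega>)))"
  unfolding mult_X[OF assms(3)] using step[OF assms] by simp

text \<open>Two projections: Z X_t belongs to the past of t, so P_n(X_u) is first replaced by a
  multiple of P_n(X_t); the recurrence expands X_t P_n(X_t), and each resulting polynomial is then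
  carried from t down to s.\<close>

lemma bridge_X_mid:
  assumes "s \<le> t" "t \<le> u" "Z \<in> borel_measurable (past s)" "all_moments M Z"
  shows "expectation (\<lambda>\<omega>. Z \<omega> * X t \<omega> * P n (X u \<omega>)) = exp (- ev n * (u - t)) *
     (exp (- ev (Suc n) * (t - s)) * expectation (\<lambda>\<omega>. Z \<omega> * P (Suc n) (X s \<omega>))
     + a n * (exp (- ev n * (t - s)) * expectation (\<lambda>\<omega>. Z \<omega> * P n (X s \<omega>)))
     + b n * (exp (- ev (n - 1) * (t - s)) * expectation (\<lambda>\<omega>. Z \<omega> * P (n - 1) (X s \<omega>))))"
proof -
  have Z: "(\<lambda>\<omega>. Z \<omega> * X t \<omega>) \<in> borel_measurable (past t)"
    by (intro borel_measurable_times past_mono[OF assms(3,1)] X_past) simp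
  show ?thesis
    using step[OF assms(2) Z all_moments_mult[OF assms(4) all_moments_X]] step_X[OF assms(1,3,4)] by simp
qed

end

section \<open>Monic polynomial bases and orthogonality in the marginal law\<close>

definition monic_basis :: "(nat \<Rightarrow> real poly) \<Rightarrow> bool" where
  "monic_basis p \<longleftrightarrow> (\<forall>n. degree (p n) = n \<and> lead_coeff (p n) = 1)"

lemma monic_basis_0:
  assumes "monic_basis p" shows "p 0 = 1"
proof -
  have "degree (p 0) = 0" "lead_coeff (p 0) = 1" using assms unfolding monic_basis_def by metis+
  then show ?thesis by (auto elim!: degree_eq_zeroE simp: one_pCons)
qed

lemma monic_basis_span:
  assumes "monic_basis p" "degree q \<le> n"
  shows "\<exists>c. q = (\<Sum>k\<le>n. smult (c k) (p k))"
  using assms(2)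
proof (induction n arbitrary: q)
  case 0
  have "q = [:coeff q 0:]" using 0 by (auto elim!: degree_eq_zeroE)
  then have "q = (\<Sum>k\<le>0. smult (coeff q 0) (p k))" by (simp add: one_pCons monic_basis_0[OF assms(1)])
  then show ?case by (rule exI[of _ "\<lambda>_. coeff q 0"])
next
  case (Suc n)
  define r where "r = q - smult (coeff q (Suc n)) (p (Suc n))"
  have "degree r \<le> n"
  proof (rule degree_le, intro allI impI)
    fix i assume "n < i"
    have p: "degree (p (Suc n)) = Suc n" "coeff (p (Suc n)) (Suc n) = 1"
      using assms(1) unfolding monic_basis_def by metis+
    show "coeff r i = 0"
    proof (cases "i = Suc n")
      case False
      then have "coeff q i = 0" "coeff (p (Suc n)) i = 0"
        using Suc.prems p(1) \<open>n < i\<close> by (auto intro!: coeff_eq_0)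
      then show ?thesis by (simp add: r_def)
    qed (simp add: r_def p)
  qed
  then obtain c where c: "r = (\<Sum>k\<le>n. smult (c k) (p k))" using Suc.IH by blast
  have "q = (\<Sum>k\<le>Suc n. smult ((c(Suc n := coeff q (Suc n))) k) (p k))"
    using c by (simp add: r_def algebra_simps)
  then show ?case by blast
qed

lemma degree_X_mult_minus_monic:
  assumes "monic_basis p" shows "degree ([:0, 1:] * p n - p (Suc n)) \<le> n"
proof (rule degree_le, intro allI impI)
  fix i assume "n < i"
  have p: "degree (p k) = k" "coeff (p k) k = 1" for k
    using assms unfolding monic_basis_def by metis+
  have "coeff ([:0, 1:] * p n) i = coeff (p n) (i - 1)" using \<open>n < i\<close> by (cases i) auto
  moreover have "coeff (p n) (i - 1) = coeff (p (Suc n)) i"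
  proof (cases "i = Suc n")
    case False
    then have "coeff (p n) (i - 1) = 0" "coeff (p (Suc n)) i = 0"
      using p(1) \<open>n < i\<close> by (auto intro!: coeff_eq_0)
    then show ?thesis by simp
  qed (simp add: p)
  ultimately show "coeff ([:0, 1:] * p n - p (Suc n)) i = 0" by simp
qed

lemma borel_poly_zero: "{x. poly p x = (0 :: real)} \<in> sets borel"
  by (intro borel_closed closed_Collect_eq continuous_intros)

lemma borel_measurable_poly [measurable, simp]: "poly p \<in> borel_measurable (borel :: real measure)"
  by (intro borel_measurable_continuous_onI continuous_intros)

context stationary_moments
begin

definition mean :: "real poly \<Rightarrow> real" where
  "mean p = expectation (\<lambda>\<omega>. poly p (X 0 \<omega>))"

lemma integrable_poly: "integrable M (\<lambda>\<omega>. poly p (X t \<omega>))"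
  by (intro all_moments_integrable am_intros)

lemma mean_simps [simp]:
  "mean (p + q) = mean p + mean q" "mean (p - q) = mean p - mean q"
  "mean (smult c p) = c * mean p" "mean 0 = 0" "mean 1 = 1" "mean (- p) = - mean p"
  by (simp_all add: mean_def integrable_poly prob_space)

lemma mean_sum: "mean (\<Sum>k\<in>I. f k) = (\<Sum>k\<in>I. mean (f k))"
  by (induction I rule: infinite_finite_induct) simp_all

lemma mean_square_eq_0_iff: "mean (p * p) = 0 \<longleftrightarrow> (AE \<omega> in M. poly p (X 0 \<omega>) = 0)"
  unfolding mean_def
  by (subst integral_nonneg_eq_0_iff_AE[OF integrable_poly]) auto

lemma mean_square_nonneg: "0 \<le> mean (p * p)"
  unfolding mean_def by (rule Bochner_Integration.integral_nonneg) simp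

lemma mean_orth_lower:
  assumes "monic_basis p" "\<And>k. k < n \<Longrightarrow> mean (q * p k) = 0" "degree r < n"
  shows "mean (q * r) = 0"
proof -
  obtain c where c: "r = (\<Sum>k\<le>degree r. smult (c k) (p k))"
    using monic_basis_span[OF assms(1)] by blast
  have "mean (q * r) = (\<Sum>k\<le>degree r. c k * mean (q * p k))"
    by (subst c) (simp add: sum_distrib_left mean_sum)
  also have "\<dots> = 0" using assms(2,3) by (intro sum.neutral) auto
  finally show ?thesis .
qed

text \<open>Such an \<open>r\<close> is orthogonal to itself. The conclusion is almost sure, since
  on a finite support a nonzero polynomial may have norm zero.\<close>

lemma AE_zero_of_orth:
  assumes "monic_basis p" "degree r \<le> n" "\<And>k. k \<le> n \<Longrightarrow> mean (r * p k) = 0"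
  shows "AE \<omega> in M. poly r (X 0 \<omega>) = 0"
  using mean_orth_lower[OF assms(1), of "Suc n" r r] assms(2,3)
  by (simp add: mean_square_eq_0_iff[symmetric])

text \<open>The leading terms cancel in the difference, which is then orthogonal to all polynomials
  of its own degree.\<close>

lemma monic_orthogonal_unique:
  assumes p: "monic_basis p" "\<And>k. k < n \<Longrightarrow> mean (p n * p k) = 0"
    and q: "monic_basis q" "\<And>k. k < n \<Longrightarrow> mean (q n * q k) = 0"
  shows "AE \<omega> in M. poly (p n) (X 0 \<omega>) = poly (q n) (X 0 \<omega>)"
proof (cases n)
  case 0
  show ?thesis using 0 monic_basis_0[OF p(1)] monic_basis_0[OF q(1)] by simp
next
  case (Suc m)
  have "degree (p n - q n) \<le> m"
  proof (rule degree_le, intro allI impI)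
    fix i assume "m < i"
    have d: "degree (p n) = n" "coeff (p n) n = 1" "degree (q n) = n" "coeff (q n) n = 1"
      using p(1) q(1) unfolding monic_basis_def by metis+
    show "coeff (p n - q n) i = 0"
    proof (cases "i = n")
      case False
      then have "coeff (p n) i = 0" "coeff (q n) i = 0"
        using d \<open>m < i\<close> Suc by (auto intro!: coeff_eq_0)
      then show ?thesis by simp
    qed (simp add: d)
  qed
  then have "AE \<omega> in M. poly (p n - q n) (X 0 \<omega>) = 0"
  proof (rule AE_zero_of_orth[OF p(1)])
    fix k assume "k \<le> m"
    then have "k < n" "degree (p k) < n" using Suc p(1) by (auto simp: monic_basis_def)
    then show "mean ((p n - q n) * p k) = 0"
      using p(2)[of k] mean_orth_lower[OF q(1), of n "q n" "p k"] q(2)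
      by (simp add: left_diff_distrib)
  qed
  then show ?thesis by simp
qed

text \<open>If the mean square were zero, the support would consist of roots of \<open>p\<close>,
  and there are at most n of them.\<close>

lemma mean_pos_below_support_size:
  assumes "enat n < support_size M X" "p \<noteq> 0" "degree p \<le> n"
  shows "0 < mean (p * p)"
proof -
  have "mean (p * p) \<noteq> 0"
  proof
    assume "mean (p * p) = 0"
    then have "AE x in marginal M X. x \<in> {x. poly p x = 0}"
      by (subst AE_marginal_iff) (simp_all add: mean_square_eq_0_iff borel_poly_zero)
    moreover have fin: "finite {x. poly p x = 0}" using assms(2) by (rule poly_roots_finite)
    ultimately have sub: "measure_support (marginal M X) \<subseteq> {x. poly p x = 0}"
      by (intro measure_support_subset_closed) (simp_all add: marginal_def finite_imp_closed)
    have "finite (measure_support (marginal M X))" by (rule finite_subset[OF sub fin])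
    moreover have "card (measure_support (marginal M X)) \<le> n"
      using card_mono[OF fin sub] card_poly_roots_bound[OF assms(2)] assms(3) by linarith
    ultimately show False using assms(1) by (simp add: support_size_def)
  qed
  then show ?thesis using mean_square_nonneg[of p] by simp
qed

lemma vanishing_poly:
  assumes "support_size M X = enat N"
  shows "\<exists>p. degree p = N \<and> lead_coeff p = 1 \<and> (AE \<omega> in M. poly p (X 0 \<omega>) = 0)"
proof (intro exI conjI)
  let ?S = "measure_support (marginal M X)"
  let ?p = "\<Prod>x\<in>?S. [:- x, 1:]"
  have S: "finite ?S" "card ?S = N" using assms by (auto simp: support_size_def split: if_splits)
  show "degree ?p = N"
    by (subst degree_prod_eq_sum_degree) (auto simp: S)
  show "lead_coeff ?p = 1" by (simp add: lead_coeff_prod)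
  have "AE x in marginal M X. x \<in> ?S"
    by (rule AE_measure_support) (simp add: marginal_def)
  then have "AE x in marginal M X. poly ?p x = 0"
    by eventually_elim (auto simp: poly_prod S(1))
  then show "AE \<omega> in M. poly ?p (X 0 \<omega>) = 0"
    by (subst (asm) AE_marginal_iff) (simp_all add: borel_poly_zero)
qed

text \<open>From the support size on, the polynomials are continued by multiples of the polynomial that
  vanishes on the support, so that no case distinction on the size is needed later.\<close>

lemma orthogonal_extension:
  assumes cs: "correlation_system M X \<alpha> p" and os: "orthogonal_system M X p"
  obtains P where "monic_basis P" "\<And>n. enat n < support_size M X \<Longrightarrow> P n = p n"
    "\<And>n. eigenfunction (poly (P n)) (\<alpha> n)" "\<And>m n. m \<noteq> n \<Longrightarrow> mean (P m * P n) = 0"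
    "\<And>n. 0 < mean (P n * P n) \<longleftrightarrow> enat n < support_size M X"
    "\<And>n. \<not> enat n < support_size M X \<Longrightarrow> AE \<omega> in M. poly (P n) (X 0 \<omega>) = 0"
proof -
  have p: "degree (p n) = n" "lead_coeff (p n) = 1" if "enat n < support_size M X" for n
    using cs that by (auto simp: correlation_system_def)
  have "\<exists>z. \<forall>n. \<not> enat n < support_size M X \<longrightarrow>
      degree (z n) = n \<and> lead_coeff (z n) = 1 \<and> (AE \<omega> in M. poly (z n) (X 0 \<omega>) = 0)"
  proof (cases "support_size M X")
    case (enat N)
    then obtain w where w: "degree w = N" "lead_coeff w = 1" "AE \<omega> in M. poly w (X 0 \<omega>) = 0"
      using vanishing_poly by blast
    show ?thesis
    proof (intro exI[of _ "\<lambda>n. monom 1 (n - N) * w"] allI impI conjI)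
      fix n assume "\<not> enat n < support_size M X"
      then have "N \<le> n" using enat by simp
      have "w \<noteq> 0" using w(2) by auto
      then show "degree (monom 1 (n - N) * w) = n"
        using \<open>N \<le> n\<close> w(1) by (simp add: degree_mult_eq degree_monom_eq)
      show "lead_coeff (monom 1 (n - N) * w) = 1"
        by (simp only: lead_coeff_mult w(2) lead_coeff_monom)
      show "AE \<omega> in M. poly (monom 1 (n - N) * w) (X 0 \<omega>) = 0"
        using w(3) by eventually_elim simp
    qed
  qed auto
  then obtain z where z: "\<And>n. \<not> enat n < support_size M X \<Longrightarrow>
      degree (z n) = n \<and> lead_coeff (z n) = 1 \<and> (AE \<omega> in M. poly (z n) (X 0 \<omega>) = 0)"
    by blast
  define P where "P n = (if enat n < support_size M X then p n else z n)" for n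
  have mb: "monic_basis P" unfolding monic_basis_def
  proof
    show "degree (P n) = n \<and> lead_coeff (P n) = 1" for n
      unfolding P_def using p[of n] z[of n] by metis
  qed
  have van: "AE \<omega> in M. poly (P n) (X 0 \<omega>) = 0" if "\<not> enat n < support_size M X" for n
    using z that by (simp add: P_def)
  show ?thesis
  proof (rule that[OF mb])
    show "P n = p n" if "enat n < support_size M X" for n using that by (simp add: P_def)
    show "eigenfunction (poly (P n)) (\<alpha> n)" for n
    proof (cases "enat n < support_size M X")
      case True
      then show ?thesis
        using cs by (intro eigenfunction_of_cond_exp am_intros) (auto simp: correlation_system_def P_def)
    next
      case False
      have "AE \<omega> in M. 0 = poly (P n) (X 0 \<omega>)" using van[OF False] by eventually_elim simp
      then show ?thesis using eigenfunction_cong_AE[OF eigenfunction_null] by simp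
    qed
    show "AE \<omega> in M. poly (P n) (X 0 \<omega>) = 0" if "\<not> enat n < support_size M X" for n
      using van that .
    have z0: "mean (P m * P n) = 0" if "\<not> enat m < support_size M X" for m n
      unfolding mean_def
    proof (rule integral_eq_zero_AE)
      show "AE \<omega> in M. poly (P m * P n) (X 0 \<omega>) = 0"
        using van[OF that] by eventually_elim simp
    qed
    show "mean (P m * P n) = 0" if "m \<noteq> n" for m n
    proof (cases "enat m < support_size M X \<and> enat n < support_size M X")
      case True
      then have "(\<integral>x. poly (p m) x * poly (p n) x \<partial>(marginal M X)) = 0"
        using os that by (simp add: orthogonal_system_def)
      then show ?thesis using True by (simp add: mean_def marginal_def integral_distr P_def)
    next
      case False
      then show ?thesis using z0[of m n] z0[of n m] by (auto simp: mult.commute)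
    qed
    show "0 < mean (P n * P n) \<longleftrightarrow> enat n < support_size M X" for n
      using z0[of n n] mean_pos_below_support_size[of n "P n"] mb unfolding monic_basis_def
      by (metis leading_coeff_0_iff less_irrefl order_refl zero_neq_one)
  qed
qed

text \<open>After subtraction of the three terms a polynomial of degree at most n remains. It is
  orthogonal to P_k for k < n - 1 because x P_k still has degree below n, and the quotients
  \<open>a n\<close> and \<open>b n\<close> are chosen to settle k = n and k = n - 1.\<close>

lemma three_term_recurrence:
  assumes P: "monic_basis P" and orth: "\<And>m n. m \<noteq> n \<Longrightarrow> mean (P m * P n) = 0"
    and z0: "\<And>n. mean (P n * P n) = 0 \<Longrightarrow> mean (P (Suc n) * P (Suc n)) = 0"
  defines "a n \<equiv> mean ([:0, 1:] * P n * P n) / mean (P n * P n)"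
    and "b n \<equiv> (if n = 0 then 0 else mean (P n * P n) / mean (P (n - 1) * P (n - 1)))"
  shows "AE \<omega> in M. X 0 \<omega> * poly (P n) (X 0 \<omega>) =
     poly (P (Suc n)) (X 0 \<omega>) + a n * poly (P n) (X 0 \<omega>) + b n * poly (P (n - 1)) (X 0 \<omega>)"
proof (cases "mean (P n * P n) = 0")
  case True
  \<comment> \<open>For n > 0 the numerator of \<open>b n\<close> is the vanishing norm; for n = 0
    the value is 0 by convention.\<close>
  have bz: "AE \<omega> in M. b n * poly (P (n - 1)) (X 0 \<omega>) = 0"
    using True by (simp add: b_def)
  have "AE \<omega> in M. poly (P n) (X 0 \<omega>) = 0" "AE \<omega> in M. poly (P (Suc n)) (X 0 \<omega>) = 0"
    using True z0 by (simp_all only: mean_square_eq_0_iff)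
  with bz show ?thesis by eventually_elim simp
next
  case False
  let ?x = "[:0, 1:] :: real poly"
  have deg: "degree (P k) = k" for k using P by (simp add: monic_basis_def)
  define r where "r = ?x * P n - P (Suc n) - smult (a n) (P n) - smult (b n) (P (n - 1))"
  have low: "mean (P k * q) = 0" if "degree q < k" for k q
    using mean_orth_lower[OF P _ that] orth by auto
  have "AE \<omega> in M. poly r (X 0 \<omega>) = 0"
  proof (rule AE_zero_of_orth[OF P])
    show "degree r \<le> n"
      unfolding r_def
      by (intro degree_diff_le degree_X_mult_minus_monic[OF P] order_trans[OF degree_smult_le]) (auto simp: deg)
    fix k assume k: "k \<le> n"
    have r: "mean (r * P k) = mean (?x * P n * P k) - a n * mean (P n * P k) - b n * mean (P (n - 1) * P k)"
      using k orth[of "Suc n" k] by (simp add: r_def algebra_simps)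
    consider "k = n" | "n = Suc k" | "Suc k < n" using k by linarith
    then show "mean (r * P k) = 0"
    proof cases
      case 1
      then have "b n * mean (P (n - 1) * P k) = 0" using orth[of "n - 1" n] by (cases n) (auto simp: b_def)
      then show ?thesis using 1 False unfolding r by (auto simp: a_def)
    next
      case 2
      \<comment> \<open>For n = k + 1 the polynomial x P_k agrees with P_n up to lower degree, so
        the mean of x P_n P_k is the norm of P_n.\<close>
      have e: "?x * P n * P k = P n * P n + P n * (?x * P k - P (Suc k))"
        using 2 by (simp add: algebra_simps)
      have "mean (?x * P n * P k) = mean (P n * P n)"
        unfolding e using low[of "?x * P k - P (Suc k)" n] degree_X_mult_minus_monic[OF P, of k] 2 by simp
      moreover have "mean (P k * P k) \<noteq> 0" using z0[of k] False 2 by auto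
      ultimately show ?thesis using 2 orth[of n k] unfolding r by (simp add: b_def)
    next
      case 3
      have e: "?x * P n * P k = P n * (?x * P k)" by (simp add: algebra_simps)
      have "degree (?x * P k) \<le> Suc k" using degree_mult_le[of ?x "P k"] deg by simp
      then have "mean (?x * P n * P k) = 0" unfolding e using 3 by (intro low) linarith
      then show ?thesis using 3 orth[of n k] orth[of "n - 1" k] unfolding r by simp
    qed
  qed
  then show ?thesis by eventually_elim (simp add: r_def)
qed

end

section \<open>Processes with linear correlation indices\<close>

text \<open>Used first for the orthogonal polynomials with still unknown coefficients
  \<open>b\<close>, and then for the q-Hermite polynomials with \<open>b n\<close> = [n]_q.\<close>

locale linear_jacobi = jacobi_process M X P "\<lambda>n. real n * \<alpha>" "\<lambda>_. 0" b
  for M :: "'a measure" and X :: "real \<Rightarrow> 'a \<Rightarrow> real" and P :: "nat \<Rightarrow> real \<Rightarrow> real"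
    and \<alpha> :: real and b :: "nat \<Rightarrow> real"
begin

lemma linear_step:
  assumes "s \<le> t" "Z \<in> borel_measurable (past s)" "all_moments M Z"
  shows "expectation (\<lambda>\<omega>. Z \<omega> * P n (X t \<omega>)) = exp (- \<alpha> * (t - s)) ^ n * expectation (\<lambda>\<omega>. Z \<omega> * P n (X s \<omega>))"
proof -
  have "exp (- (real n * \<alpha>) * (t - s)) = exp (- \<alpha> * (t - s)) ^ n"
    by (simp add: exp_of_nat_mult[symmetric] algebra_simps)
  then show ?thesis using step[OF assms, of n] by simp
qed

lemma mult_X_linear:
  assumes "all_moments M Z"
  shows "expectation (\<lambda>\<omega>. Z \<omega> * X t \<omega> * P n (X t \<omega>)) =
     expectation (\<lambda>\<omega>. Z \<omega> * P (Suc n) (X t \<omega>)) + b n * expectation (\<lambda>\<omega>. Z \<omega> * P (n - 1) (X t \<omega>))"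
  using mult_X[OF assms] by simp

text \<open>For n = 0 and n = 1 the truncated index \<open>n - 2\<close> does no harm: the product
  \<open>b n * b (n - 1)\<close> contains the factor \<open>b 0\<close>.\<close>

lemma mult_X_square:
  assumes "all_moments M Z"
  shows "expectation (\<lambda>\<omega>. Z \<omega> * X t \<omega> * X t \<omega> * P n (X t \<omega>)) =
     expectation (\<lambda>\<omega>. Z \<omega> * P (n + 2) (X t \<omega>)) + (b (Suc n) + b n) * expectation (\<lambda>\<omega>. Z \<omega> * P n (X t \<omega>))
      + b n * b (n - 1) * expectation (\<lambda>\<omega>. Z \<omega> * P (n - 2) (X t \<omega>))"
  using mult_X_linear[OF all_moments_mult[OF assms all_moments_X[of t]], of t n]
    mult_X_linear[OF assms, of t "Suc n"] mult_X_linear[OF assms, of t "n - 1"]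
  by (cases n) (simp_all add: algebra_simps numeral_2_eq_2)

context
  fixes s t u :: real and Z
  assumes st: "s \<le> t" and tu: "t \<le> u" and Z: "Z \<in> borel_measurable (past s)" "all_moments M Z"
begin

lemma ZX_past: "(\<lambda>\<omega>. Z \<omega> * X r \<omega>) \<in> borel_measurable (past t)" if "r \<le> t"
  by (intro borel_measurable_times past_mono[OF Z(1) st] X_past that)

lemma bridge_1:
  "expectation (\<lambda>\<omega>. Z \<omega> * X t \<omega> * P n (X u \<omega>)) = exp (- \<alpha> * (u - t)) ^ n *
     (exp (- \<alpha> * (t - s)) ^ Suc n * expectation (\<lambda>\<omega>. Z \<omega> * P (Suc n) (X s \<omega>))
     + b n * (exp (- \<alpha> * (t - s)) ^ (n - 1) * expectation (\<lambda>\<omega>. Z \<omega> * P (n - 1) (X s \<omega>))))"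
  unfolding linear_step[OF tu ZX_past[OF order_refl] all_moments_mult[OF Z(2) all_moments_X]]
    mult_X_linear[OF Z(2)] linear_step[OF st Z] by simp

lemma bridge_2:
  "expectation (\<lambda>\<omega>. Z \<omega> * X t \<omega> * X t \<omega> * P n (X u \<omega>)) = exp (- \<alpha> * (u - t)) ^ n *
     (exp (- \<alpha> * (t - s)) ^ (n + 2) * expectation (\<lambda>\<omega>. Z \<omega> * P (n + 2) (X s \<omega>))
     + (b (Suc n) + b n) * (exp (- \<alpha> * (t - s)) ^ n * expectation (\<lambda>\<omega>. Z \<omega> * P n (X s \<omega>)))
     + b n * b (n - 1) * (exp (- \<alpha> * (t - s)) ^ (n - 2) * expectation (\<lambda>\<omega>. Z \<omega> * P (n - 2) (X s \<omega>))))"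
proof -
  have m: "(\<lambda>\<omega>. Z \<omega> * X t \<omega> * X t \<omega>) \<in> borel_measurable (past t)"
    by (intro borel_measurable_times[OF ZX_past] X_past) simp_all
  show ?thesis
    unfolding linear_step[OF tu m all_moments_mult[OF all_moments_mult[OF Z(2) all_moments_X] all_moments_X]]
      mult_X_square[OF Z(2)] linear_step[OF st Z] by simp
qed

text \<open>The factor X_u is absorbed by the recurrence at time u, after which
  \<open>bridge_1\<close> applies twice. With t = s this is the mixed term of a quadratic
  bridge.\<close>

lemma bridge_11:
  "expectation (\<lambda>\<omega>. Z \<omega> * X t \<omega> * X u \<omega> * P n (X u \<omega>)) =
     exp (- \<alpha> * (u - t)) ^ Suc n *
       (exp (- \<alpha> * (t - s)) ^ (n + 2) * expectation (\<lambda>\<omega>. Z \<omega> * P (n + 2) (X s \<omega>))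
         + b (Suc n) * (exp (- \<alpha> * (t - s)) ^ n * expectation (\<lambda>\<omega>. Z \<omega> * P n (X s \<omega>))))
     + b n * (exp (- \<alpha> * (u - t)) ^ (n - 1) *
       (exp (- \<alpha> * (t - s)) ^ n * expectation (\<lambda>\<omega>. Z \<omega> * P n (X s \<omega>))
         + b (n - 1) * (exp (- \<alpha> * (t - s)) ^ (n - 2) * expectation (\<lambda>\<omega>. Z \<omega> * P (n - 2) (X s \<omega>)))))"
proof -
  have "expectation (\<lambda>\<omega>. Z \<omega> * X t \<omega> * X u \<omega> * P n (X u \<omega>)) =
     expectation (\<lambda>\<omega>. Z \<omega> * X t \<omega> * P (Suc n) (X u \<omega>)) + b n * expectation (\<lambda>\<omega>. Z \<omega> * X t \<omega> * P (n - 1) (X u \<omega>))"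
    by (rule mult_X_linear[OF all_moments_mult[OF Z(2) all_moments_X]])
  then show ?thesis unfolding bridge_1
    by (cases n) (simp_all add: numeral_2_eq_2)
qed

end

end

section \<open>The q-Hermite polynomials\<close>

lemma q_int_0 [simp]: "q_int q 0 = 0"
  by (simp add: q_int_def)

lemma q_int_Suc: "q_int q (Suc n) = 1 + q * q_int q n"
  unfolding q_int_def by (subst sum.lessThan_Suc_shift) (simp add: sum_distrib_left)

lemma q_int_1 [simp]: "q_int q (Suc 0) = 1"
  by (simp add: q_int_Suc)

text \<open>For q in [-1, 0] the map y \<mapsto> 1 + q y sends [0, 1] into itself.\<close>

lemma q_int_bounds:
  assumes "-1 \<le> q" "q \<le> 0" shows "0 \<le> q_int q n \<and> q_int q n \<le> 1"
proof (induction n)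
  case (Suc n)
  have "q * q_int q n \<le> 0" using assms Suc by (simp add: mult_nonpos_nonneg)
  moreover have "- 1 \<le> q * q_int q n"
    using mult_mono[of "- q" 1 "q_int q n" 1] assms Suc by simp
  ultimately show ?case by (simp add: q_int_Suc)
qed simp

lemma q_int_nonneg: "-1 \<le> q \<Longrightarrow> 0 \<le> q_int q n"
proof (cases "q \<le> 0")
  case False
  then show ?thesis by (simp add: q_int_def sum_nonneg)
qed (use q_int_bounds in blast)

text \<open>Strict positivity is what will rule out finite supports with more than two points; it
  breaks down at q = -1, where [2]_q = 0.\<close>

lemma q_int_pos:
  assumes "-1 < q" shows "0 < q_int q (Suc n)"
proof (cases "q \<le> 0")
  case True
  have "- q * q_int q n \<le> - q * 1"
    using q_int_bounds[of q n] assms True by (intro mult_left_mono) auto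
  then show ?thesis using assms by (simp add: q_int_Suc)
next
  case False
  then have "0 \<le> q * q_int q n" using q_int_nonneg[of q n] by simp
  then show ?thesis by (simp add: q_int_Suc)
qed

lemma q_int_le:
  assumes "-1 \<le> q" "q \<le> 1" shows "q_int q n \<le> real n"
proof -
  have "q_int q n \<le> (\<Sum>i<n. 1)" unfolding q_int_def
  proof (rule sum_mono)
    fix i have "q ^ i \<le> \<bar>q\<bar> ^ i" by (simp add: power_abs[symmetric])
    also have "\<dots> \<le> 1" using assms by (intro power_le_one) auto
    finally show "q ^ i \<le> 1" .
  qed
  then show ?thesis by simp
qed

lemma q_fact_0 [simp]: "q_fact q 0 = 1"
  by (simp add: q_fact_def)

lemma q_fact_Suc: "q_fact q (Suc n) = q_int q (Suc n) * q_fact q n"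
  by (simp add: q_fact_def mult.commute)

lemma q_fact_nonneg: "-1 \<le> q \<Longrightarrow> 0 \<le> q_fact q n"
  by (simp add: q_fact_def prod_nonneg q_int_nonneg)

lemma q_fact_pos: "-1 < q \<Longrightarrow> 0 < q_fact q n"
  by (induction n) (simp_all add: q_fact_Suc q_int_pos)

lemma q_fact_le:
  assumes "-1 \<le> q" "q \<le> 1" shows "q_fact q n \<le> fact n"
proof (induction n)
  case (Suc n)
  then show ?case
    using mult_mono[OF q_int_le[OF assms, of "Suc n"] Suc] q_fact_nonneg[of q n] assms
    by (simp add: q_fact_Suc)
qed simp

fun q_hermite_poly :: "real \<Rightarrow> nat \<Rightarrow> real poly" where
  "q_hermite_poly q 0 = 1"
| "q_hermite_poly q (Suc 0) = [:0, 1:]"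
| "q_hermite_poly q (Suc (Suc n)) =
     [:0, 1:] * q_hermite_poly q (Suc n) - smult (q_int q (Suc n)) (q_hermite_poly q n)"

lemma poly_q_hermite_poly [simp]: "poly (q_hermite_poly q n) x = q_hermite q n x"
  by (induction q n x rule: q_hermite.induct) simp_all

lemma q_hermite_poly_rec:
  "[:0, 1:] * q_hermite_poly q n = q_hermite_poly q (Suc n) + smult (q_int q n) (q_hermite_poly q (n - 1))"
  by (cases n) (simp_all add: one_pCons)

lemma q_hermite_rec: "x * q_hermite q n x = q_hermite q (Suc n) x + q_int q n * q_hermite q (n - 1) x"
  by (cases n) simp_all

lemma q_hermite_measurable [measurable]: "q_hermite q n \<in> borel_measurable borel"
proof -
  have "(\<lambda>x. poly (q_hermite_poly q n) x) \<in> borel_measurable borel"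
    by (intro borel_measurable_continuous_onI continuous_intros)
  then show ?thesis by simp
qed

lemma monic_basis_q_hermite_poly: "monic_basis (q_hermite_poly q)"
proof -
  have "degree (q_hermite_poly q n) = n \<and> lead_coeff (q_hermite_poly q n) = 1" for n
  proof (induction q n rule: q_hermite_poly.induct)
    case (3 q n)
    let ?A = "[:0, 1:] * q_hermite_poly q (Suc n)" and ?B = "smult (q_int q (Suc n)) (q_hermite_poly q n)"
    have "q_hermite_poly q (Suc n) \<noteq> 0" using 3(1) by auto
    then have A: "degree ?A = Suc (Suc n)" "lead_coeff ?A = 1"
      using 3(1) by (auto simp: degree_mult_eq lead_coeff_mult)
    have B: "degree ?B < degree ?A"
      using degree_smult_le[of "q_int q (Suc n)" "q_hermite_poly q n"] 3(2) unfolding A(1) by linarith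
    have d: "degree (?A - ?B) = degree ?A"
      using degree_add_eq_left[of "- ?B" ?A] B by simp
    have "coeff (?A - ?B) (degree ?A) = lead_coeff ?A"
      using coeff_eq_0[OF B] by (simp only: coeff_diff diff_zero)
    then show ?case using d A by (metis q_hermite_poly.simps(3))
  qed simp_all
  then show ?thesis unfolding monic_basis_def by blast
qed

context stationary_moments
begin

text \<open>The values 1, 0, 0, ... on the basis determine the functional \<open>mean\<close>; the
  recurrence moves a factor x from one polynomial to the other and produces the norms [n]_q!. At q =
  -1 these vanish from n = 2 on, which already encodes a two-point support.\<close>

lemma mean_q_hermite_orth:
  assumes "\<And>n. mean (q_hermite_poly q (Suc n)) = 0"
  shows "mean (q_hermite_poly q m * q_hermite_poly q n) = (if m = n then q_fact q n else 0)"
proof -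
  let ?H = "q_hermite_poly q"
  have "mean (?H m * ?H n) = (if m = n then q_fact q n else 0)" if "m \<le> n" for m n
    using that
  proof (induction m arbitrary: n rule: less_induct)
    case (less m)
    show ?case
    proof (cases m)
      case 0
      then show ?thesis using assms by (cases n) auto
    next
      case (Suc k)
      then obtain l where n: "n = Suc l" "k \<le> l" using less.prems by (cases n) auto
      have e: "?H m * ?H n = ?H k * ([:0, 1:] * ?H n) - smult (q_int q k) (?H (k - 1) * ?H n)"
      proof -
        have "?H m = [:0, 1:] * ?H k - smult (q_int q k) (?H (k - 1))"
          using q_hermite_poly_rec[of q k] unfolding Suc by (metis add_diff_cancel_right')
        then show ?thesis by (simp only: left_diff_distrib right_diff_distrib mult_smult_left mult_smult_right mult_ac)
      qed
      have 1: "mean (?H k * ?H (Suc n)) = 0" using less.IH[of k "Suc n"] Suc n by simp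
      have 2: "mean (?H k * ?H l) = (if k = l then q_fact q l else 0)" using less.IH[of k l] Suc n by simp
      have 3: "q_int q k * mean (?H (k - 1) * ?H n) = 0"
        using less.IH[of "k - 1" n] Suc n by (cases "k = 0") auto
      have 4: "mean (?H k * ([:0, 1:] * ?H n)) = mean (?H k * ?H (Suc n)) + q_int q n * mean (?H k * ?H (n - 1))"
        by (simp only: q_hermite_poly_rec[of q n] distrib_left mult_smult_right mean_simps)
      have "mean (?H m * ?H n) = q_int q n * mean (?H k * ?H l)"
        unfolding e mean_simps 4 1 3 by (simp add: n(1))
      then show ?thesis unfolding 2 using n(1) Suc by (simp add: q_fact_Suc)
    qed
  qed
  then show ?thesis using linorder_le_cases[of m n] by (metis mult.commute)
qed

end

section \<open>Exponential moments of processes with q-Hermite regression\<close>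

locale q_process = stationary_moments +
  fixes q \<alpha> :: real
  assumes q_bounds: "-1 \<le> q" "q \<le> 1" and alpha_pos: "0 < \<alpha>"
    and q_eigen: "\<And>n. eigenfunction (q_hermite q n) (real n * \<alpha>)"
    and mean_q_hermite_Suc: "\<And>n. mean (q_hermite_poly q (Suc n)) = 0"
begin

sublocale linear_jacobi M X "q_hermite q" \<alpha> "q_int q"
  by unfold_locales (use q_eigen in \<open>auto simp: q_hermite_rec\<close>)

text \<open>The extra index j makes the induction work: one factor x raises or lowers the degree, (v
  + w)^2 is at most 2 v^2 + 2 w^2, and [j]_q is at most j. At j = 0 the bound reads E X^(2k) \<le>
  4^k k!.\<close>

lemma moment_bound: "expectation (\<lambda>\<omega>. (X 0 \<omega> ^ k * q_hermite q j (X 0 \<omega>))\<^sup>2) \<le> 4 ^ k * fact (j + k)"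
proof (induction k arbitrary: j)
  case 0
  have "expectation (\<lambda>\<omega>. (X 0 \<omega> ^ 0 * q_hermite q j (X 0 \<omega>))\<^sup>2) = mean (q_hermite_poly q j * q_hermite_poly q j)"
    by (simp add: mean_def power2_eq_square)
  then show ?case
    using mean_q_hermite_orth[OF mean_q_hermite_Suc, of j j] q_fact_le[OF q_bounds, of j] by simp
next
  case (Suc k)
  let ?N = "\<lambda>k j. expectation (\<lambda>\<omega>. (X 0 \<omega> ^ k * q_hermite q j (X 0 \<omega>))\<^sup>2)"
  have i: "integrable M (\<lambda>\<omega>. (X 0 \<omega> ^ k * q_hermite q j (X 0 \<omega>))\<^sup>2)" for k j
    by (intro all_moments_integrable am_intros P_all_moments)
  have "?N (Suc k) j \<le> expectation (\<lambda>\<omega>. 2 * (X 0 \<omega> ^ k * q_hermite q (Suc j) (X 0 \<omega>))\<^sup>2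
      + 2 * (q_int q j)\<^sup>2 * (X 0 \<omega> ^ k * q_hermite q (j - 1) (X 0 \<omega>))\<^sup>2)"
  proof (rule integral_mono)
    fix \<omega>
    define x where "x = X 0 \<omega>"
    define v w where "v = x ^ k * q_hermite q (Suc j) x" and "w = q_int q j * (x ^ k * q_hermite q (j - 1) x)"
    have "x ^ Suc k * q_hermite q j x = x ^ k * (x * q_hermite q j x)" by simp
    also have "\<dots> = v + w" unfolding q_hermite_rec v_def w_def by (simp add: algebra_simps)
    finally have "(x ^ Suc k * q_hermite q j x)\<^sup>2 = (v + w)\<^sup>2" by simp
    also have "\<dots> \<le> 2 * v\<^sup>2 + 2 * w\<^sup>2"
      using zero_le_power2[of "v - w"] unfolding power2_sum power2_diff by linarith
    also have "\<dots> = 2 * (x ^ k * q_hermite q (Suc j) x)\<^sup>2 + 2 * (q_int q j)\<^sup>2 * (x ^ k * q_hermite q (j - 1) x)\<^sup>2"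
      by (simp add: v_def w_def power_mult_distrib)
    finally show "(X 0 \<omega> ^ Suc k * q_hermite q j (X 0 \<omega>))\<^sup>2 \<le> 2 * (X 0 \<omega> ^ k * q_hermite q (Suc j) (X 0 \<omega>))\<^sup>2
      + 2 * (q_int q j)\<^sup>2 * (X 0 \<omega> ^ k * q_hermite q (j - 1) (X 0 \<omega>))\<^sup>2"
      by (simp only: x_def)
  qed (rule i, simp add: i)
  also have "\<dots> = 2 * ?N k (Suc j) + 2 * (q_int q j)\<^sup>2 * ?N k (j - 1)"
    using i by simp
  also have "\<dots> \<le> 2 * (4 ^ k * fact (Suc j + k)) + 2 * (4 ^ k * fact (Suc j + k))"
  proof (intro add_mono mult_left_mono Suc.IH)
    have "(q_int q j)\<^sup>2 * ?N k (j - 1) \<le> (real j)\<^sup>2 * (4 ^ k * fact (j - 1 + k))"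
      using q_int_le[OF q_bounds, of j] q_int_nonneg[OF q_bounds(1), of j]
      by (intro mult_mono Suc.IH power_mono) auto
    also have "\<dots> = 4 ^ k * ((real j)\<^sup>2 * fact (j - 1 + k))" by simp
    also have "\<dots> \<le> 4 ^ k * fact (Suc j + k)"
    proof (intro mult_left_mono)
      show "(real j)\<^sup>2 * fact (j - 1 + k) \<le> fact (Suc j + k)"
      proof (cases j)
        case (Suc i)
        have "real (Suc i) * real (Suc i) \<le> (real (i + k) + 2) * (real (i + k) + 1)" by (intro mult_mono) auto
        from mult_right_mono[OF this, of "fact (i + k)"] show ?thesis
          by (simp add: Suc power2_eq_square algebra_simps)
      qed simp
    qed simp
    finally show "2 * (q_int q j)\<^sup>2 * ?N k (j - 1) \<le> 2 * (4 ^ k * fact (Suc j + k))" by simp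
  qed simp
  also have "\<dots> = 4 ^ Suc k * fact (j + Suc k)" by simp
  finally show ?case .
qed

text \<open>The moment bound turns the k-th term of the exponential series into at most (4/8)^k, so
  the denominator 8 leaves a geometric series of ratio 1/2.\<close>

lemma integrable_exp_square: "integrable M (\<lambda>\<omega>. exp ((X 0 \<omega>)\<^sup>2 / 8))"
proof (rule integrableI_nonneg)
  have m: "(\<integral>\<^sup>+\<omega>. ennreal (((X 0 \<omega>)\<^sup>2 / 8) ^ k / fact k) \<partial>M) \<le> ennreal ((1 / 2) ^ k)" for k
  proof -
    have i: "integrable M (\<lambda>\<omega>. ((X 0 \<omega>)\<^sup>2 / 8) ^ k / fact k)"
      unfolding power_divide power_mult[symmetric]
      by (intro integrable_divide) (rule moments)
    have "expectation (\<lambda>\<omega>. ((X 0 \<omega>)\<^sup>2 / 8) ^ k / fact k) = expectation (\<lambda>\<omega>. (X 0 \<omega> ^ k * q_hermite q 0 (X 0 \<omega>))\<^sup>2) / (8 ^ k * fact k)"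
      by (simp add: power_divide power_mult[symmetric] mult.commute)
    also have "\<dots> \<le> 4 ^ k * fact (0 + k) / (8 ^ k * fact k)"
      by (intro divide_right_mono moment_bound) simp
    also have "\<dots> = (1 / 2) ^ k" by (simp add: power_divide flip: power_mult_distrib)
       (simp add: field_simps flip: power_mult_distrib)
    finally show ?thesis
      by (subst nn_integral_eq_integral[OF i]) (auto intro: ennreal_leI)
  qed
  have e: "ennreal (exp x) = (\<Sum>k. ennreal (x ^ k / fact k))" if "0 \<le> x" for x :: real
  proof -
    have "(\<lambda>k. x ^ k / fact k) sums exp x"
      using exp_converges[of x] by (simp add: divide_inverse mult.commute)
    then show ?thesis using that by (subst suminf_ennreal2) (auto simp: sums_iff)
  qed
  have "(\<integral>\<^sup>+\<omega>. ennreal (exp ((X 0 \<omega>)\<^sup>2 / 8)) \<partial>M) = (\<Sum>k. \<integral>\<^sup>+\<omega>. ennreal (((X 0 \<omega>)\<^sup>2 / 8) ^ k / fact k) \<partial>M)"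
    by (subst nn_integral_suminf[symmetric]) (auto simp: e)
  also have "\<dots> \<le> (\<Sum>k. ennreal ((1 / 2) ^ k))" by (intro suminf_le m) auto
  also have "\<dots> = ennreal (\<Sum>k. (1 / 2) ^ k)"
    by (intro suminf_ennreal2) (auto intro: summable_geometric)
  finally show "(\<integral>\<^sup>+\<omega>. ennreal (exp ((X 0 \<omega>)\<^sup>2 / 8)) \<partial>M) < \<infinity>"
    using le_less_trans ennreal_less_top by (metis infinity_ennreal_def)
qed auto

lemma all_moments_exp: "all_moments M (\<lambda>\<omega>. exp (c * \<bar>X t \<omega>\<bar>))"
proof (rule all_moments_stationary)
  have "integrable M (\<lambda>\<omega>. exp (c * \<bar>X 0 \<omega>\<bar>))" for c
  proof (rule Bochner_Integration.integrable_bound)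
    show "integrable M (\<lambda>\<omega>. exp (2 * c\<^sup>2) * exp ((X 0 \<omega>)\<^sup>2 / 8))"
      by (intro integrable_mult_right integrable_exp_square)
    show "AE \<omega> in M. norm (exp (c * \<bar>X 0 \<omega>\<bar>)) \<le> norm (exp (2 * c\<^sup>2) * exp ((X 0 \<omega>)\<^sup>2 / 8))"
    proof (rule AE_I2)
      fix \<omega>
      \<comment> \<open>Dividing the expanded square by 8 gives c |x| \<le> 2 c^2 + x^2 / 8, which
        matches the integrable exponential.\<close>
      have "0 \<le> (4 * c - \<bar>X 0 \<omega>\<bar>)\<^sup>2" by simp
      then have "c * \<bar>X 0 \<omega>\<bar> \<le> 2 * c\<^sup>2 + (X 0 \<omega>)\<^sup>2 / 8"
        unfolding power2_diff by (simp add: power_mult_distrib)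
      then show "norm (exp (c * \<bar>X 0 \<omega>\<bar>)) \<le> norm (exp (2 * c\<^sup>2) * exp ((X 0 \<omega>)\<^sup>2 / 8))"
        by (simp add: exp_add[symmetric])
    qed
  qed simp
  moreover have "\<bar>exp (c * \<bar>X 0 \<omega>\<bar>)\<bar> ^ n = exp ((real n * c) * \<bar>X 0 \<omega>\<bar>)" for n \<omega>
    by (simp add: exp_of_nat_mult[symmetric] mult.assoc)
  ultimately show "all_moments M (\<lambda>\<omega>. exp (c * \<bar>X 0 \<omega>\<bar>))"
    by (simp only: all_moments_def) simp
qed simp

lemma expectation_indicator_zero:
  assumes "all_moments M Y" "\<And>n. expectation (\<lambda>\<omega>. Y \<omega> * q_hermite q n (X t \<omega>)) = 0" "B \<in> sets borel"
  shows "expectation (\<lambda>\<omega>. Y \<omega> * indicator B (X t \<omega>)) = 0"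
proof (rule restricted_integral_zero_of_moments[OF _ _ _ _ assms(3)])
  show "random_variable borel Y" by (rule all_momentsD[OF assms(1)])
  show "integrable M (\<lambda>\<omega>. Y \<omega> * exp (c * \<bar>X t \<omega>\<bar>))" for c
    by (intro all_moments_integrable all_moments_mult assms(1) all_moments_exp)
  fix n
  obtain c where c: "monom 1 n = (\<Sum>k\<le>n. smult (c k) (q_hermite_poly q k))"
    using monic_basis_span[OF monic_basis_q_hermite_poly, of "monom 1 n" n q] by (auto simp: degree_monom_eq)
  have "x ^ n = (\<Sum>k\<le>n. c k * q_hermite q k x)" for x :: real
    using arg_cong[OF c, of "\<lambda>p. poly p x"] by (simp add: poly_monom poly_sum)
  then have "expectation (\<lambda>\<omega>. Y \<omega> * X t \<omega> ^ n) = expectation (\<lambda>\<omega>. \<Sum>k\<le>n. c k * (Y \<omega> * q_hermite q k (X t \<omega>)))"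
    by (simp add: sum_distrib_left mult_ac)
  also have "\<dots> = (\<Sum>k\<le>n. c k * expectation (\<lambda>\<omega>. Y \<omega> * q_hermite q k (X t \<omega>)))"
    using all_moments_integrable[OF all_moments_mult[OF assms(1) P_all_moments]] by simp
  finally show "expectation (\<lambda>\<omega>. Y \<omega> * X t \<omega> ^ n) = 0" using assms(2) by simp
qed simp

end

section \<open>The bridge of a process with q-Hermite regression\<close>

lemma (in prob_space) integral_zero_generated:
  fixes D :: "'a \<Rightarrow> real"
  assumes G: "Int_stable G" "G \<subseteq> sets M" "space M \<in> G" and D: "integrable M D"
    and zero: "\<And>E. E \<in> G \<Longrightarrow> expectation (\<lambda>\<omega>. D \<omega> * indicator E \<omega>) = 0"
    and A: "A \<in> sigma_sets (space M) G"
  shows "expectation (\<lambda>\<omega>. D \<omega> * indicator A \<omega>) = 0"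
proof -
  have sM: "sigma_sets (space M) G \<subseteq> sets M" using G(2) by (rule sets.sigma_sets_subset)
  have i: "integrable M (\<lambda>\<omega>. D \<omega> * indicator E \<omega>)" if "E \<in> sets M" for E
    using integrable_mult_indicator[OF that D] by (simp add: mult.commute)
  have GP: "G \<subseteq> Pow (space M)" using G(2) sets.space_closed by blast
  show ?thesis
    using G(1) GP A
  proof (induction rule: sigma_sets_induct_disjoint)
    case (basic E)
    then show ?case by (rule zero)
  next
    case empty
    then show ?case by simp
  next
    case (compl E)
    then have "E \<in> sets M" using sM by blast
    have "expectation (\<lambda>\<omega>. D \<omega> * indicator (space M - E) \<omega>) =
        expectation (\<lambda>\<omega>. D \<omega> * indicator (space M) \<omega> - D \<omega> * indicator E \<omega>)"
      by (rule Bochner_Integration.integral_cong) (auto simp: indicator_def)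
    also have "\<dots> = 0"
      using zero[OF G(3)] compl by (simp add: i \<open>E \<in> sets M\<close>)
    finally show ?case .
  next
    case (union E)
    have E: "E n \<in> sets M" for n using union(2) sM by blast
    have "(\<integral>\<omega>\<in>(\<Union>n. E n). D \<omega> \<partial>M) = (\<Sum>n. (\<integral>\<omega>\<in>E n. D \<omega> \<partial>M))"
    proof (rule lebesgue_integral_countable_add)
      show "E n \<in> sets M" for n by (rule E)
      show "E m \<inter> E n = {}" if "m \<noteq> n" for m n
        using union(1) that by (auto simp: disjoint_family_on_def)
      show "set_integrable M (\<Union>n. E n) D"
        unfolding set_integrable_def using i[of "\<Union>n. E n"] E by (simp add: mult.commute)
    qed
    also have "\<dots> = 0"
      using union(3) by (simp add: set_lebesgue_integral_def mult.commute)
    finally show ?case by (simp add: set_lebesgue_integral_def mult.commute)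
  qed
qed

context q_process
begin

text \<open>The hypothesis says that E(Y | X_t) = 0, and any g(X_t) can be pulled out of a
  conditional expectation.\<close>

lemma expectation_zero_of_indicator:
  fixes Y :: "'a \<Rightarrow> real" and g :: "real \<Rightarrow> real"
  assumes Y: "integrable M Y" and zero: "\<And>B. B \<in> sets borel \<Longrightarrow> expectation (\<lambda>\<omega>. Y \<omega> * indicator B (X t \<omega>)) = 0"
    and g: "g \<in> borel_measurable borel" "integrable M (\<lambda>\<omega>. Y \<omega> * g (X t \<omega>))"
  shows "expectation (\<lambda>\<omega>. Y \<omega> * g (X t \<omega>)) = 0"
proof -
  interpret F: sigma_finite_subalgebra M "sigma_gen M X {t}"
    by (rule sigma_finite_subalgebra_sigma_gen) (use prob_space_axioms in auto)
  have [measurable]: "Y \<in> borel_measurable M" using Y by simp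
  have ce: "AE \<omega> in M. real_cond_exp M (sigma_gen M X {t}) Y \<omega> = 0"
  proof (rule F.real_cond_exp_charact)
    fix A assume "A \<in> sets (sigma_gen M X {t})"
    then have "A \<in> sigma_sets (space M) {X t -` B \<inter> space M | B. B \<in> sets borel}"
      by (simp add: sets_sigma_gen)
    then obtain B where B: "B \<in> sets borel" "A = X t -` B \<inter> space M"
      using sigma_sets_vimage_commute[of "X t" "space M" UNIV "sets borel"] sets.sigma_sets_eq[of "borel :: real measure"]
      by auto
    have "(\<integral>\<omega>\<in>A. Y \<omega> \<partial>M) = expectation (\<lambda>\<omega>. Y \<omega> * indicator B (X t \<omega>))"
      unfolding set_lebesgue_integral_def
      by (rule Bochner_Integration.integral_cong) (auto simp: B(2) indicator_def)
    then show "(\<integral>\<omega>\<in>A. Y \<omega> \<partial>M) = (\<integral>\<omega>\<in>A. 0 \<partial>M)" using zero[OF B(1)] by simp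
  qed (use Y in auto)
  have g': "(\<lambda>\<omega>. g (X t \<omega>)) \<in> borel_measurable (sigma_gen M X {t})"
    by (rule measurable_compose[OF measurable_sigma_gen_component g(1)]) simp
  have "expectation (\<lambda>\<omega>. g (X t \<omega>) * Y \<omega>) =
      expectation (\<lambda>\<omega>. g (X t \<omega>) * real_cond_exp M (sigma_gen M X {t}) Y \<omega>)"
    by (rule F.real_cond_exp_intg(2)[symmetric]) (use g g' in \<open>simp_all add: mult.commute\<close>)
  also have "\<dots> = 0"
  proof (rule integral_eq_zero_AE)
    show "AE \<omega> in M. g (X t \<omega>) * real_cond_exp M (sigma_gen M X {t}) Y \<omega> = 0"
      using ce by eventually_elim simp
  qed
  finally show ?thesis by (simp add: mult.commute)
qed

definition future_cylinder :: "real set \<Rightarrow> (real \<Rightarrow> real set) \<Rightarrow> 'a set" where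
  "future_cylinder F B = {\<omega> \<in> space M. \<forall>t\<in>F. X t \<omega> \<in> B t}"

text \<open>The invariant is that Y is orthogonal to all H_n(X_u). The eigenfunction relation
  carries it to the earliest remaining time t; determinacy by moments then allows the factor
  1_B(X_t) to be absorbed into Y without losing it, and the induction proceeds with t in place of
  u.\<close>

lemma expectation_future_zero:
  assumes "finite F" "\<And>t. t \<in> F \<Longrightarrow> u \<le> t" "\<And>t. B t \<in> sets borel"
    and "Y \<in> borel_measurable (past u)" "all_moments M Y"
    and "\<And>n. expectation (\<lambda>\<omega>. Y \<omega> * q_hermite q n (X u \<omega>)) = 0"
  shows "expectation (\<lambda>\<omega>. Y \<omega> * indicator (future_cylinder F B) \<omega>) = 0"
  using assms
proof (induction "card F" arbitrary: F Y u)
  case 0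
  then have "F = {}" by simp
  then have "expectation (\<lambda>\<omega>. Y \<omega> * indicator (future_cylinder F B) \<omega>) = expectation (\<lambda>\<omega>. Y \<omega> * q_hermite q 0 (X u \<omega>))"
    by (intro Bochner_Integration.integral_cong) (auto simp: future_cylinder_def)
  then show ?case using "0.prems"(6)[of 0] by simp
next
  case (Suc k)
  define t where "t = Min F"
  have "F \<noteq> {}" using Suc.hyps(2) by auto
  have t: "t \<in> F" "\<And>r. r \<in> F \<Longrightarrow> t \<le> r" "u \<le> t"
    using \<open>F \<noteq> {}\<close> Suc.prems(1,2) by (auto simp: t_def)
  have Yt: "expectation (\<lambda>\<omega>. Y \<omega> * q_hermite q n (X t \<omega>)) = 0" for n
    using linear_step[OF t(3) Suc.prems(4,5), of n] Suc.prems(6) by simp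
  define Y' where "Y' = (\<lambda>\<omega>. Y \<omega> * indicator (B t) (X t \<omega>))"
  have Y'_m: "Y' \<in> borel_measurable (past t)"
    unfolding Y'_def
    by (intro borel_measurable_times past_mono[OF Suc.prems(4) t(3)]
        measurable_compose[OF X_past] borel_measurable_indicator Suc.prems(3)) simp
  have am_ind: "all_moments M (\<lambda>\<omega>. indicator (B t) (X t \<omega>) :: real)"
    by (rule all_moments_bounded[where B=1, OF finite_measure_axioms])
      (use Suc.prems(3)[of t] in \<open>auto simp: indicator_def\<close>)
  have Y'_am: "all_moments M Y'"
    unfolding Y'_def by (intro all_moments_mult Suc.prems(5) am_ind)
  have Y'_0: "expectation (\<lambda>\<omega>. Y' \<omega> * q_hermite q n (X t \<omega>)) = 0" for n
  proof -
    have "expectation (\<lambda>\<omega>. Y \<omega> * (indicator (B t) (X t \<omega>) * q_hermite q n (X t \<omega>))) = 0"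
    proof (rule expectation_zero_of_indicator)
      show "integrable M Y" by (rule all_moments_integrable[OF Suc.prems(5)])
      show "expectation (\<lambda>\<omega>. Y \<omega> * indicator C (X t \<omega>)) = 0" if "C \<in> sets borel" for C
        by (rule expectation_indicator_zero[OF Suc.prems(5) Yt that])
      show "(\<lambda>x. indicator (B t) x * q_hermite q n x) \<in> borel_measurable borel"
        using Suc.prems(3)[of t] by simp
      show "integrable M (\<lambda>\<omega>. Y \<omega> * (indicator (B t) (X t \<omega>) * q_hermite q n (X t \<omega>)))"
        by (intro all_moments_integrable all_moments_mult Suc.prems(5) am_ind P_all_moments)
    qed
    then show ?thesis by (simp add: Y'_def mult.assoc)
  qed
  have "expectation (\<lambda>\<omega>. Y' \<omega> * indicator (future_cylinder (F - {t}) B) \<omega>) = 0"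
    using Suc.hyps(2) Suc.prems(1,3) t Y'_m Y'_am Y'_0 by (intro Suc.hyps(1)) auto
  moreover have "Y' \<omega> * indicator (future_cylinder (F - {t}) B) \<omega> = Y \<omega> * indicator (future_cylinder F B) \<omega>"
    if "\<omega> \<in> space M" for \<omega>
    using t(1) that by (auto simp: Y'_def future_cylinder_def indicator_def)
  ultimately show ?case by (simp cong: Bochner_Integration.integral_cong)
qed

text \<open>The events outside (s, u) are generated by intersections of a past event with a finite
  cylinder of times from u on. The past factor is absorbed into the test variable Z, the cylinder is
  handled by \<open>expectation_future_zero\<close>.\<close>

lemma expectation_bridge_zero:
  assumes su: "s \<le> u" and D: "D \<in> borel_measurable (past u)" "all_moments M D"
    and zero: "\<And>Z n. Z \<in> borel_measurable (past s) \<Longrightarrow> all_moments M Z \<Longrightarrow>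
      expectation (\<lambda>\<omega>. Z \<omega> * D \<omega> * q_hermite q n (X u \<omega>)) = 0"
    and A: "A \<in> sets (sigma_gen M X (- {s<..<u}))"
  shows "expectation (\<lambda>\<omega>. D \<omega> * indicator A \<omega>) = 0"
proof -
  define G where "G = {A \<inter> future_cylinder F B | A F B.
    A \<in> sets (past s) \<and> finite F \<and> (\<forall>t\<in>F. u \<le> t) \<and> (\<forall>t. B t \<in> sets borel)}"
  have fc_empty: "future_cylinder {} B = space M" for B by (auto simp: future_cylinder_def)
  have past_sets: "A \<in> sets (past s) \<Longrightarrow> A \<in> sets M" for A
    using subalgebra_past[of "{..s}"] by (auto simp: subalgebra_def)
  have past_space: "space M \<in> sets (past s)" using sets.top[of "past s"] by simp
  have fc: "future_cylinder F B \<in> sets M" if "finite F" "\<And>t. B t \<in> sets borel" for F B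
    unfolding future_cylinder_def using that by (intro sets.sets_Collect_finite_All) auto
  have GI: "A \<inter> future_cylinder F B \<in> G"
    if "A \<in> sets (past s)" "finite F" "\<forall>t\<in>F. u \<le> t" "\<forall>t. B t \<in> sets borel" for A F B
    using that unfolding G_def by blast
  have GM: "G \<subseteq> sets M" unfolding G_def using past_sets fc by blast
  have gen: "sets (sigma_gen M X (- {s<..<u})) \<subseteq> sigma_sets (space M) G"
    unfolding sets_sigma_gen
  proof (intro sigma_sets_mono subsetI)
    fix E assume "E \<in> {X r -` B \<inter> space M |r B. r \<in> - {s<..<u} \<and> B \<in> sets borel}"
    then obtain r B where E: "E = X r -` B \<inter> space M" "r \<in> - {s<..<u}" "B \<in> sets borel" by blast
    have "E \<in> G"
    proof (cases "r \<le> s")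
      case True
      then have "E \<in> sets (past s)" using E(3) unfolding E(1) sets_sigma_gen by auto
      then have "E \<inter> future_cylinder {} (\<lambda>_. UNIV) \<in> G" by (intro GI) auto
      moreover have "E \<inter> space M = E" unfolding E(1) by auto
      ultimately show ?thesis by (simp add: fc_empty)
    next
      case False
      then have "space M \<inter> future_cylinder {r} (\<lambda>_. B) \<in> G" using E(2,3) past_space by (intro GI) auto
      moreover have "E = space M \<inter> future_cylinder {r} (\<lambda>_. B)" unfolding E(1) by (auto simp: future_cylinder_def)
      ultimately show ?thesis by simp
    qed
    then show "E \<in> sigma_sets (space M) G" by (rule sigma_sets.Basic)
  qed
  show ?thesis
  proof (rule integral_zero_generated[OF _ GM _ all_moments_integrable[OF D(2)]])
    show "Int_stable G"
    proof (rule Int_stableI)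
      fix E E' assume "E \<in> G" "E' \<in> G"
      then obtain A F B A' F' B' where E: "E = A \<inter> future_cylinder F B" "E' = A' \<inter> future_cylinder F' B'"
        "A \<in> sets (past s)" "A' \<in> sets (past s)" "finite F" "finite F'" "\<forall>t\<in>F. u \<le> t" "\<forall>t\<in>F'. u \<le> t"
        "\<forall>t. B t \<in> sets borel" "\<forall>t. B' t \<in> sets borel"
        unfolding G_def by blast
      \<comment> \<open>Cylinders over different time sets are brought to the union of both by the
        trivial condition \<open>UNIV\<close> at missing times.\<close>
      define C where "C t = (if t \<in> F then B t else UNIV) \<inter> (if t \<in> F' then B' t else UNIV)" for t
      have "E \<inter> E' = (A \<inter> A') \<inter> future_cylinder (F \<union> F') C"
        unfolding E(1,2) by (auto simp: future_cylinder_def C_def split: if_splits)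
      moreover have "(A \<inter> A') \<inter> future_cylinder (F \<union> F') C \<in> G"
        using E(3-) by (intro GI) (auto simp: C_def)
      ultimately show "E \<inter> E' \<in> G" by simp
    qed
    show "space M \<in> G"
      using GI[OF past_space, of "{}" "\<lambda>_. UNIV"] by (simp add: fc_empty)
    show "A \<in> sigma_sets (space M) G" using A gen by blast
    fix E assume "E \<in> G"
    then obtain A' F B where E: "E = A' \<inter> future_cylinder F B" "A' \<in> sets (past s)" "finite F" "\<forall>t\<in>F. u \<le> t"
      "\<forall>t. B t \<in> sets borel" unfolding G_def by blast
    have iZ: "(indicator A' :: 'a \<Rightarrow> real) \<in> borel_measurable (past s)" "all_moments M (indicator A')"
      using E(2) past_sets by (auto intro: all_moments_indicator[OF finite_measure_axioms])
    have "expectation (\<lambda>\<omega>. (indicator A' \<omega> * D \<omega>) * indicator (future_cylinder F B) \<omega>) = 0"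
    proof (rule expectation_future_zero[OF E(3)])
      show "(\<lambda>\<omega>. indicator A' \<omega> * D \<omega>) \<in> borel_measurable (past u)"
        by (intro borel_measurable_times past_mono[OF iZ(1) su] D(1))
      show "all_moments M (\<lambda>\<omega>. indicator A' \<omega> * D \<omega>)" by (intro all_moments_mult iZ(2) D(2))
      show "expectation (\<lambda>\<omega>. indicator A' \<omega> * D \<omega> * q_hermite q n (X u \<omega>)) = 0" for n
        by (rule zero[OF iZ])
    qed (use E in auto)
    moreover have "(\<lambda>\<omega>. (indicator A' \<omega> * D \<omega>) * indicator (future_cylinder F B) \<omega>) = (\<lambda>\<omega>. D \<omega> * indicator E \<omega>)"
      by (auto simp: E(1) indicator_def)
    ultimately show "expectation (\<lambda>\<omega>. D \<omega> * indicator E \<omega>) = 0" by simp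
  qed
qed

text \<open>The criterion behind the converse direction: a candidate for the bridge need only be
  compared with q-Hermite polynomials of the right end point.\<close>

lemma bridge_cond_exp:
  assumes st: "s < t" "t < u" and f: "f \<in> borel_measurable borel" "all_moments M (\<lambda>\<omega>. f (X t \<omega>))"
    and g: "g \<in> borel_measurable (sigma_gen M X {s, u})" "all_moments M g"
    and zero: "\<And>Z n. Z \<in> borel_measurable (past s) \<Longrightarrow> all_moments M Z \<Longrightarrow>
      expectation (\<lambda>\<omega>. Z \<omega> * (f (X t \<omega>) - g \<omega>) * q_hermite q n (X u \<omega>)) = 0"
  shows "AE \<omega> in M. real_cond_exp M (sigma_gen M X (- {s<..<u})) (\<lambda>\<omega>. f (X t \<omega>)) \<omega> = g \<omega>"
proof -
  interpret F: sigma_finite_subalgebra M "sigma_gen M X (- {s<..<u})"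
    by (rule sigma_finite_subalgebra_sigma_gen) (use prob_space_axioms in auto)
  have gu: "g \<in> borel_measurable (past u)"
    by (rule measurable_sigma_gen_mono[OF g(1)]) (use st in auto)
  have fu: "(\<lambda>\<omega>. f (X t \<omega>)) \<in> borel_measurable (past u)"
    by (rule measurable_compose[OF X_past f(1)]) (use st in simp)
  show ?thesis
  proof (rule F.real_cond_exp_charact)
    show "g \<in> borel_measurable (sigma_gen M X (- {s<..<u}))"
      by (rule measurable_sigma_gen_mono[OF g(1)]) (use st in auto)
    show i: "integrable M (\<lambda>\<omega>. f (X t \<omega>))" "integrable M g"
      by (intro all_moments_integrable f(2) g(2))+
    fix A assume A: "A \<in> sets (sigma_gen M X (- {s<..<u}))"
    then have AM: "A \<in> sets M" using subalgebra_past[of "- {s<..<u}"] by (auto simp: subalgebra_def)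
    have "expectation (\<lambda>\<omega>. (f (X t \<omega>) - g \<omega>) * indicator A \<omega>) = 0"
      by (rule expectation_bridge_zero[of s u])
         (use st zero A in \<open>auto intro!: borel_measurable_diff fu gu all_moments_diff f(2) g(2)\<close>)
    then have "expectation (\<lambda>\<omega>. indicator A \<omega> * f (X t \<omega>) - indicator A \<omega> * g \<omega>) = 0"
      by (simp add: algebra_simps)
    then show "(\<integral>\<omega>\<in>A. f (X t \<omega>) \<partial>M) = (\<integral>\<omega>\<in>A. g \<omega> \<partial>M)"
      unfolding set_lebesgue_integral_def
      using integrable_mult_indicator[OF AM i(1)] integrable_mult_indicator[OF AM i(2)] by simp
  qed
qed

end

text \<open>For the candidate A x^2 + B x y + C y^2 + F, testing against H_n(X_u) compares the
  coefficients of orders n + 2, n and n - 2. The outer two give the first two equations; the middle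
  one must hold for all n and splits, by [n+1]_q = 1 + q [n]_q, into the next two. The final
  disjunction guarantees degree two.\<close>

lemma bridge_coefficients_2:
  fixes \<rho> r q :: real
  assumes rho: "0 < \<rho>" "\<rho> < 1" and r: "0 < r" "r < 1" and q: "-1 \<le> q" "q \<le> 1"
  defines "R \<equiv> \<rho> * r"
  obtains A B C F where "\<rho>\<^sup>2 = A + B * R + C * R\<^sup>2" "r\<^sup>2 = A * R\<^sup>2 + B * R + C"
    "1 - A - C = B * R + F" "(1 - A - C) * R - B = - q * F * R" "B \<noteq> 0 \<or> A + C \<noteq> 0"
proof -
  have R: "0 < R" "R < 1"
    using rho r mult_strict_mono[of \<rho> 1 r 1] by (auto simp: R_def)
  have R2: "0 < R\<^sup>2" "R\<^sup>2 < 1" using R by (auto simp: power_less_one_iff)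
  have qR: "1 - q * R\<^sup>2 > 0"
  proof -
    have "q * R\<^sup>2 \<le> 1 * R\<^sup>2" using q R2 by (intro mult_right_mono) auto
    then show ?thesis using R2 by linarith
  qed
  \<comment> \<open>With S = 1 - A - C the third and fourth equation express \<open>B\<close> and
    \<open>S\<close> through \<open>F\<close>. The difference of the first two gives A - C =
    \<open>d\<close>; their sum becomes F (1 - q R^2) = 1 + R^2 - \<rho>^2 - r^2, whose right side
    is (1 - \<rho>^2)(1 - r^2).\<close>
  define F where "F = (1 - \<rho>\<^sup>2) * (1 - r\<^sup>2) / (1 - q * R\<^sup>2)"
  define B where "B = F * (1 + q) * R / (1 - R\<^sup>2)"
  define S where "S = F * (1 + q * R\<^sup>2) / (1 - R\<^sup>2)"
  define d where "d = (\<rho>\<^sup>2 - r\<^sup>2) / (1 - R\<^sup>2)"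
  define A C where "A = (1 - S + d) / 2" and "C = (1 - S - d) / 2"
  have F: "F * (1 - q * R\<^sup>2) = 1 + R\<^sup>2 - \<rho>\<^sup>2 - r\<^sup>2"
  proof -
    have "F * (1 - q * R\<^sup>2) = (1 - \<rho>\<^sup>2) * (1 - r\<^sup>2)" using qR by (simp add: F_def)
    then show ?thesis by (simp add: R_def power_mult_distrib algebra_simps)
  qed
  have S: "S * (1 - R\<^sup>2) = F * (1 + q * R\<^sup>2)" and B: "B * (1 - R\<^sup>2) = F * (1 + q) * R"
    and d: "d * (1 - R\<^sup>2) = \<rho>\<^sup>2 - r\<^sup>2"
    using R2 by (simp_all add: S_def B_def d_def)
  have AC: "A + C = 1 - S" "A - C = d" by (simp_all add: A_def C_def field_simps)
  have nz: "1 - R\<^sup>2 \<noteq> 0" using R2 by simp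
  have sum: "(1 - S) * (1 + R\<^sup>2) + 2 * B * R = \<rho>\<^sup>2 + r\<^sup>2"
  proof -
    have "((1 - S) * (1 + R\<^sup>2) + 2 * B * R) * (1 - R\<^sup>2)
      = (1 + R\<^sup>2) * (1 - R\<^sup>2) - (S * (1 - R\<^sup>2)) * (1 + R\<^sup>2) + 2 * (B * (1 - R\<^sup>2)) * R"
      by (simp add: algebra_simps)
    also have "\<dots> = (1 + R\<^sup>2 - F * (1 - q * R\<^sup>2)) * (1 - R\<^sup>2)"
      unfolding S B by (simp add: algebra_simps power2_eq_square)
    also have "\<dots> = (\<rho>\<^sup>2 + r\<^sup>2) * (1 - R\<^sup>2)" unfolding F by simp
    finally show ?thesis using nz by simp
  qed
  have diff: "d * (1 - R\<^sup>2) = \<rho>\<^sup>2 - r\<^sup>2" by (rule d)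
  show ?thesis
  proof (rule that[of A B C F])
    have "A + B * R + C * R\<^sup>2 = ((A + C) * (1 + R\<^sup>2) + 2 * B * R + (A - C) * (1 - R\<^sup>2)) / 2"
      by (simp add: field_simps)
    then show "\<rho>\<^sup>2 = A + B * R + C * R\<^sup>2" unfolding AC diff using sum by simp
    have "A * R\<^sup>2 + B * R + C = ((A + C) * (1 + R\<^sup>2) + 2 * B * R - (A - C) * (1 - R\<^sup>2)) / 2"
      by (simp add: field_simps)
    then show "r\<^sup>2 = A * R\<^sup>2 + B * R + C" unfolding AC diff using sum by simp
    have S': "1 - A - C = S" using AC(1) by simp
    have "(B * R + F) * (1 - R\<^sup>2) = (B * (1 - R\<^sup>2)) * R + F * (1 - R\<^sup>2)" by (simp add: algebra_simps)
    also have "\<dots> = S * (1 - R\<^sup>2)" unfolding S B by (simp add: algebra_simps power2_eq_square)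
    finally show "1 - A - C = B * R + F" unfolding S' using nz by simp
    have "(S * R - B) * (1 - R\<^sup>2) = (S * (1 - R\<^sup>2)) * R - B * (1 - R\<^sup>2)" by (simp add: algebra_simps)
    also have "\<dots> = (- q * F * R) * (1 - R\<^sup>2)" unfolding S B by (simp add: algebra_simps power2_eq_square)
    finally show "(1 - A - C) * R - B = - q * F * R" unfolding S' mult_right_cancel[OF nz] .
    have Fpos: "F > 0" unfolding F_def using qR rho r
      by (intro divide_pos_pos mult_pos_pos) (auto simp: power_less_one_iff)
    show "B \<noteq> 0 \<or> A + C \<noteq> 0"
    \<comment> \<open>For q = -1 the coefficient B is zero, and \<open>sum\<close> shows that A + C
      is a positive multiple of \<rho>^2 + r^2.\<close>
    proof (cases "q = -1")
      case True
      have "\<rho>\<^sup>2 + r\<^sup>2 > 0" using rho by (simp add: add_pos_nonneg)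
      then show ?thesis using sum AC by auto
    next
      case False
      then show ?thesis using Fpos R nz q by (auto simp: B_def)
    qed
  qed
qed

context q_process
begin

lemma X_pair_measurable: "r \<in> {s, u} \<Longrightarrow> X r \<in> borel_measurable (sigma_gen M X {s, u})"
  by (rule measurable_sigma_gen_component)

lemma bridge_ends:
  assumes "s < t" "t < u"
  defines "\<rho> \<equiv> exp (- \<alpha> * (t - s))" and "r \<equiv> exp (- \<alpha> * (u - t))"
  shows "0 < \<rho>" "\<rho> < 1" "0 < r" "r < 1" "exp (- \<alpha> * (u - s)) = \<rho> * r"
  using assms alpha_pos by (simp_all add: exp_add[symmetric] algebra_simps)

lemma r_harness_1: "r_harness 1 M X"
  unfolding r_harness_def
proof (intro allI impI)
  fix s t u :: real assume stu: "s < t \<and> t < u"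
  then have st: "s < t" "t < u" by auto
  define \<rho> r where "\<rho> = exp (- \<alpha> * (t - s))" and "r = exp (- \<alpha> * (u - t))"
  note e = bridge_ends[OF st, folded \<rho>_def r_def]
  define R where "R = \<rho> * r"
  have R: "0 < R" "R < 1" using e mult_strict_mono[of \<rho> 1 r 1] by (auto simp: R_def)
  have R2: "1 - R\<^sup>2 \<noteq> 0" using R power_less_one_iff[of R 2] by auto
  \<comment> \<open>The solution of \<rho> = A + B R and r = A R + B, which are the comparisons of
    the coefficients of orders n + 1 and n - 1.\<close>
  define A B where "A = \<rho> * (1 - r\<^sup>2) / (1 - R\<^sup>2)" and "B = r * (1 - \<rho>\<^sup>2) / (1 - R\<^sup>2)"
  have A: "A * (1 - R\<^sup>2) = \<rho> * (1 - r\<^sup>2)" and B: "B * (1 - R\<^sup>2) = r * (1 - \<rho>\<^sup>2)"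
    using R2 by (simp_all add: A_def B_def)
  have 1: "\<rho> = A + B * R"
  proof -
    have "(A + B * R) * (1 - R\<^sup>2) = A * (1 - R\<^sup>2) + (B * (1 - R\<^sup>2)) * R" by (simp add: algebra_simps)
    also have "\<dots> = \<rho> * (1 - R\<^sup>2)" unfolding A B by (simp add: R_def algebra_simps power2_eq_square)
    finally show ?thesis using R2 by simp
  qed
  have 2: "r = A * R + B"
  proof -
    have "(A * R + B) * (1 - R\<^sup>2) = (A * (1 - R\<^sup>2)) * R + B * (1 - R\<^sup>2)" by (simp add: algebra_simps)
    also have "\<dots> = r * (1 - R\<^sup>2)" unfolding A B by (simp add: R_def algebra_simps power2_eq_square)
    finally show ?thesis using R2 by simp
  qed
  have A0: "A \<noteq> 0" using e R2 power_less_one_iff[of r 2] by (auto simp: A_def)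
  define c where "c i j = (if i = 1 \<and> j = 0 then A else if i = 0 \<and> j = 1 then B else 0)" for i j :: nat
  have csum: "(\<Sum>i\<le>1. \<Sum>j\<le>1 - i. c i j * x ^ i * y ^ j) = A * x + B * y" for x y
    by (simp add: c_def)
  have ce: "AE \<omega> in M. real_cond_exp M (sigma_gen M X (- {s<..<u})) (\<lambda>\<omega>. X t \<omega>) \<omega> = A * X s \<omega> + B * X u \<omega>"
  proof (rule bridge_cond_exp[OF st, where f="\<lambda>x. x"])
    show "(\<lambda>\<omega>. A * X s \<omega> + B * X u \<omega>) \<in> borel_measurable (sigma_gen M X {s, u})"
      by (intro borel_measurable_add borel_measurable_times borel_measurable_const X_pair_measurable) auto
    show "all_moments M (\<lambda>\<omega>. A * X s \<omega> + B * X u \<omega>)" by (intro am_intros)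
    fix Z n assume Z: "Z \<in> borel_measurable (past s)" "all_moments M Z"
    define G where "G k = expectation (\<lambda>\<omega>. Z \<omega> * q_hermite q k (X s \<omega>))" for k
    have i: "integrable M (\<lambda>\<omega>. Z \<omega> * X r \<omega> * q_hermite q n (X u \<omega>))" for r
      by (intro all_moments_integrable am_intros Z P_all_moments)
    have ex: "expectation (\<lambda>\<omega>. Z \<omega> * (X t \<omega> - (A * X s \<omega> + B * X u \<omega>)) * q_hermite q n (X u \<omega>)) =
      expectation (\<lambda>\<omega>. Z \<omega> * X t \<omega> * q_hermite q n (X u \<omega>)) - A * expectation (\<lambda>\<omega>. Z \<omega> * X s \<omega> * q_hermite q n (X u \<omega>))
       - B * expectation (\<lambda>\<omega>. Z \<omega> * X u \<omega> * q_hermite q n (X u \<omega>))"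
    proof -
      have "expectation (\<lambda>\<omega>. Z \<omega> * (X t \<omega> - (A * X s \<omega> + B * X u \<omega>)) * q_hermite q n (X u \<omega>)) =
        expectation (\<lambda>\<omega>. Z \<omega> * X t \<omega> * q_hermite q n (X u \<omega>) - A * (Z \<omega> * X s \<omega> * q_hermite q n (X u \<omega>))
          - B * (Z \<omega> * X u \<omega> * q_hermite q n (X u \<omega>)))"
        by (rule arg_cong[of _ _ expectation]) (simp add: fun_eq_iff algebra_simps)
      then show ?thesis by (simp add: i)
    qed
    have bt: "expectation (\<lambda>\<omega>. Z \<omega> * X t \<omega> * q_hermite q n (X u \<omega>)) =
        r ^ n * (\<rho> ^ Suc n * G (Suc n) + q_int q n * (\<rho> ^ (n - 1) * G (n - 1)))"
      using bridge_1[of s t u Z n] st Z unfolding G_def \<rho>_def r_def by simp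
    have bs: "expectation (\<lambda>\<omega>. Z \<omega> * X s \<omega> * q_hermite q n (X u \<omega>)) =
        R ^ n * (G (Suc n) + q_int q n * G (n - 1))"
      using bridge_1[of s s u Z n] st Z e(5) unfolding G_def R_def by simp
    have bu: "expectation (\<lambda>\<omega>. Z \<omega> * X u \<omega> * q_hermite q n (X u \<omega>)) =
        R ^ Suc n * G (Suc n) + q_int q n * (R ^ (n - 1) * G (n - 1))"
      using bridge_1[of s u u Z n] st Z e(5) unfolding G_def R_def by simp
    show "expectation (\<lambda>\<omega>. Z \<omega> * (X t \<omega> - (A * X s \<omega> + B * X u \<omega>)) * q_hermite q n (X u \<omega>)) = 0"
    proof (cases n)
      case 0
      then show ?thesis unfolding ex bt bs bu by (subst 1) (simp add: algebra_simps)
    next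
      case (Suc k)
      have "r ^ n * (\<rho> ^ Suc n * G (Suc n) + q_int q n * (\<rho> ^ (n - 1) * G (n - 1)))
         - A * (R ^ n * (G (Suc n) + q_int q n * G (n - 1)))
         - B * (R ^ Suc n * G (Suc n) + q_int q n * (R ^ (n - 1) * G (n - 1)))
        = R ^ n * G (Suc n) * (\<rho> - (A + B * R)) + q_int q n * R ^ k * G k * (r - (A * R + B))"
        unfolding Suc R_def by (simp add: power_mult_distrib algebra_simps)
      then show ?thesis unfolding ex bt bs bu using 1 2 by simp
    qed
  qed (auto intro: am_intros)
  have "\<exists>i\<le>1. c i (1 - i) \<noteq> 0" using A0 by (intro exI[of _ 1]) (simp add: c_def)
  with ce show "\<exists>c. (\<exists>i\<le>1. c i (1 - i) \<noteq> 0) \<and> (AE \<omega> in M. real_cond_exp M (sigma_gen M X (- {s<..<u})) (\<lambda>\<omega>'. X t \<omega>' ^ 1) \<omega> =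
      (\<Sum>i\<le>1. \<Sum>j\<le>1 - i. c i j * X s \<omega> ^ i * X u \<omega> ^ j))"
    unfolding csum[symmetric] power_one_right by blast
qed

lemma r_harness_2: "r_harness 2 M X"
  unfolding r_harness_def
proof (intro allI impI)
  fix s t u :: real assume stu: "s < t \<and> t < u"
  then have st: "s < t" "t < u" by auto
  define \<rho> r where "\<rho> = exp (- \<alpha> * (t - s))" and "r = exp (- \<alpha> * (u - t))"
  note e = bridge_ends[OF st, folded \<rho>_def r_def]
  define R where "R = \<rho> * r"
  have R: "0 < R" using e by (simp add: R_def)
  obtain A B C F where c: "\<rho>\<^sup>2 = A + B * R + C * R\<^sup>2" "r\<^sup>2 = A * R\<^sup>2 + B * R + C"
    "1 - A - C = B * R + F" "(1 - A - C) * R - B = - q * F * R" "B \<noteq> 0 \<or> A + C \<noteq> 0"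
    using bridge_coefficients_2[OF e(1-4) q_bounds] unfolding R_def by blast
  define c where "c i j = (if i = 2 \<and> j = 0 then A else if i = 1 \<and> j = 1 then B else
     if i = 0 \<and> j = 2 then C else if i = 0 \<and> j = 0 then F else 0)" for i j :: nat
  have csum: "(\<Sum>i\<le>2. \<Sum>j\<le>2 - i. c i j * x ^ i * y ^ j) = A * x\<^sup>2 + B * (x * y) + C * y\<^sup>2 + F" for x y
    by (simp add: c_def numeral_2_eq_2)
  have ce: "AE \<omega> in M. real_cond_exp M (sigma_gen M X (- {s<..<u})) (\<lambda>\<omega>. (X t \<omega>)\<^sup>2) \<omega> =
      A * (X s \<omega>)\<^sup>2 + B * (X s \<omega> * X u \<omega>) + C * (X u \<omega>)\<^sup>2 + F"
  proof (rule bridge_cond_exp[OF st, where f="\<lambda>x. x\<^sup>2"])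
    show "(\<lambda>\<omega>. A * (X s \<omega>)\<^sup>2 + B * (X s \<omega> * X u \<omega>) + C * (X u \<omega>)\<^sup>2 + F) \<in> borel_measurable (sigma_gen M X {s, u})"
      by (intro borel_measurable_add borel_measurable_times borel_measurable_const borel_measurable_power X_pair_measurable) auto
    show "all_moments M (\<lambda>\<omega>. A * (X s \<omega>)\<^sup>2 + B * (X s \<omega> * X u \<omega>) + C * (X u \<omega>)\<^sup>2 + F)" by (intro am_intros)
    fix Z n assume Z: "Z \<in> borel_measurable (past s)" "all_moments M Z"
    define G where "G k = expectation (\<lambda>\<omega>. Z \<omega> * q_hermite q k (X s \<omega>))" for k
    let ?E = "\<lambda>v w. expectation (\<lambda>\<omega>. Z \<omega> * X v \<omega> * X w \<omega> * q_hermite q n (X u \<omega>))"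
    let ?b = "q_int q"
    have i: "integrable M (\<lambda>\<omega>. Z \<omega> * X v \<omega> * X w \<omega> * q_hermite q n (X u \<omega>))"
      "integrable M (\<lambda>\<omega>. Z \<omega> * q_hermite q n (X u \<omega>))" for v w
      by (intro all_moments_integrable am_intros Z P_all_moments)+
    have ex: "expectation (\<lambda>\<omega>. Z \<omega> * ((X t \<omega>)\<^sup>2 - (A * (X s \<omega>)\<^sup>2 + B * (X s \<omega> * X u \<omega>) + C * (X u \<omega>)\<^sup>2 + F)) * q_hermite q n (X u \<omega>))
       = ?E t t - A * ?E s s - B * ?E s u - C * ?E u u - F * expectation (\<lambda>\<omega>. Z \<omega> * q_hermite q n (X u \<omega>))"
    proof -
      have "expectation (\<lambda>\<omega>. Z \<omega> * ((X t \<omega>)\<^sup>2 - (A * (X s \<omega>)\<^sup>2 + B * (X s \<omega> * X u \<omega>) + C * (X u \<omega>)\<^sup>2 + F)) * q_hermite q n (X u \<omega>))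
       = expectation (\<lambda>\<omega>. Z \<omega> * X t \<omega> * X t \<omega> * q_hermite q n (X u \<omega>) - A * (Z \<omega> * X s \<omega> * X s \<omega> * q_hermite q n (X u \<omega>))
         - B * (Z \<omega> * X s \<omega> * X u \<omega> * q_hermite q n (X u \<omega>)) - C * (Z \<omega> * X u \<omega> * X u \<omega> * q_hermite q n (X u \<omega>))
         - F * (Z \<omega> * q_hermite q n (X u \<omega>)))"
        by (rule arg_cong[of _ _ expectation]) (simp add: fun_eq_iff algebra_simps power2_eq_square)
      then show ?thesis by (simp add: i)
    qed
    have tt: "?E t t = r ^ n * (\<rho> ^ (n + 2) * G (n + 2) + (?b (Suc n) + ?b n) * (\<rho> ^ n * G n)
       + ?b n * ?b (n - 1) * (\<rho> ^ (n - 2) * G (n - 2)))"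
      using bridge_2[of s t u Z n] st Z unfolding G_def \<rho>_def r_def by simp
    have ss: "?E s s = R ^ n * (G (n + 2) + (?b (Suc n) + ?b n) * G n + ?b n * ?b (n - 1) * G (n - 2))"
      using bridge_2[of s s u Z n] st Z e(5) unfolding G_def R_def by simp
    have uu: "?E u u = R ^ (n + 2) * G (n + 2) + (?b (Suc n) + ?b n) * (R ^ n * G n)
       + ?b n * ?b (n - 1) * (R ^ (n - 2) * G (n - 2))"
      using bridge_2[of s u u Z n] st Z e(5) unfolding G_def R_def by simp
    have su: "?E s u = R ^ Suc n * (G (n + 2) + ?b (Suc n) * G n) + ?b n * (R ^ (n - 1) * (G n + ?b (n - 1) * G (n - 2)))"
      using bridge_11[of s s u Z n] st Z e(5) unfolding G_def R_def by simp
    have F: "expectation (\<lambda>\<omega>. Z \<omega> * q_hermite q n (X u \<omega>)) = R ^ n * G n"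
      using linear_step[of s u Z n] st Z e(5) unfolding G_def R_def by simp
    \<comment> \<open>The coefficient of order n. Replacing [n+1]_q by 1 + q [n]_q reduces it to the
      third and fourth equation for the bridge coefficients.\<close>
    have g: "(?b (Suc n) + ?b n) * (1 - A - C) * R = B * (R\<^sup>2 * ?b (Suc n) + ?b n) + F * R"
    proof -
      have "(?b (Suc n) + ?b n) * (1 - A - C) * R - (B * (R\<^sup>2 * ?b (Suc n) + ?b n) + F * R)
        = ?b (Suc n) * R * ((1 - A - C) - B * R) + ?b n * ((1 - A - C) * R - B) - F * R"
        by (simp add: algebra_simps power2_eq_square)
      also have "\<dots> = 0" unfolding c(4) q_int_Suc unfolding c(3) by (simp add: algebra_simps)
      finally show ?thesis by simp
    qed
    show "expectation (\<lambda>\<omega>. Z \<omega> * ((X t \<omega>)\<^sup>2 - (A * (X s \<omega>)\<^sup>2 + B * (X s \<omega> * X u \<omega>) + C * (X u \<omega>)\<^sup>2 + F)) * q_hermite q n (X u \<omega>)) = 0"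
    proof -
      \<comment> \<open>For n < 2 the exponents n - 1 and n - 2 are truncated; the terms containing
        them vanish through [0]_q = 0 and have to be treated apart.\<close>
      consider "n = 0" | "n = 1" | k where "n = Suc (Suc k)" by (metis One_nat_def not0_implies_Suc)
      then show ?thesis
      proof cases
        case 1
        have "?E t t - A * ?E s s - B * ?E s u - C * ?E u u - F * (R ^ n * G n)
          = (\<rho>\<^sup>2 - (A + B * R + C * R\<^sup>2)) * G 2 + ((1 - A - C) - (B * R + F)) * G 0"
          unfolding tt ss su uu unfolding 1 by (simp add: algebra_simps numeral_2_eq_2)
        then show ?thesis unfolding ex F using c(1,3) by simp
      next
        case 2
        have "?E t t - A * ?E s s - B * ?E s u - C * ?E u u - F * (R ^ n * G n)
          = R * (\<rho>\<^sup>2 - (A + B * R + C * R\<^sup>2)) * G 3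
           + ((?b (Suc n) + ?b n) * (1 - A - C) * R - (B * (R\<^sup>2 * ?b (Suc n) + ?b n) + F * R)) * G 1"
          unfolding tt ss su uu unfolding 2 R_def by (simp add: algebra_simps numeral_2_eq_2 numeral_3_eq_3)
        then show ?thesis unfolding ex F using c(1) g by simp
      next
        case 3
        have "?E t t - A * ?E s s - B * ?E s u - C * ?E u u - F * (R ^ n * G n)
          = R ^ n * (\<rho>\<^sup>2 - (A + B * R + C * R\<^sup>2)) * G (n + 2)
           + R ^ Suc k * ((?b (Suc n) + ?b n) * (1 - A - C) * R - (B * (R\<^sup>2 * ?b (Suc n) + ?b n) + F * R)) * G n
           + R ^ k * ?b n * ?b (n - 1) * (r\<^sup>2 - (A * R\<^sup>2 + B * R + C)) * G k"
          unfolding tt ss su uu unfolding 3 R_def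
          by (simp add: algebra_simps power2_eq_square power_mult_distrib)
        then show ?thesis unfolding ex F using c(1,2) g by simp
      qed
    qed
  qed (auto intro: am_intros)
  have "\<exists>i\<le>2. c i (2 - i) \<noteq> 0"
  proof (rule ccontr)
    assume "\<not> ?thesis"
    then have z: "c i (2 - i) = 0" if "i \<le> 2" for i using that by blast
    show False using z[of 0] z[of 1] z[of 2] c(5) by (simp add: c_def)
  qed
  with ce show "\<exists>c. (\<exists>i\<le>2. c i (2 - i) \<noteq> 0) \<and> (AE \<omega> in M. real_cond_exp M (sigma_gen M X (- {s<..<u})) (\<lambda>\<omega>'. X t \<omega>' ^ 2) \<omega> =
      (\<Sum>i\<le>2. \<Sum>j\<le>2 - i. c i j * X s \<omega> ^ i * X u \<omega> ^ j))"
    unfolding csum[symmetric] by blast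
qed

theorem quadratic_harness_q_process: "quadratic_harness M X"
  unfolding quadratic_harness_def using r_harness_1 r_harness_2 by blast

end

section \<open>Quadratic harnesses\<close>

context stationary_moments
begin

text \<open>The coefficients are fixed before the test functions, so a few tests determine them and
  the remaining tests become constraints on the process.\<close>

lemma r_harness_test:
  assumes "r_harness r M X" "s < t" "t < u"
  obtains c where "\<And>f g. f \<in> borel_measurable borel \<Longrightarrow> g \<in> borel_measurable borel \<Longrightarrow>
    all_moments M (\<lambda>\<omega>. f (X s \<omega>)) \<Longrightarrow> all_moments M (\<lambda>\<omega>. g (X u \<omega>)) \<Longrightarrow>
    expectation (\<lambda>\<omega>. f (X s \<omega>) * X t \<omega> ^ r * g (X u \<omega>)) =
      (\<Sum>i\<le>r. \<Sum>j\<le>r - i. c i j * expectation (\<lambda>\<omega>. f (X s \<omega>) * X s \<omega> ^ i * X u \<omega> ^ j * g (X u \<omega>)))"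
proof -
  let ?F = "sigma_gen M X (- {s<..<u})"
  interpret F: sigma_finite_subalgebra M ?F
    by (rule sigma_finite_subalgebra_sigma_gen) (use prob_space_axioms in auto)
  obtain c where c: "AE \<omega> in M. real_cond_exp M ?F (\<lambda>\<omega>'. X t \<omega>' ^ r) \<omega>
                = (\<Sum>i\<le>r. \<Sum>j\<le>r - i. c i j * X s \<omega> ^ i * X u \<omega> ^ j)"
    using assms unfolding r_harness_def by blast
  show ?thesis
  proof (rule that[of c])
    fix f g :: "real \<Rightarrow> real"
    assume m[measurable]: "f \<in> borel_measurable borel" "g \<in> borel_measurable borel"
      and am: "all_moments M (\<lambda>\<omega>. f (X s \<omega>))" "all_moments M (\<lambda>\<omega>. g (X u \<omega>))"
    let ?Z = "\<lambda>\<omega>. f (X s \<omega>) * g (X u \<omega>)"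
    have Z: "?Z \<in> borel_measurable ?F"
      by (intro borel_measurable_times measurable_compose[OF measurable_sigma_gen_component m(1)]
          measurable_compose[OF measurable_sigma_gen_component m(2)]) (use assms in auto)
    have "expectation (\<lambda>\<omega>. f (X s \<omega>) * X t \<omega> ^ r * g (X u \<omega>)) = expectation (\<lambda>\<omega>. ?Z \<omega> * X t \<omega> ^ r)"
      by (simp add: mult_ac)
    also have "\<dots> = expectation (\<lambda>\<omega>. ?Z \<omega> * real_cond_exp M ?F (\<lambda>\<omega>'. X t \<omega>' ^ r) \<omega>)"
    proof (rule F.real_cond_exp_intg(2)[symmetric, OF _ Z])
      show "integrable M (\<lambda>\<omega>. ?Z \<omega> * X t \<omega> ^ r)"
        by (intro all_moments_integrable am_intros am)
    qed simp
    also have "\<dots> = expectation (\<lambda>\<omega>. \<Sum>i\<le>r. \<Sum>j\<le>r - i. c i j * (f (X s \<omega>) * X s \<omega> ^ i * X u \<omega> ^ j * g (X u \<omega>)))"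
    proof (rule integral_cong_AE)
      show "(\<lambda>\<omega>. ?Z \<omega> * real_cond_exp M ?F (\<lambda>\<omega>'. X t \<omega>' ^ r) \<omega>) \<in> borel_measurable M"
        by (intro borel_measurable_times borel_measurable_cond_exp2) measurable
      show "AE \<omega> in M. ?Z \<omega> * real_cond_exp M ?F (\<lambda>\<omega>'. X t \<omega>' ^ r) \<omega> =
          (\<Sum>i\<le>r. \<Sum>j\<le>r - i. c i j * (f (X s \<omega>) * X s \<omega> ^ i * X u \<omega> ^ j * g (X u \<omega>)))"
        using c by eventually_elim (simp add: sum_distrib_left sum_distrib_right mult_ac)
    qed measurable
    also have "\<dots> = (\<Sum>i\<le>r. \<Sum>j\<le>r - i. c i j * expectation (\<lambda>\<omega>. f (X s \<omega>) * X s \<omega> ^ i * X u \<omega> ^ j * g (X u \<omega>)))"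
    proof -
      have "integrable M (\<lambda>\<omega>. f (X s \<omega>) * X s \<omega> ^ i * X u \<omega> ^ j * g (X u \<omega>))" for i j
        by (intro all_moments_integrable am_intros am)
      then show ?thesis by (simp add: Bochner_Integration.integral_sum)
    qed
    finally show "expectation (\<lambda>\<omega>. f (X s \<omega>) * X t \<omega> ^ r * g (X u \<omega>)) =
      (\<Sum>i\<le>r. \<Sum>j\<le>r - i. c i j * expectation (\<lambda>\<omega>. f (X s \<omega>) * X s \<omega> ^ i * X u \<omega> ^ j * g (X u \<omega>)))" .
  qed
qed

end

text \<open>\<open>alpha_distinct\<close> is the form in which regularity acts; the sequences run
  over all n, with null polynomials from the support size \<open>v\<close> on.\<close>

locale regular_process = stationary_moments +
  fixes P :: "nat \<Rightarrow> real poly" and \<alpha> :: "nat \<Rightarrow> real" and v :: enat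
  assumes monic: "monic_basis P" and alpha_0: "\<alpha> 0 = 0"
    and P_eigen: "\<And>n. eigenfunction (poly (P n)) (\<alpha> n)"
    and P_orth: "\<And>m n. m \<noteq> n \<Longrightarrow> mean (P m * P n) = 0"
    and P_norm: "\<And>n. 0 < mean (P n * P n) \<longleftrightarrow> enat n < v"
    and P_null: "\<And>n. \<not> enat n < v \<Longrightarrow> AE \<omega> in M. poly (P n) (X 0 \<omega>) = 0"
    and alpha_distinct: "\<And>i j. i < j \<Longrightarrow> enat j < v \<Longrightarrow> \<alpha> i \<noteq> \<alpha> j"
    and moment_1: "expectation (X 0) = 0" and moment_2: "expectation (\<lambda>\<omega>. X 0 \<omega> ^ 2) = 1"
    and moment_3: "expectation (\<lambda>\<omega>. X 0 \<omega> ^ 3) = 0"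
begin

abbreviation "x \<equiv> [:0, 1:] :: real poly"

lemma mean_x: "mean x = 0" "mean (x * x) = 1" "mean (x * (x * x)) = 0"
  using moment_1 moment_2 moment_3 by (simp_all add: mean_def power2_eq_square power3_eq_cube mult.assoc)

definition h :: "nat \<Rightarrow> real" where "h n = mean (P n * P n)"

lemma P_0: "P 0 = 1" by (rule monic_basis_0[OF monic])

lemma P_1: "P 1 = x"
proof -
  obtain e where e: "x - P 1 = [:e:]"
    using degree_X_mult_minus_monic[OF monic, of 0] by (auto simp: P_0 elim!: degree_eq_zeroE)
  then have P: "P 1 = x - Polynomial.smult e 1" by (simp add: one_pCons algebra_simps)
  have "mean (P 1) = 0" using P_orth[of 1 0] by (simp add: P_0)
  then have "e = 0" unfolding P mean_simps mean_x(1) by simp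
  then show ?thesis using P by simp
qed

lemma h_0: "h 0 = 1" by (simp add: h_def P_0)

lemma h_1: "h 1 = 1" using mean_x(2) by (simp only: h_def P_1)

lemma v_gt_1: "enat 1 < v" using P_norm[of 1] h_1 by (simp add: h_def)

lemma h_pos_iff: "0 < h n \<longleftrightarrow> enat n < v" by (simp add: h_def P_norm)

lemma h_nonneg: "0 \<le> h n" unfolding h_def by (rule mean_square_nonneg)

lemma h_eq_0: "\<not> enat n < v \<Longrightarrow> h n = 0" using h_pos_iff[of n] h_nonneg[of n] by linarith

text \<open>The vanishing third moment makes x^2 - 1 orthogonal to x.\<close>

lemma P_2: "AE \<omega> in M. poly (P 2) (X 0 \<omega>) = (X 0 \<omega>)\<^sup>2 - 1"
proof -
  \<comment> \<open>The second q-Hermite polynomial is x^2 - 1 for every q, so the choice q = 0 is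
    immaterial.\<close>
  have "AE \<omega> in M. poly (P 2) (X 0 \<omega>) = poly (q_hermite_poly 0 2) (X 0 \<omega>)"
  proof (rule monic_orthogonal_unique[OF monic _ monic_basis_q_hermite_poly])
    show "mean (P 2 * P k) = 0" if "k < 2" for k using P_orth that by simp
    show "mean (q_hermite_poly 0 2 * q_hermite_poly 0 k) = 0" if "k < 2" for k
    proof -
      have H: "q_hermite_poly 0 2 = x * x - 1" by (simp add: numeral_2_eq_2 one_pCons)
      have "mean ((x * x - 1) * 1) = 0" "mean ((x * x - 1) * x) = 0"
        using mean_x by (simp_all only: mult_1_right left_diff_distrib mult_1_left mean_simps mult.assoc)
      moreover have "k = 0 \<or> k = 1" using that by linarith
      ultimately show ?thesis unfolding H by (auto simp del: mult_pCons_left mult_pCons_right)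
    qed
  qed
  then show ?thesis by eventually_elim (simp add: numeral_2_eq_2 power2_eq_square)
qed

text \<open>E (X_0 - X_1)^2 = 2 - 2 exp(-\<alpha>_1) is nonnegative, and \<alpha>_1 differs from
  \<alpha>_0 = 0.\<close>

lemma alpha_1_pos: "0 < \<alpha> 1"
proof -
  have ex: "expectation (\<lambda>\<omega>. X 0 \<omega> * poly (P 1) (X 1 \<omega>)) = exp (- \<alpha> 1 * (1 - 0)) * expectation (\<lambda>\<omega>. X 0 \<omega> * poly (P 1) (X 0 \<omega>))"
    by (rule eigenfunction_step[OF P_eigen]) (auto intro: all_moments_X)
  have sq: "expectation (\<lambda>\<omega>. X t \<omega> ^ 2) = 1" for t
    using expectation_stationary[of "\<lambda>x. x ^ 2" t] moment_2 by simp
  have i: "integrable M (\<lambda>\<omega>. X t \<omega> ^ 2)" "integrable M (\<lambda>\<omega>. X 0 \<omega> * X 1 \<omega>)" for t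
    by (intro all_moments_integrable am_intros)+
  have "0 \<le> expectation (\<lambda>\<omega>. (X 0 \<omega> - X 1 \<omega>)\<^sup>2)" by (rule Bochner_Integration.integral_nonneg) simp
  also have "\<dots> = expectation (\<lambda>\<omega>. X 0 \<omega> ^ 2 + X 1 \<omega> ^ 2 - 2 * (X 0 \<omega> * X 1 \<omega>))"
    by (simp add: power2_diff mult.assoc)
  also have "\<dots> = 2 - 2 * expectation (\<lambda>\<omega>. X 0 \<omega> * X 1 \<omega>)"
    using i by (simp add: sq)
  finally have "exp (- \<alpha> 1) \<le> 1"
    using ex moment_2 unfolding P_1 by (simp add: power2_eq_square)
  then have "0 \<le> \<alpha> 1" by simp
  moreover have "\<alpha> 1 \<noteq> 0" using alpha_distinct[of 0 1] v_gt_1 alpha_0 by simp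
  ultimately show ?thesis by simp
qed

definition a :: "nat \<Rightarrow> real" where "a n = mean (x * P n * P n) / h n"
definition b :: "nat \<Rightarrow> real" where "b n = (if n = 0 then 0 else h n / h (n - 1))"

sublocale jac: jacobi_process M X "\<lambda>n. poly (P n)" \<alpha> a b
proof unfold_locales
  show "eigenfunction (poly (P n)) (\<alpha> n)" for n by (rule P_eigen)
  show "b 0 = 0" by (simp add: b_def)
  have "mean (P (Suc n) * P (Suc n)) = 0" if "mean (P n * P n) = 0" for n
  proof -
    have "\<not> enat n < v" using that P_norm[of n] by simp
    then have "\<not> enat (Suc n) < v" by (meson enat_ord_simps(2) lessI order_less_trans)
    then show ?thesis using h_eq_0 by (simp add: h_def)
  qed
  then show "AE \<omega> in M. X 0 \<omega> * poly (P n) (X 0 \<omega>) =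
      poly (P (Suc n)) (X 0 \<omega>) + a n * poly (P n) (X 0 \<omega>) + b n * poly (P (n - 1)) (X 0 \<omega>)" for n
    unfolding a_def b_def h_def by (intro three_term_recurrence[OF monic P_orth])
qed

lemma inner_P: "expectation (\<lambda>\<omega>. poly (P m) (X t \<omega>) * poly (P n) (X t \<omega>)) = (if m = n then h n else 0)"
proof -
  have "expectation (\<lambda>\<omega>. poly (P m) (X t \<omega>) * poly (P n) (X t \<omega>)) = mean (P m * P n)"
    using expectation_stationary[of "poly (P m * P n)" t] by (simp add: mean_def)
  then show ?thesis using P_orth by (auto simp: h_def)
qed

lemma poly_past: "(\<lambda>\<omega>. poly p (X 0 \<omega>)) \<in> borel_measurable (past 0)"
  by (rule measurable_compose[OF X_past]) simp_all

lemma poly_all_moments: "all_moments M (\<lambda>\<omega>. poly p (X t \<omega>))"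
  by (intro am_intros)

lemma bridge_inner:
  assumes "0 \<le> t" "t \<le> u"
  shows "expectation (\<lambda>\<omega>. poly (P m) (X 0 \<omega>) * X t \<omega> * poly (P n) (X u \<omega>)) = exp (- \<alpha> n * (u - t)) *
     (exp (- \<alpha> (Suc n) * t) * (if m = Suc n then h m else 0)
     + a n * (exp (- \<alpha> n * t) * (if m = n then h m else 0))
     + b n * (exp (- \<alpha> (n - 1) * t) * (if m = n - 1 then h m else 0)))"
  using jac.bridge_X_mid[OF assms poly_past poly_all_moments, of "P m" n] by (auto simp: inner_P)

text \<open>At times 0, 1, 2 the tests (0,0), (1,0) and (0,1) show that the constant term is 0 and
  both slopes equal c = \<rho> / (1 + \<rho>^2). The test (n + 1, n) then relates successive
  eigenvalues, and (n, n) reads a_n (1 - 2c) = 0 up to a nonzero factor, where 2c \<noteq> 1 because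
  \<rho> < 1.\<close>

lemma linear_harness_indices:
  assumes "r_harness 1 M X"
  shows "\<And>n. enat (Suc n) < v \<Longrightarrow> \<alpha> (Suc n) = \<alpha> n + \<alpha> 1 \<or> \<alpha> (Suc n) = \<alpha> n - \<alpha> 1" and "\<And>n. a n = 0"
proof -
  define \<rho> where "\<rho> = exp (- \<alpha> 1)"
  have \<rho>: "0 < \<rho>" "\<rho> < 1" using alpha_1_pos by (simp_all add: \<rho>_def)
  have r2: "exp (- \<alpha> n * 2) = exp (- \<alpha> n) * exp (- \<alpha> n)" for n by (simp add: exp_add[symmetric])
  obtain c where c: "\<And>f g. f \<in> borel_measurable borel \<Longrightarrow> g \<in> borel_measurable borel \<Longrightarrow>
    all_moments M (\<lambda>\<omega>. f (X 0 \<omega>)) \<Longrightarrow> all_moments M (\<lambda>\<omega>. g (X 2 \<omega>)) \<Longrightarrow>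
    expectation (\<lambda>\<omega>. f (X 0 \<omega>) * X 1 \<omega> ^ 1 * g (X 2 \<omega>)) =
      (\<Sum>i\<le>1. \<Sum>j\<le>1 - i. c i j * expectation (\<lambda>\<omega>. f (X 0 \<omega>) * X 0 \<omega> ^ i * X 2 \<omega> ^ j * g (X 2 \<omega>)))"
    using r_harness_test[OF assms, of 0 1 2] by auto
  have test: "expectation (\<lambda>\<omega>. poly (P m) (X 0 \<omega>) * X 1 \<omega> * poly (P n) (X 2 \<omega>)) =
     c 0 0 * expectation (\<lambda>\<omega>. poly (P m) (X 0 \<omega>) * poly (P n) (X 2 \<omega>))
     + c 0 1 * expectation (\<lambda>\<omega>. poly (P m) (X 0 \<omega>) * X 2 \<omega> * poly (P n) (X 2 \<omega>))
     + c 1 0 * expectation (\<lambda>\<omega>. poly (P m) (X 0 \<omega>) * X 0 \<omega> * poly (P n) (X 2 \<omega>))" for m n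
    using c[of "poly (P m)" "poly (P n)"] poly_all_moments by simp
  have c00: "c 0 0 = 0"
  proof -
    have "a 0 = 0" using mean_x(1) by (simp add: a_def P_0)
    then show ?thesis
      using test[of 0 0] bridge_inner[of 1 2 0 0] bridge_inner[of 2 2 0 0] bridge_inner[of 0 2 0 0]
      by (simp add: P_0 prob_space)
  qed
  have c1: "\<rho> = c 1 0 + c 0 1 * \<rho>\<^sup>2"
    using test[of 1 0] bridge_inner[of 1 2 1 0] bridge_inner[of 2 2 1 0] bridge_inner[of 0 2 1 0] c00 h_1 alpha_0 r2[of 1]
    by (simp add: \<rho>_def power2_eq_square algebra_simps)
  have b1: "b 1 = 1" using h_0 h_1 by (simp add: b_def)
  have c2: "\<rho> = c 1 0 * \<rho>\<^sup>2 + c 0 1"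
    using test[of 0 1] bridge_inner[of 1 2 0 1] bridge_inner[of 2 2 0 1] bridge_inner[of 0 2 0 1] c00 h_0 alpha_0 r2[of 1] b1
    by (simp add: \<rho>_def power2_eq_square algebra_simps)
  have "(c 1 0 - c 0 1) * (1 - \<rho>\<^sup>2) = (c 1 0 + c 0 1 * \<rho>\<^sup>2) - (c 1 0 * \<rho>\<^sup>2 + c 0 1)" by (simp add: algebra_simps)
  also have "\<dots> = 0" using c1 c2 by simp
  finally have ceq: "c 1 0 = c 0 1" using \<rho> power_less_one_iff[of \<rho> 2] by auto
  have cv: "c 0 1 * (1 + \<rho>\<^sup>2) = \<rho>" using c1 ceq by (simp add: algebra_simps)
  show "\<alpha> (Suc n) = \<alpha> n + \<alpha> 1 \<or> \<alpha> (Suc n) = \<alpha> n - \<alpha> 1" if n: "enat (Suc n) < v" for n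
  proof -
    define y z where "y = exp (- \<alpha> n)" and "z = exp (- \<alpha> (Suc n))"
    have hp: "h (Suc n) \<noteq> 0" using h_pos_iff[of "Suc n"] n by simp
    have ne: "(Suc n = n - Suc 0) = False" by arith
    have "y * z * h (Suc n) = (c 0 1 * z\<^sup>2 + c 1 0 * y\<^sup>2) * h (Suc n)"
      using test[of "Suc n" n] bridge_inner[of 1 2 "Suc n" n] bridge_inner[of 2 2 "Suc n" n] bridge_inner[of 0 2 "Suc n" n] c00
      r2[of n] r2[of "Suc n"] ne by (simp add: y_def z_def power2_eq_square algebra_simps)
    then have "y * z = c 0 1 * z\<^sup>2 + c 1 0 * y\<^sup>2" unfolding mult_right_cancel[OF hp] .
    then have "y * z = c 0 1 * (z\<^sup>2 + y\<^sup>2)" unfolding ceq by (simp add: algebra_simps)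
    then have "y * z * (1 + \<rho>\<^sup>2) = (c 0 1 * (1 + \<rho>\<^sup>2)) * (z\<^sup>2 + y\<^sup>2)" by (simp add: mult_ac)
    \<comment> \<open>A quadratic equation for z / y with the roots \<rho> and 1 / \<rho>, hence the
      two signs.\<close>
    then have "(z - \<rho> * y) * (y - \<rho> * z) = 0" unfolding cv by (simp add: algebra_simps power2_eq_square)
    then have "z = \<rho> * y \<or> y = \<rho> * z" by auto
    then have "exp (- \<alpha> (Suc n)) = exp (- \<alpha> 1 - \<alpha> n) \<or> exp (- \<alpha> n) = exp (- \<alpha> 1 - \<alpha> (Suc n))"
      unfolding y_def z_def \<rho>_def exp_diff by (simp add: exp_minus field_simps)
    then show ?thesis by auto
  qed
  show "a n = 0" for n
  proof (cases "enat n < v")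
    case True
    define y where "y = exp (- \<alpha> n)"
    have hp: "h n \<noteq> 0" using h_pos_iff[of n] True by simp
    \<comment> \<open>The condition \<open>n = n - 1\<close> holds at n = 0 by truncation, and there
      \<open>b n\<close> is 0.\<close>
    have bn: "b n * (exp w * (if n = n - 1 then h n else 0)) = 0" for w by (cases n) (simp_all add: b_def)
    have B: "expectation (\<lambda>\<omega>. poly (P n) (X 0 \<omega>) * X t \<omega> * poly (P n) (X 2 \<omega>)) = exp (- \<alpha> n * (2 - t)) * (a n * (exp (- \<alpha> n * t) * h n))"
      if "0 \<le> t" "t \<le> 2" for t
      unfolding bridge_inner[OF that] bn by simp
    have "a n * h n * y\<^sup>2 = (c 0 1 + c 1 0) * (a n * h n * y\<^sup>2)"
      using test[of n n] B[of 0] B[of 1] B[of 2] c00 r2[of n] by (simp add: y_def power2_eq_square algebra_simps)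
    moreover have "c 0 1 + c 1 0 \<noteq> 1"
    proof
      assume "c 0 1 + c 1 0 = 1"
      then have half: "c 0 1 = 1 / 2" unfolding ceq by simp
      have "1 + \<rho>\<^sup>2 = 2 * \<rho>" using cv unfolding half by simp
      then have "(1 - \<rho>)\<^sup>2 = 0" by (simp add: power2_diff)
      then show False using \<rho> by simp
    qed
    ultimately have "a n * h n * y\<^sup>2 = 0" by (metis mult_cancel_right1 mult.commute)
    then show ?thesis using hp by (simp add: y_def)
  next
    case False
    then show ?thesis using h_eq_0 by (simp add: a_def)
  qed
qed

text \<open>A downward step from \<alpha>_(n-1) would give \<alpha>_n = \<alpha>_(n-2), contrary to
  distinctness.\<close>

lemma linear_indices:
  assumes "r_harness 1 M X" "enat n < v"
  shows "\<alpha> n = real n * \<alpha> 1"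
  using assms(2)
proof (induction n rule: less_induct)
  case (less n)
  have lt: "enat m < v" if "m < n" for m using that less.prems by (meson enat_ord_simps(2) order_less_trans)
  show ?case
  proof (cases n)
    case (Suc k)
    have k: "\<alpha> k = real k * \<alpha> 1" using less.IH[of k] lt[of k] Suc by simp
    consider "\<alpha> n = \<alpha> k + \<alpha> 1" | "\<alpha> n = \<alpha> k - \<alpha> 1" using linear_harness_indices(1)[OF assms(1)] less.prems Suc by blast
    then show ?thesis
    proof cases
      case 1
      then show ?thesis using k Suc by (simp add: algebra_simps)
    next
      case 2
      show ?thesis
      proof (cases k)
        case (Suc j)
        then have "\<alpha> j = real j * \<alpha> 1" using less.IH[of j] lt[of j] \<open>n = Suc k\<close> by simp
        then have "\<alpha> n = \<alpha> j" using 2 k Suc by (simp add: algebra_simps)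
        then show ?thesis using alpha_distinct[of j n] less.prems Suc \<open>n = Suc k\<close> by simp
      qed (use Suc in simp)
    qed
  qed (simp add: alpha_0)
qed

end

text \<open>For \<open>q > 1\<close> the second polynomial orthogonal with respect to the conditional law would have
  the norm \<open>(1 + q) (1 - \<rho>\<^sup>2) (1 - q \<rho>\<^sup>2)\<close>, which is negative for suitable \<open>\<rho>\<close>.\<close>

lemma (in linear_jacobi) q_hermite_le_1:
  assumes P: "\<And>n. P n = q_hermite q n" and b: "\<And>n. b n = q_int q n" and \<alpha>: "0 < \<alpha>" and q: "-1 < q"
    and m1: "expectation (X 0) = 0" and m2: "expectation (\<lambda>\<omega>. X 0 \<omega> ^ 2) = 1"
    and m4: "expectation (\<lambda>\<omega>. X 0 \<omega> ^ 4) = 2 + q"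
  shows "q \<le> 1"
proof (rule ccontr)
  assume "\<not> q \<le> 1"
  then have q1: "1 < q" by simp
  \<comment> \<open>\<rho>^2 is the midpoint between 1/q and 1, so that \<rho> < 1 while q \<rho>^2
    > 1.\<close>
  define \<rho> where "\<rho> = sqrt ((1 + 1 / q) / 2)"
  have r2: "\<rho>\<^sup>2 = (1 + 1 / q) / 2" using q1 by (simp add: \<rho>_def)
  have "0 < \<rho>" using q1 by (simp add: \<rho>_def add_pos_pos)
  have "\<rho>\<^sup>2 < 1" "q * \<rho>\<^sup>2 > 1" using q1 by (simp_all add: r2 field_simps)
  then have "\<rho> < 1" using power_less_one_iff[of \<rho> 2] \<open>0 < \<rho>\<close> by auto
  \<comment> \<open>The time lag at which the correlation equals \<rho>.\<close>
  define t where "t = - ln \<rho> / \<alpha>"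
  have t: "0 \<le> t" "exp (- \<alpha> * (t - 0)) = \<rho>"
    using \<open>0 < \<rho>\<close> ln_less_zero[OF \<open>0 < \<rho>\<close> \<open>\<rho> < 1\<close>] \<alpha> by (simp_all add: t_def divide_nonpos_pos)
  define mm where "mm i j = expectation (\<lambda>\<omega>. X 0 \<omega> ^ i * X t \<omega> ^ j)" for i j :: nat
  have i: "integrable M (\<lambda>\<omega>. X 0 \<omega> ^ i * X t \<omega> ^ j)" for i j
    by (intro all_moments_integrable am_intros)
  have st: "expectation (\<lambda>\<omega>. X 0 \<omega> ^ k * P n (X t \<omega>)) = \<rho> ^ n * expectation (\<lambda>\<omega>. X 0 \<omega> ^ k * P n (X 0 \<omega>))" for k n
    using linear_step[OF t(1), of "\<lambda>\<omega>. X 0 \<omega> ^ k" n] t(2)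
    by (simp add: am_intros borel_measurable_power)
  have e0: "mm i 0 = expectation (\<lambda>\<omega>. X 0 \<omega> ^ i)" for i by (simp add: mm_def)
  have ej: "mm 0 j = expectation (\<lambda>\<omega>. X 0 \<omega> ^ j)" for j
    using expectation_stationary[of "\<lambda>x. x ^ j" t] by (simp add: mm_def)
  have H: "P (Suc 0) y = y" "P 2 y = y ^ 2 - 1" "P 3 y = y ^ 3 - (2 + q) * y" for y
    by (simp_all add: P numeral_2_eq_2 numeral_3_eq_3 q_int_Suc power2_eq_square algebra_simps)
  have i0: "integrable M (\<lambda>\<omega>. X 0 \<omega> ^ i)" for i by (rule moments)
  have k1: "mm k 1 = \<rho> * mm (Suc k) 0" for k
    using st[of k 1] by (simp add: H mm_def mult_ac)
  have k2: "mm k 2 - mm k 0 = \<rho>\<^sup>2 * (mm (k + 2) 0 - mm k 0)" for k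
    using st[of k 2] i[of k 2] i[of k 0] i0[of "k + 2"] i0[of k]
    by (simp add: H mm_def right_diff_distrib power_add power2_eq_square mult_ac)
  have k3: "mm 1 3 - (2 + q) * mm 1 1 = 0"
  proof -
    have "expectation (\<lambda>\<omega>. X 0 \<omega> ^ 1 * P 3 (X 0 \<omega>)) = expectation (\<lambda>\<omega>. X 0 \<omega> ^ 4 - (2 + q) * X 0 \<omega> ^ 2)"
      by (rule arg_cong[of _ _ expectation]) (simp add: H fun_eq_iff right_diff_distrib power4_eq_xxxx power3_eq_cube power2_eq_square mult_ac)
    also have "\<dots> = 0" using i0[of 4] i0[of 2] by (simp add: m4 m2)
    finally have z: "expectation (\<lambda>\<omega>. X 0 \<omega> ^ 1 * P 3 (X t \<omega>)) = 0" using st[of 1 3] by simp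
    have "expectation (\<lambda>\<omega>. X 0 \<omega> ^ 1 * P 3 (X t \<omega>)) = expectation (\<lambda>\<omega>. X 0 \<omega> ^ 1 * X t \<omega> ^ 3 - (2 + q) * (X 0 \<omega> ^ 1 * X t \<omega> ^ 1))"
      by (rule arg_cong[of _ _ expectation]) (simp add: H fun_eq_iff algebra_simps)
    then show ?thesis using z i[of 1 3] i[of 1 1] by (simp add: mm_def)
  qed
  have m00: "mm 0 0 = 1" and m20: "mm 2 0 = 1" and m40: "mm 4 0 = 2 + q" and m02: "mm 0 2 = 1" and m04: "mm 0 4 = 2 + q"
    using m2 m4 by (simp_all add: e0 ej prob_space)
  have m11: "mm 1 1 = \<rho>" using k1[of 1] m20 by (simp add: numeral_2_eq_2)
  have m31: "mm 3 1 = \<rho> * (2 + q)" using k1[of 3] m40 by simp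
  have m13: "mm 1 3 = (2 + q) * \<rho>" using k3 m11 by simp
  have m22: "mm 2 2 = 1 + \<rho>\<^sup>2 * (1 + q)" using k2[of 2] m20 m40 by simp
  define w where "w = 1 + q"
  define k where "k = \<rho>\<^sup>2 - 1"
  \<comment> \<open>The monic Al-Salam-Chihara polynomial of degree two in X_t with parameter \<rho>
    X_0; it factors as (X_t - \<rho> X_0)(X_t - q \<rho> X_0) - (1 - \<rho>^2).\<close>
  let ?Y = "\<lambda>\<omega>. X t \<omega> ^ 2 - w * \<rho> * X 0 \<omega> * X t \<omega> + q * \<rho>\<^sup>2 * X 0 \<omega> ^ 2 + k"
  have "0 \<le> expectation (\<lambda>\<omega>. (?Y \<omega>)\<^sup>2)" by (rule Bochner_Integration.integral_nonneg) simp
  also have "expectation (\<lambda>\<omega>. (?Y \<omega>)\<^sup>2) = expectation (\<lambda>\<omega>. X 0 \<omega> ^ 0 * X t \<omega> ^ 4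
     + (w\<^sup>2 * \<rho>\<^sup>2 + 2 * q * \<rho>\<^sup>2) * (X 0 \<omega> ^ 2 * X t \<omega> ^ 2)
     + q\<^sup>2 * \<rho> ^ 4 * (X 0 \<omega> ^ 4 * X t \<omega> ^ 0)
     + k\<^sup>2 * (X 0 \<omega> ^ 0 * X t \<omega> ^ 0)
     - 2 * w * \<rho> * (X 0 \<omega> ^ 1 * X t \<omega> ^ 3)
     + 2 * k * (X 0 \<omega> ^ 0 * X t \<omega> ^ 2)
     - 2 * w * q * \<rho> ^ 3 * (X 0 \<omega> ^ 3 * X t \<omega> ^ 1)
     - 2 * w * \<rho> * k * (X 0 \<omega> ^ 1 * X t \<omega> ^ 1)
     + 2 * q * \<rho>\<^sup>2 * k * (X 0 \<omega> ^ 2 * X t \<omega> ^ 0))"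
    by (rule arg_cong[of _ _ expectation])
       (simp add: fun_eq_iff algebra_simps power4_eq_xxxx power3_eq_cube power2_eq_square)
  also have "\<dots> = mm 0 4 + (w\<^sup>2 * \<rho>\<^sup>2 + 2 * q * \<rho>\<^sup>2) * mm 2 2 + q\<^sup>2 * \<rho> ^ 4 * mm 4 0 + k\<^sup>2 * mm 0 0
      - 2 * w * \<rho> * mm 1 3 + 2 * k * mm 0 2 - 2 * w * q * \<rho> ^ 3 * mm 3 1 - 2 * w * \<rho> * k * mm 1 1 + 2 * q * \<rho>\<^sup>2 * k * mm 2 0"
  proof -
    have ic: "integrable M (\<lambda>\<omega>. d * (X 0 \<omega> ^ i * X t \<omega> ^ j))" for d i j by (simp add: i)
    show ?thesis unfolding mm_def
      by (simp only: Bochner_Integration.integral_add Bochner_Integration.integral_diff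
          Bochner_Integration.integrable_add Bochner_Integration.integrable_diff i ic integral_mult_right_zero)
  qed
  also have "\<dots> = (1 + q) * (1 - \<rho>\<^sup>2) * (1 - q * \<rho>\<^sup>2)"
    unfolding m00 m20 m40 m02 m04 m11 m31 m13 m22 w_def k_def
    by (simp add: algebra_simps power4_eq_xxxx power3_eq_cube power2_eq_square)
  also have "\<dots> < 0"
    using q1 \<open>\<rho>\<^sup>2 < 1\<close> \<open>q * \<rho>\<^sup>2 > 1\<close> by (intro mult_pos_neg mult_pos_pos) auto
  finally show False by simp
qed

text \<open>H_2 = x^2 - 1 vanishes, H_3 = x H_2 - [2]_q x vanishes because [2]_q = 0 at q = -1, and
  the recurrence propagates two consecutive zeros.\<close>

lemma (in stationary_moments) q_hermite_minus_one_null: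
  assumes sq: "AE \<omega> in M. (X 0 \<omega>)\<^sup>2 = 1"
  shows "AE \<omega> in M. q_hermite (-1) (n + 2) (X 0 \<omega>) = 0"
proof (induction n rule: less_induct)
  case (less n)
  consider "n = 0" | "n = 1" | k where "n = Suc (Suc k)" by (metis One_nat_def not0_implies_Suc)
  then show ?case
  proof cases
    case 1
    show ?thesis using sq by eventually_elim (simp add: 1 power2_eq_square numeral_2_eq_2)
  next
    case 2
    show ?thesis using less[of 0] 2
      by (auto elim!: eventually_mono simp: q_int_Suc numeral_2_eq_2 numeral_3_eq_3)
  next
    case 3
    have "AE \<omega> in M. q_hermite (-1) (Suc k + 2) (X 0 \<omega>) = 0" "AE \<omega> in M. q_hermite (-1) (k + 2) (X 0 \<omega>) = 0"
      using less[of "Suc k"] less[of k] 3 by auto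
    then show ?thesis unfolding 3 by eventually_elim simp
  qed
qed

context regular_process
begin

lemma AE_eq_q_hermite:
  assumes "\<And>n. AE \<omega> in M. X 0 \<omega> * poly (P n) (X 0 \<omega>) = poly (P (Suc n)) (X 0 \<omega>) + q_int q n * poly (P (n - 1)) (X 0 \<omega>)"
  shows "AE \<omega> in M. poly (P n) (X 0 \<omega>) = q_hermite q n (X 0 \<omega>)"
proof (induction n rule: less_induct)
  case (less n)
  show ?case
  proof (cases n)
    case 0
    then show ?thesis by (simp add: P_0)
  next
    case (Suc k)
    have "AE \<omega> in M. poly (P k) (X 0 \<omega>) = q_hermite q k (X 0 \<omega>)"
      "AE \<omega> in M. poly (P (k - 1)) (X 0 \<omega>) = q_hermite q (k - 1) (X 0 \<omega>)"
      using less Suc by auto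
    then show ?thesis using assms[of k]
    proof eventually_elim
      case (elim \<omega>)
      then show ?case using q_hermite_rec[of "X 0 \<omega>" q k] by (simp add: Suc)
    qed
  qed
qed

lemma q_processI:
  assumes ae: "\<And>n. AE \<omega> in M. poly (P n) (X 0 \<omega>) = q_hermite q n (X 0 \<omega>)"
    and q: "-1 \<le> q" "q \<le> 1" and c: "0 < c" "\<And>n. enat n < v \<Longrightarrow> \<alpha> n = real n * c"
  shows "q_process M X q c"
proof unfold_locales
  show "eigenfunction (q_hermite q n) (real n * c)" for n
  proof (cases "enat n < v")
    case True
    show ?thesis unfolding c(2)[OF True, symmetric]
      by (rule eigenfunction_cong_AE[OF P_eigen q_hermite_measurable ae])
  next
    case False
    have "AE \<omega> in M. 0 = q_hermite q n (X 0 \<omega>)" using ae[of n] P_null[OF False] by eventually_elim simp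
    then show ?thesis by (intro eigenfunction_cong_AE[OF eigenfunction_null]) auto
  qed
  show "mean (q_hermite_poly q (Suc n)) = 0" for n
  proof -
    have "mean (q_hermite_poly q (Suc n)) = mean (P (Suc n) * P 0)"
      unfolding mean_def using ae[of "Suc n"]
      by (intro integral_cong_AE) (auto simp: P_0)
    then show ?thesis using P_orth by simp
  qed
qed (use q c in auto)

text \<open>A null P_2 means X_0^2 = 1. Only the indices 0 and 1 remain below the support size, and
  for these linearity is automatic.\<close>

lemma two_point_q_process:
  assumes "\<not> enat 2 < v" shows "q_process M X (-1) (\<alpha> 1)"
proof (rule q_processI)
  have nv: "\<not> enat n < v" if "2 \<le> n" for n using assms that by (meson enat_ord_simps(1) order.strict_trans1)
  have sq: "AE \<omega> in M. (X 0 \<omega>)\<^sup>2 = 1" using P_2 P_null[OF assms] by eventually_elim simp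
  note H = q_hermite_minus_one_null[OF sq]
  show "AE \<omega> in M. poly (P n) (X 0 \<omega>) = q_hermite (- 1) n (X 0 \<omega>)" for n
  proof -
    consider "n = 0" | "n = 1" | k where "n = k + 2" by (metis One_nat_def add_2_eq_Suc' not0_implies_Suc)
    then show ?thesis
    proof cases
      case 3
      have "AE \<omega> in M. poly (P n) (X 0 \<omega>) = 0" using P_null nv 3 by simp
      then show ?thesis using H[of k] unfolding 3 by eventually_elim simp
    qed (simp_all add: P_0 P_1[simplified])
  qed
  show "\<alpha> n = real n * \<alpha> 1" if "enat n < v" for n
  proof -
    have "n < 2" using nv that by (meson not_le)
    then have "n = 0 \<or> n = 1" by auto
    then show ?thesis using alpha_0 by auto
  qed
qed (use alpha_1_pos in auto)

theorem quadratic_harness_imp_q_process: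
  assumes qh: "quadratic_harness M X"
  shows "\<exists>q c. q_process M X q c \<and> (\<forall>n. enat n < v \<longrightarrow> \<alpha> n = real n * c)"
proof (cases "enat 2 < v")
  case False
  have "\<alpha> n = real n * \<alpha> 1" if "enat n < v" for n
    using qh that by (intro linear_indices) (auto simp: quadratic_harness_def)
  then show ?thesis using two_point_q_process[OF False] by blast
next
  case True
  have h1: "r_harness 1 M X" and h2: "r_harness 2 M X" using qh unfolding quadratic_harness_def by blast+
  define c where "c = \<alpha> 1"
  have c: "0 < c" using alpha_1_pos by (simp add: c_def)
  have al: "\<alpha> n = real n * c" if "enat n < v" for n
    using linear_indices[OF h1 that] by (simp add: c_def)
  have a0: "a n = 0" for n by (rule linear_harness_indices(2)[OF h1])
  \<comment> \<open>Beyond the support size the polynomials are null, so the exponent n c may be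
    prescribed there as well.\<close>
  have eig: "eigenfunction (poly (P n)) (real n * c)" for n
  proof (cases "enat n < v")
    case True
    then show ?thesis using P_eigen[of n] al by simp
  next
    case False
    have "AE \<omega> in M. 0 = poly (P n) (X 0 \<omega>)" using P_null[OF False] by eventually_elim simp
    then show ?thesis by (intro eigenfunction_cong_AE[OF eigenfunction_null]) auto
  qed
  interpret lin: linear_jacobi M X "\<lambda>n. poly (P n)" c b
  proof unfold_locales
    show "AE \<omega> in M. X 0 \<omega> * poly (P n) (X 0 \<omega>) = poly (P (Suc n)) (X 0 \<omega>) + 0 * poly (P n) (X 0 \<omega>) + b n * poly (P (n - 1)) (X 0 \<omega>)" for n
      using jac.recurrence[of n] a0[of n] by simp
  qed (simp_all add: eig)
  define \<rho> where "\<rho> = exp (- c)"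
  have \<rho>: "0 < \<rho>" "\<rho> < 1" using c by (simp_all add: \<rho>_def)
  define R where "R = \<rho>\<^sup>2"
  have R: "0 < R" "R < 1" using \<rho> by (simp_all add: R_def power_less_one_iff)
  have e1: "exp (- c * (1 - 0)) = \<rho>" "exp (- c * (2 - 1)) = \<rho>" "exp (- c * (2 - 0)) = R" "exp (- c * (0 - 0)) = 1" "exp (- c * (2 - 2)) = 1"
    by (simp_all add: \<rho>_def R_def power2_eq_square exp_add[symmetric])
  obtain k where k: "\<And>f g. f \<in> borel_measurable borel \<Longrightarrow> g \<in> borel_measurable borel \<Longrightarrow>
    all_moments M (\<lambda>\<omega>. f (X 0 \<omega>)) \<Longrightarrow> all_moments M (\<lambda>\<omega>. g (X 2 \<omega>)) \<Longrightarrow>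
    expectation (\<lambda>\<omega>. f (X 0 \<omega>) * X 1 \<omega> ^ 2 * g (X 2 \<omega>)) =
      (\<Sum>i\<le>2. \<Sum>j\<le>2 - i. k i j * expectation (\<lambda>\<omega>. f (X 0 \<omega>) * X 0 \<omega> ^ i * X 2 \<omega> ^ j * g (X 2 \<omega>)))"
    using r_harness_test[OF h2, of 0 1 2] by auto
  \<comment> \<open>The linear coefficients \<open>D\<close> and \<open>E\<close> cancel out: in
    each test below both degrees have the same parity, whereas a single factor X changes it.\<close>
  define A B C F D E where "A = k 2 0" and "B = k 1 1" and "C = k 0 2" and "F = k 0 0" and "D = k 1 0" and "E = k 0 1"
  let ?e = "\<lambda>m n u w. expectation (\<lambda>\<omega>. poly (P m) (X 0 \<omega>) * X u \<omega> * X w \<omega> * poly (P n) (X 2 \<omega>))"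
  let ?d = "\<lambda>m n u. expectation (\<lambda>\<omega>. poly (P m) (X 0 \<omega>) * X u \<omega> * poly (P n) (X 2 \<omega>))"
  have test: "?e m n 1 1 = F * expectation (\<lambda>\<omega>. poly (P m) (X 0 \<omega>) * poly (P n) (X 2 \<omega>))
     + E * ?d m n 2 + D * ?d m n 0 + C * ?e m n 2 2 + B * ?e m n 0 2 + A * ?e m n 0 0" for m n
    using k[of "poly (P m)" "poly (P n)"] poly_all_moments
    by (simp add: A_def B_def C_def D_def E_def F_def numeral_2_eq_2 power2_eq_square mult.assoc)
  define \<delta> where "\<delta> m n = (if m = n then h m else 0)" for m n
  have inner: "expectation (\<lambda>\<omega>. poly (P m) (X 0 \<omega>) * poly (P n) (X 0 \<omega>)) = \<delta> m n" for m n
    by (simp add: inner_P \<delta>_def)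
  note pm = poly_past poly_all_moments
  have t11: "?e m n 1 1 = \<rho> ^ n * (\<rho> ^ (n + 2) * \<delta> m (n + 2) + (b (Suc n) + b n) * (\<rho> ^ n * \<delta> m n)
       + b n * b (n - 1) * (\<rho> ^ (n - 2) * \<delta> m (n - 2)))" for m n
    using lin.bridge_2[of 0 1 2 "\<lambda>\<omega>. poly (P m) (X 0 \<omega>)" n] pm unfolding e1 inner by simp
  have t00: "?e m n 0 0 = R ^ n * (\<delta> m (n + 2) + (b (Suc n) + b n) * \<delta> m n + b n * b (n - 1) * \<delta> m (n - 2))" for m n
    using lin.bridge_2[of 0 0 2 "\<lambda>\<omega>. poly (P m) (X 0 \<omega>)" n] pm unfolding e1 inner by simp
  have t22: "?e m n 2 2 = R ^ (n + 2) * \<delta> m (n + 2) + (b (Suc n) + b n) * (R ^ n * \<delta> m n)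
       + b n * b (n - 1) * (R ^ (n - 2) * \<delta> m (n - 2))" for m n
    using lin.bridge_2[of 0 2 2 "\<lambda>\<omega>. poly (P m) (X 0 \<omega>)" n] pm unfolding e1 inner by simp
  have t02: "?e m n 0 2 = R ^ Suc n * (\<delta> m (n + 2) + b (Suc n) * \<delta> m n)
       + b n * (R ^ (n - 1) * (\<delta> m n + b (n - 1) * \<delta> m (n - 2)))" for m n
    using lin.bridge_11[of 0 0 2 "\<lambda>\<omega>. poly (P m) (X 0 \<omega>)" n] pm unfolding e1 inner by simp
  have d0: "?d m n 0 = R ^ n * (\<delta> m (Suc n) + b n * \<delta> m (n - 1))" for m n
    using lin.bridge_1[of 0 0 2 "\<lambda>\<omega>. poly (P m) (X 0 \<omega>)" n] pm unfolding e1 inner by simp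
  have d2: "?d m n 2 = R ^ Suc n * \<delta> m (Suc n) + b n * (R ^ (n - 1) * \<delta> m (n - 1))" for m n
    using lin.bridge_1[of 0 2 2 "\<lambda>\<omega>. poly (P m) (X 0 \<omega>)" n] pm unfolding e1 inner by simp
  have f: "expectation (\<lambda>\<omega>. poly (P m) (X 0 \<omega>) * poly (P n) (X 2 \<omega>)) = R ^ n * \<delta> m n" for m n
    using lin.linear_step[of 0 2 "\<lambda>\<omega>. poly (P m) (X 0 \<omega>)" n] pm unfolding e1 inner by simp
  have b1: "b 1 = 1" and b0: "b 0 = 0" using h_0 h_1 by (simp_all add: b_def)
  have h2: "h 2 > 0" using h_pos_iff True by simp
  have b2: "b 2 = h 2" using h_1 by (simp add: b_def)
  have h2': "h 2 \<noteq> 0" using h2 by simp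
  have "\<rho>\<^sup>2 * h 2 = (A + B * R + C * R\<^sup>2) * h 2"
    using test[of 2 0] unfolding t11 t00 t22 t02 d0 d2 f by (simp add: \<delta>_def b0 numeral_2_eq_2 algebra_simps)
  then have q1: "\<rho>\<^sup>2 = A + B * R + C * R\<^sup>2" unfolding mult_right_cancel[OF h2'] .
  have "\<rho>\<^sup>2 * h 2 = (A * R\<^sup>2 + B * R + C) * h 2"
    using test[of 0 2] h_0 b1 b2 unfolding t11 t00 t22 t02 d0 d2 f by (simp add: \<delta>_def numeral_2_eq_2 algebra_simps)
  then have q2: "\<rho>\<^sup>2 = A * R\<^sup>2 + B * R + C" unfolding mult_right_cancel[OF h2'] .
  define S where "S = 1 - A - C"
  have s0: "S = B * R + F"
    using test[of 0 0] h_0 b1 unfolding t11 t00 t22 t02 d0 d2 f by (simp add: \<delta>_def b0 S_def algebra_simps)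
  \<comment> \<open>The diagonal test of degree n >= 1, divided by the norm of P_n and by R^(n-1);
    it links two successive recurrence coefficients.\<close>
  have sn: "b (Suc n) * (S - B * R) * R + b n * (S * R - B) = F * R" if n: "enat n < v" "n = Suc m" for n m
  proof -
    have hn: "h n \<noteq> 0" using h_pos_iff[of n] n(1) by simp
    have dl: "\<delta> n (n + 2) = 0" "\<delta> n n = h n" "\<delta> n (n - 2) = 0" "\<delta> n (Suc n) = 0" "\<delta> n (n - 1) = 0"
      using n(2) by (auto simp: \<delta>_def)
    have RR: "\<rho> ^ n * \<rho> ^ n = R ^ n" by (simp add: R_def power2_eq_square power_mult_distrib)
    have "\<rho> ^ n * \<rho> ^ n * (b (Suc n) + b n) * h n = (F * R ^ n + C * (b (Suc n) + b n) * R ^ n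
       + B * (R ^ Suc n * b (Suc n) + b n * R ^ (n - 1)) + A * R ^ n * (b (Suc n) + b n)) * h n"
      using test[of n n] unfolding t11 t00 t22 t02 d0 d2 f dl by (simp add: algebra_simps)
    then have "R ^ m * ((b (Suc n) + b n) * S * R - B * (R\<^sup>2 * b (Suc n) + b n) - F * R) = 0"
      unfolding RR mult_right_cancel[OF hn] unfolding n(2) S_def by (simp add: algebra_simps power2_eq_square)
    then have "(b (Suc n) + b n) * S * R - B * (R\<^sup>2 * b (Suc n) + b n) - F * R = 0" using R by simp
    then show ?thesis by (simp add: algebra_simps power2_eq_square)
  qed
  \<comment> \<open>The recursion for \<open>b\<close> is obtained by dividing by F R. If F were 0,
    the test (1, 1) would force B = 0 and S = 0, and the sum of \<open>q1\<close> and
    \<open>q2\<close> would become 2 R = 1 + R^2.\<close>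
  have F0: "F \<noteq> 0"
  proof
    assume "F = 0"
    then have SB: "S - B * R = 0" using s0 by simp
    have "b (Suc 1) * (S - B * R) * R + b 1 * (S * R - B) = F * R"
      using v_gt_1 by (intro sn[of 1 0]) simp_all
    then have "S * R - B = 0" unfolding SB b1 \<open>F = 0\<close> by simp
    then have "(B * R) * R - B = 0" using SB by (metis eq_iff_diff_eq_0)
    then have "B * (1 - R\<^sup>2) = 0" by (simp add: algebra_simps power2_eq_square)
    then have "B = 0" using R power_less_one_iff[of R 2] by auto
    then have "A + C = 1" using SB by (simp add: S_def)
    have "2 * \<rho>\<^sup>2 = (A + C) * (1 + R\<^sup>2)" using q1 q2 \<open>B = 0\<close> by (simp add: algebra_simps)
    then have "(1 - R)\<^sup>2 = 0" unfolding \<open>A + C = 1\<close> R_def by (simp add: power2_eq_square algebra_simps)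
    then show False using R by simp
  qed
  \<comment> \<open>As b_1 = 1, this is the only value with b_2 = 1 + q b_1.\<close>
  define q where "q = b 2 - 1"
  have sq: "S * R - B = - q * F * R"
  proof -
    have "b (Suc 1) * (S - B * R) * R + b 1 * (S * R - B) = F * R"
      using v_gt_1 by (intro sn[of 1 0]) simp_all
    moreover have "S - B * R = F" using s0 by simp
    ultimately have "b 2 * F * R + (S * R - B) = F * R" unfolding b1 by (simp add: numeral_2_eq_2)
    then show ?thesis by (simp add: q_def algebra_simps)
  qed
  have rec: "b (Suc n) = 1 + q * b n" if "enat n < v" for n
  proof (cases n)
    case (Suc m)
    have "b (Suc n) * F * R - b n * (q * F * R) = F * R"
    proof -
      have "S - B * R = F" using s0 by simp
      from sn[OF that Suc, unfolded sq this] show ?thesis by (simp add: algebra_simps)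
    qed
    then have "(b (Suc n) - (1 + q * b n)) * (F * R) = 0" by (simp add: algebra_simps)
    then show ?thesis using F0 R by simp
  qed (simp add: b0 b1[simplified])
  have lt: "enat m < v" if "m \<le> n" "enat n < v" for m n using that by (meson enat_ord_simps(1) order.strict_trans1)
  \<comment> \<open>The range reaches one index past the support: at n = v the formula meets a
    coefficient that is 0 by definition. This overlap gives the contradiction for finite
    supports.\<close>
  have bq: "b n = q_int q n" if "n = 0 \<or> enat (n - 1) < v" for n
    using that
  proof (induction n)
    case (Suc n)
    then show ?case using rec[of n] lt[of "n - 1" n] by (simp add: q_int_Suc)
  qed (simp add: b0)
  have q: "-1 < q" using h2 b2 by (simp add: q_def)
  \<comment> \<open>b_(n+1) is the quotient of successive norms; since it equals [n+1]_q > 0, the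
    next norm cannot vanish.\<close>
  have vn: "enat n < v" for n
  proof (induction n)
    case 0
    then show ?case using lt[of 0 1] v_gt_1 by simp
  next
    case (Suc n)
    have "0 < b (Suc n)" using bq[of "Suc n"] Suc q_int_pos[OF q, of n] by simp
    then have "h (Suc n) \<noteq> 0" by (auto simp: b_def)
    then show ?case using h_eq_0 by blast
  qed
  have bq': "b n = q_int q n" for n using bq vn by simp
  have ae: "AE \<omega> in M. poly (P n) (X 0 \<omega>) = q_hermite q n (X 0 \<omega>)" for n
  proof (rule AE_eq_q_hermite)
    show "AE \<omega> in M. X 0 \<omega> * poly (P n) (X 0 \<omega>) = poly (P (Suc n)) (X 0 \<omega>) + q_int q n * poly (P (n - 1)) (X 0 \<omega>)" for n
      using lin.recurrence[of n] by (simp add: bq')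
  qed
  interpret qlin: linear_jacobi M X "q_hermite q" c "q_int q"
  proof unfold_locales
    show "eigenfunction (q_hermite q n) (real n * c)" for n
      by (rule eigenfunction_cong_AE[OF eig q_hermite_measurable ae])
  qed (simp_all add: q_hermite_rec)
  \<comment> \<open>The norm of x^2 - 1 is E X^4 - 1, and it equals b_2 = 1 + q.\<close>
  have m4: "expectation (\<lambda>\<omega>. X 0 \<omega> ^ 4) = 2 + q"
  proof -
    have i: "integrable M (\<lambda>\<omega>. X 0 \<omega> ^ n)" for n by (rule moments)
    have "h 2 = expectation (\<lambda>\<omega>. poly (P 2) (X 0 \<omega>) * poly (P 2) (X 0 \<omega>))" by (simp add: inner_P)
    also have "\<dots> = expectation (\<lambda>\<omega>. X 0 \<omega> ^ 4 - 2 * X 0 \<omega> ^ 2 + 1)"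
    proof (rule integral_cong_AE)
      show "AE \<omega> in M. poly (P 2) (X 0 \<omega>) * poly (P 2) (X 0 \<omega>) = X 0 \<omega> ^ 4 - 2 * X 0 \<omega> ^ 2 + 1"
        using P_2
      proof eventually_elim
        case (elim \<omega>)
        show ?case unfolding elim by (simp add: algebra_simps power4_eq_xxxx power2_eq_square)
      qed
    qed measurable
    also have "\<dots> = expectation (\<lambda>\<omega>. X 0 \<omega> ^ 4) - 1" using i[of 4] i[of 2] moment_2 by (simp add: prob_space)
    finally show ?thesis using b2 by (simp add: q_def)
  qed
  have "q \<le> 1"
    by (rule qlin.q_hermite_le_1[OF refl refl c q moment_1 moment_2 m4])
  then have "q_process M X q c" using q by (intro q_processI ae c al) auto
  then show ?thesis using al by blast
qed

end

section \<open>Hermite polynomials\<close>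

lemma q_int_one: "q_int 1 n = real n"
  by (simp add: q_int_def)

text \<open>The Taylor coefficients of exp(-y^2 / 2).\<close>

definition half_exp_coeff :: "nat \<Rightarrow> real" where
  "half_exp_coeff j = (if even j then (- 1 / 2) ^ (j div 2) / fact (j div 2) else 0)"

text \<open>The differential equation f' = -y f, read on coefficients.\<close>

lemma half_exp_coeff_rec: "real (j + 2) * half_exp_coeff (j + 2) = - half_exp_coeff j"
proof (cases "even j")
  case True
  then obtain m where j: "j = 2 * m" by blast
  have "half_exp_coeff (j + 2) = - half_exp_coeff j / (2 * real (Suc m))"
    by (simp add: half_exp_coeff_def j)
  moreover have "real (j + 2) = 2 * real (Suc m)" by (simp add: j)
  ultimately show ?thesis by simp
qed (simp add: half_exp_coeff_def)

lemma half_exp_coeff_sums: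
  fixes z :: complex
  shows "(\<lambda>j. of_real (half_exp_coeff j) * z ^ j) sums exp (- z\<^sup>2 / 2)"
    and "summable (\<lambda>j. norm (of_real (half_exp_coeff j) * z ^ j))"
proof -
  have sm: "strict_mono (\<lambda>m::nat. 2 * m)" by (simp add: strict_mono_def)
  have z: "half_exp_coeff j = 0" if "j \<notin> range (\<lambda>m::nat. 2 * m)" for j
    using that by (auto simp: half_exp_coeff_def elim!: evenE)
  have e: "of_real (half_exp_coeff (2 * m)) * z ^ (2 * m) = (- z\<^sup>2 / 2) ^ m /\<^sub>R fact m" for m
  proof -
    have "complex_of_real (half_exp_coeff (2 * m)) * z ^ (2 * m) = (- 1 / 2) ^ m / fact m * (z\<^sup>2) ^ m"
      by (simp add: half_exp_coeff_def power_mult)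
    also have "\<dots> = ((- 1 / 2) ^ m * (z\<^sup>2) ^ m) / fact m" by (rule times_divide_eq_left)
    also have "(- 1 / 2) ^ m * (z\<^sup>2) ^ m = (- z\<^sup>2 / 2) ^ m"
      by (subst power_mult_distrib[symmetric]) (rule arg_cong[of _ _ "\<lambda>w. w ^ m"], simp)
    also have "(- z\<^sup>2 / 2) ^ m / fact m = (- z\<^sup>2 / 2) ^ m /\<^sub>R fact m"
      by (rule sym, simp only: scaleR_conv_of_real divide_inverse of_real_inverse of_real_fact mult.commute)
    finally show ?thesis .
  qed
  show "(\<lambda>j. of_real (half_exp_coeff j) * z ^ j) sums exp (- z\<^sup>2 / 2)"
    using exp_converges[of "- z\<^sup>2 / 2"] sums_mono_reindex[OF sm, of "\<lambda>j. of_real (half_exp_coeff j) * z ^ j"] z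
    unfolding e by simp
  show "summable (\<lambda>j. norm (of_real (half_exp_coeff j) * z ^ j))"
    using summable_norm_exp[of "- z\<^sup>2 / 2"] summable_mono_reindex[OF sm, of "\<lambda>j. norm (of_real (half_exp_coeff j) * z ^ j)"] z
    unfolding e by simp
qed

text \<open>The generating function exp(x y - y^2 / 2), written as a Cauchy product of its two
  factors. Both sides obey (n + 1) c_(n+1) = x c_n - c_(n-1).\<close>

lemma q_hermite_one_expansion:
  "q_hermite 1 n x / fact n = (\<Sum>k\<le>n. x ^ k / fact k * half_exp_coeff (n - k))"
proof -
  define a where "a k = x ^ k / fact k" for k :: nat
  define c where "c n = (\<Sum>k\<le>n. a k * half_exp_coeff (n - k))" for n
  have a: "real (Suc k) * a (Suc k) = x * a k" for k by (simp add: a_def)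
  have c0: "c 0 = 1" by (simp add: c_def a_def half_exp_coeff_def)
  have rec: "real (Suc n) * c (Suc n) = x * c n - (if n = 0 then 0 else c (n - 1))" for n
  proof -
    \<comment> \<open>The product rule on coefficients: n + 1 is split into k and n + 1 - k.\<close>
    have "real (Suc n) * c (Suc n) = (\<Sum>k\<le>Suc n. real k * a k * half_exp_coeff (Suc n - k))
       + (\<Sum>k\<le>Suc n. a k * (real (Suc n - k) * half_exp_coeff (Suc n - k)))"
      unfolding c_def sum_distrib_left sum.distrib[symmetric]
      by (rule sum.cong) (auto simp: of_nat_diff algebra_simps)
    also have "(\<Sum>k\<le>Suc n. real k * a k * half_exp_coeff (Suc n - k)) = (\<Sum>k\<le>n. (real (Suc k) * a (Suc k)) * half_exp_coeff (n - k))"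
      by (subst sum.atMost_Suc_shift) simp
    also have "\<dots> = x * c n" unfolding a c_def by (simp add: sum_distrib_left mult.assoc)
    also have "(\<Sum>k\<le>Suc n. a k * (real (Suc n - k) * half_exp_coeff (Suc n - k))) = - (if n = 0 then 0 else c (n - 1))"
    proof (cases n)
      case 0
      then show ?thesis by (simp add: half_exp_coeff_def)
    next
      case (Suc m)
      have "(\<Sum>k\<le>Suc n. a k * (real (Suc n - k) * half_exp_coeff (Suc n - k))) = (\<Sum>k\<le>m. a k * (real (Suc n - k) * half_exp_coeff (Suc n - k)))"
        by (simp add: Suc half_exp_coeff_def)
      also have "\<dots> = (\<Sum>k\<le>m. - (a k * half_exp_coeff (m - k)))"
      proof (rule sum.cong[OF refl])
        fix k assume "k \<in> {..m}"
        then have "Suc n - k = (m - k) + 2" using Suc by simp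
        then show "a k * (real (Suc n - k) * half_exp_coeff (Suc n - k)) = - (a k * half_exp_coeff (m - k))"
          by (simp only: half_exp_coeff_rec mult_minus_right)
      qed
      finally show ?thesis by (simp add: Suc c_def sum_negf)
    qed
    finally show ?thesis by simp
  qed
  have "q_hermite 1 n x = fact n * c n"
  proof (induction n rule: less_induct)
    case (less n)
    show ?case
    proof (cases n)
      case 0
      then show ?thesis by (simp add: c0)
    next
      case (Suc m)
      have 1: "q_hermite 1 m x = fact m * c m" using less Suc by simp
      have 2: "real m * q_hermite 1 (m - 1) x = (if m = 0 then 0 else fact m * c (m - 1))"
        using less[of "m - 1"] Suc by (cases m) simp_all
      have "q_hermite 1 (Suc m) x = x * q_hermite 1 m x - real m * q_hermite 1 (m - 1) x"
        using q_hermite_rec[of x 1 m] by (simp add: q_int_one)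
      also have "\<dots> = fact m * (x * c m - (if m = 0 then 0 else c (m - 1)))"
        unfolding 1 2 by (simp add: algebra_simps)
      also have "\<dots> = fact (Suc m) * c (Suc m)" unfolding rec[symmetric] by simp
      finally show ?thesis using Suc by simp
    qed
  qed
  then show ?thesis by (simp add: c_def a_def)
qed

section \<open>The case \<open>q = 1\<close>\<close>

text \<open>The generating function at y = i \<theta>, where exp(-y^2 / 2) becomes exp(\<theta>^2 /
  2). Exponential moments justify averaging the Cauchy product term by term.\<close>

lemma (in q_process) hermite_generating_function:
  assumes q1: "q = 1" and Z: "all_moments M Z"
  shows "(\<lambda>n. (\<i> * of_real \<theta>) ^ n / fact n * of_real (expectation (\<lambda>\<omega>. Z \<omega> * q_hermite q n (X t \<omega>)))) sums
    ((CLINT \<omega>|M. of_real (Z \<omega>) * iexp (\<theta> * X t \<omega>)) * of_real (exp (\<theta>\<^sup>2 / 2)))"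
proof -
  let ?z = "\<i> * complex_of_real \<theta>"
  let ?a = "\<lambda>k. ?z ^ k / fact k * complex_of_real (expectation (\<lambda>\<omega>. Z \<omega> * X t \<omega> ^ k))"
  let ?b = "\<lambda>j. complex_of_real (half_exp_coeff j) * ?z ^ j"
  have Zm: "random_variable borel Z" using Z by (rule all_momentsD)
  have ex: "integrable M (\<lambda>\<omega>. Z \<omega> * exp (c * \<bar>X t \<omega>\<bar>))" for c
    by (intro all_moments_integrable all_moments_mult Z all_moments_exp)
  note S = char_moment_series[OF X_measurable Zm ex, of \<theta>]
  have iX: "integrable M (\<lambda>\<omega>. Z \<omega> * X t \<omega> ^ k)" for k
    by (intro all_moments_integrable am_intros Z)
  have cn: "(\<Sum>k\<le>n. ?a k * ?b (n - k)) = ?z ^ n / fact n * of_real (expectation (\<lambda>\<omega>. Z \<omega> * q_hermite q n (X t \<omega>)))" for n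
  proof -
    have "(\<Sum>k\<le>n. ?a k * ?b (n - k)) = (\<Sum>k\<le>n. ?z ^ n * of_real (expectation (\<lambda>\<omega>. Z \<omega> * X t \<omega> ^ k) * (half_exp_coeff (n - k) / fact k)))"
    proof (rule sum.cong[OF refl])
      fix k assume "k \<in> {..n}"
      then have "?z ^ k * ?z ^ (n - k) = ?z ^ n" by (simp add: power_add[symmetric])
      then show "?a k * ?b (n - k) = ?z ^ n * of_real (expectation (\<lambda>\<omega>. Z \<omega> * X t \<omega> ^ k) * (half_exp_coeff (n - k) / fact k))"
        by (simp add: mult_ac)
    qed
    also have "\<dots> = ?z ^ n * of_real (\<Sum>k\<le>n. expectation (\<lambda>\<omega>. Z \<omega> * X t \<omega> ^ k) * (half_exp_coeff (n - k) / fact k))"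
      by (simp only: sum_distrib_left of_real_sum)
    also have "(\<Sum>k\<le>n. expectation (\<lambda>\<omega>. Z \<omega> * X t \<omega> ^ k) * (half_exp_coeff (n - k) / fact k)) =
       expectation (\<lambda>\<omega>. \<Sum>k\<le>n. Z \<omega> * X t \<omega> ^ k * (half_exp_coeff (n - k) / fact k))"
      using iX by (subst Bochner_Integration.integral_sum) auto
    also have "\<dots> = expectation (\<lambda>\<omega>. Z \<omega> * q_hermite q n (X t \<omega>) / fact n)"
      unfolding q1 times_divide_eq_right[symmetric] q_hermite_one_expansion
      by (simp add: sum_distrib_left mult_ac divide_inverse)
    also have "?z ^ n * of_real (expectation (\<lambda>\<omega>. Z \<omega> * q_hermite q n (X t \<omega>) / fact n)) =
       ?z ^ n / fact n * of_real (expectation (\<lambda>\<omega>. Z \<omega> * q_hermite q n (X t \<omega>)))" by simp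
    finally show ?thesis .
  qed
  have "(\<lambda>n. \<Sum>k\<le>n. ?a k * ?b (n - k)) sums (suminf ?a * suminf ?b)"
    by (rule Cauchy_product_sums[OF S(2) half_exp_coeff_sums(2)])
  moreover have "suminf ?a = (CLINT \<omega>|M. of_real (Z \<omega>) * iexp (\<theta> * X t \<omega>))" using S(1) by (simp add: sums_iff)
  moreover have "suminf ?b = of_real (exp (\<theta>\<^sup>2 / 2))"
    using half_exp_coeff_sums(1)[of ?z] by (simp add: sums_iff power_mult_distrib exp_of_real[symmetric])
  ultimately show ?thesis unfolding cn by simp
qed

text \<open>Going from t to s multiplies the n-th term by \<rho>^n, which amounts to replacing
  \<theta> by \<theta> \<rho> in the series.\<close>

lemma (in q_process) hermite_char_step_real:
  assumes q1: "q = 1" and st: "s \<le> t" and Z: "Z \<in> borel_measurable (past s)" "all_moments M Z"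
  defines "\<rho> \<equiv> exp (- \<alpha> * (t - s))"
  shows "(CLINT \<omega>|M. of_real (Z \<omega>) * iexp (\<theta> * X t \<omega>)) =
    of_real (exp (- (\<theta>\<^sup>2 * (1 - \<rho>\<^sup>2)) / 2)) * (CLINT \<omega>|M. of_real (Z \<omega>) * iexp (\<theta> * \<rho> * X s \<omega>))"
proof -
  have "(\<i> * of_real \<theta>) ^ n / fact n * complex_of_real (expectation (\<lambda>\<omega>. Z \<omega> * q_hermite q n (X t \<omega>))) =
     (\<i> * of_real (\<theta> * \<rho>)) ^ n / fact n * of_real (expectation (\<lambda>\<omega>. Z \<omega> * q_hermite q n (X s \<omega>)))" for n
    using linear_step[OF st Z, of n] by (simp add: \<rho>_def power_mult_distrib)
  then have "(CLINT \<omega>|M. of_real (Z \<omega>) * iexp (\<theta> * X t \<omega>)) * of_real (exp (\<theta>\<^sup>2 / 2)) =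
     (CLINT \<omega>|M. of_real (Z \<omega>) * iexp (\<theta> * \<rho> * X s \<omega>)) * of_real (exp ((\<theta> * \<rho>)\<^sup>2 / 2))"
    using hermite_generating_function[OF q1 Z(2), of \<theta> t] hermite_generating_function[OF q1 Z(2), of "\<theta> * \<rho>" s]
    by (simp only: sums_iff)
  then have "(CLINT \<omega>|M. of_real (Z \<omega>) * iexp (\<theta> * X t \<omega>)) * of_real (exp (\<theta>\<^sup>2 / 2)) * of_real (exp (- (\<theta>\<^sup>2 / 2))) =
     (CLINT \<omega>|M. of_real (Z \<omega>) * iexp (\<theta> * \<rho> * X s \<omega>)) * of_real (exp ((\<theta> * \<rho>)\<^sup>2 / 2)) * of_real (exp (- (\<theta>\<^sup>2 / 2)))"
    by (simp only:)
  then show ?thesis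
    unfolding mult.assoc of_real_mult[symmetric] exp_add[symmetric]
    by (simp add: power_mult_distrib algebra_simps diff_divide_distrib)
qed

text \<open>The complex weight exp(i Y) is split into the real weights cos Y and sin Y, to which the
  real version applies.\<close>

lemma (in q_process) hermite_char_step:
  assumes q1: "q = 1" and st: "s \<le> t" and Y: "Y \<in> borel_measurable (past s)"
  defines "\<rho> \<equiv> exp (- \<alpha> * (t - s))"
  shows "(CLINT \<omega>|M. iexp (Y \<omega> + \<theta> * X t \<omega>)) =
    of_real (exp (- (\<theta>\<^sup>2 * (1 - \<rho>\<^sup>2)) / 2)) * (CLINT \<omega>|M. iexp (Y \<omega> + \<theta> * \<rho> * X s \<omega>))"
proof -
  have Ym[measurable]: "Y \<in> borel_measurable M" by (rule past_measurable_M[OF Y])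
  have c: "(\<lambda>\<omega>. cos (Y \<omega>)) \<in> borel_measurable (past s)" "(\<lambda>\<omega>. sin (Y \<omega>)) \<in> borel_measurable (past s)"
    using Y by simp_all
  have am: "all_moments M (\<lambda>\<omega>. cos (Y \<omega>))" "all_moments M (\<lambda>\<omega>. sin (Y \<omega>))"
    by (rule all_moments_bounded[where B=1, OF finite_measure_axioms]; simp)+
  have i: "complex_integrable M (\<lambda>\<omega>. of_real (f \<omega>) * iexp (w * X r \<omega>))" if "all_moments M f" for f w r
    using all_moments_integrable[OF that]
    by (rule Bochner_Integration.integrable_bound) (use all_momentsD[OF that] in \<open>auto simp: norm_mult\<close>)
  have split: "(CLINT \<omega>|M. iexp (Y \<omega> + w * X r \<omega>)) = (CLINT \<omega>|M. of_real (cos (Y \<omega>)) * iexp (w * X r \<omega>))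
     + \<i> * (CLINT \<omega>|M. of_real (sin (Y \<omega>)) * iexp (w * X r \<omega>))" for w r
  proof -
    have "iexp (Y \<omega> + w * X r \<omega>) = of_real (cos (Y \<omega>)) * iexp (w * X r \<omega>) + \<i> * (of_real (sin (Y \<omega>)) * iexp (w * X r \<omega>))" for \<omega>
    proof -
      have "iexp (Y \<omega> + w * X r \<omega>) = iexp (Y \<omega>) * iexp (w * X r \<omega>)"
        by (simp add: exp_add[symmetric] algebra_simps)
      also have "iexp (Y \<omega>) = of_real (cos (Y \<omega>)) + \<i> * of_real (sin (Y \<omega>))"
        by (simp add: cis_conv_exp[symmetric] complex_eq_iff)
      finally show ?thesis by (simp add: algebra_simps)
    qed
    then show ?thesis using i[OF am(1), of w r] i[OF am(2), of w r] by (simp only: Bochner_Integration.integral_add integrable_mult_right integral_mult_right_zero)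
  qed
  show ?thesis
    unfolding split hermite_char_step_real[OF q1 st c(1) am(1), folded \<rho>_def] hermite_char_step_real[OF q1 st c(2) am(2), folded \<rho>_def]
    by (simp add: algebra_simps)
qed

lemma char_normal_density:
  assumes "0 < \<sigma>"
  shows "real_distribution (density lborel (\<lambda>x. ennreal (normal_density 0 \<sigma> x)))"
    and "char (density lborel (\<lambda>x. ennreal (normal_density 0 \<sigma> x))) t = of_real (exp (- (t\<^sup>2 * \<sigma>\<^sup>2) / 2))"
proof -
  interpret S: real_distribution std_normal_distribution by (rule real_dist_normal_dist)
  have "distributed std_normal_distribution lborel (\<lambda>x. x) std_normal_density"
    unfolding distributed_def using distr_id[of std_normal_distribution]
    by (auto simp: id_def cong: distr_cong)
  then have "distributed std_normal_distribution lborel (\<lambda>x. 0 + \<sigma> * x) (normal_density (0 + \<sigma> * 0) (\<bar>\<sigma>\<bar> * 1))"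
    using assms by (intro S.normal_density_affine) auto
  then have "distr std_normal_distribution lborel (\<lambda>x. \<sigma> * x) = density lborel (\<lambda>x. ennreal (normal_density 0 \<sigma> x))"
    using assms by (simp add: distributed_def)
  then have d: "density lborel (\<lambda>x. ennreal (normal_density 0 \<sigma> x)) = distr std_normal_distribution borel (\<lambda>x. \<sigma> * x)"
    by (metis distr_cong sets_lborel)
  show "real_distribution (density lborel (\<lambda>x. ennreal (normal_density 0 \<sigma> x)))"
    unfolding d by (rule S.real_distribution_distr) simp
  have "char (distr std_normal_distribution borel (\<lambda>x. \<sigma> * x)) t = char std_normal_distribution (t * \<sigma>)"
    unfolding char_def by (subst integral_distr) (simp_all add: mult.assoc)
  then show "char (density lborel (\<lambda>x. ennreal (normal_density 0 \<sigma> x))) t = of_real (exp (- (t\<^sup>2 * \<sigma>\<^sup>2) / 2))"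
    unfolding d by (simp add: char_std_normal_distribution power_mult_distrib)
qed

text \<open>The sign of \<open>Q\<close> is forced by |char(1)| \<le> 1; Q = 0 is the Dirac case of
  \<open>gaussian_law\<close>.\<close>

lemma gaussian_law_of_char:
  assumes "real_distribution \<nu>" and ch: "\<And>\<theta>. char \<nu> \<theta> = of_real (exp (- (\<theta>\<^sup>2 * Q) / 2))"
  shows "gaussian_law \<nu>"
proof -
  interpret real_distribution \<nu> by fact
  have "exp (- Q / 2) \<le> 1" using cmod_char_le_1[of 1] by (simp add: ch)
  then have Q: "0 \<le> Q" by simp
  show ?thesis
  proof (cases "Q = 0")
    case True
    have r: "real_distribution (return borel (0 :: real))"
      by (auto simp: real_distribution_def real_distribution_axioms_def intro: prob_space_return)
    have "char (return borel 0) \<theta> = 1" for \<theta>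
      unfolding char_def by (subst integral_return) auto
    then have "\<nu> = return borel 0"
      by (intro Levy_uniqueness[OF assms(1) r]) (simp add: fun_eq_iff ch True)
    then show ?thesis by (auto simp: gaussian_law_def)
  next
    case False
    then have s: "0 < sqrt Q" using Q by simp
    have "\<nu> = density lborel (\<lambda>x. ennreal (normal_density 0 (sqrt Q) x))"
      by (rule Levy_uniqueness[OF assms(1) char_normal_density(1)[OF s]])
         (use Q in \<open>simp add: fun_eq_iff ch char_normal_density(2)[OF s]\<close>)
    then show ?thesis using s unfolding gaussian_law_def by blast
  qed
qed

context q_process
begin

lemma mean_zero: "expectation (X t) = 0"
  using mean_q_hermite_Suc[of 0] expectation_stationary[of "\<lambda>x. x" t] by (simp add: mean_def)

text \<open>Induction on the largest time b: conditioning at the next smaller time s multiplies the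
  transform by a Gaussian factor and adds c_b \<rho> to the coefficient at s. Arbitrary coefficients
  in the induction absorb this shift.\<close>

lemma gaussian_char:
  assumes q1: "q = 1" and "finite T"
  shows "\<exists>Q. \<forall>\<theta>. (CLINT \<omega>|M. iexp (\<theta> * (\<Sum>t\<in>T. c t * X t \<omega>))) = of_real (exp (- (\<theta>\<^sup>2 * Q) / 2))"
  using assms(2)
proof (induction T arbitrary: c rule: finite_linorder_max_induct)
  case empty
  show ?case by (intro exI[of _ 0]) (simp add: prob_space)
next
  case (insert b A)
  show ?case
  proof (cases "A = {}")
    case True
    \<comment> \<open>With weight 1 all terms of the generating function except the constant one
      vanish.\<close>
    have one: "(CLINT \<omega>|M. iexp (w * X b \<omega>)) = of_real (exp (- w\<^sup>2 / 2))" for w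
    proof -
      have eq: "(\<i> * of_real w) ^ n / fact n * complex_of_real (expectation (\<lambda>\<omega>. 1 * q_hermite q n (X b \<omega>))) = (if n = 0 then 1 else 0)" for n
      proof (cases n)
        case (Suc m)
        have "expectation (\<lambda>\<omega>. q_hermite q n (X b \<omega>)) = mean (q_hermite_poly q n)"
          using expectation_stationary[of "q_hermite q n" b] by (simp add: mean_def)
        then show ?thesis using mean_q_hermite_Suc[of m] Suc by simp
      qed (simp add: prob_space)
      have "(\<lambda>n. if n = 0 then 1 else 0 :: complex) sums ((CLINT \<omega>|M. of_real 1 * iexp (w * X b \<omega>)) * of_real (exp (w\<^sup>2 / 2)))"
        using hermite_generating_function[OF q1 all_moments_const[OF finite_measure_axioms, of 1], of w b] unfolding eq .
      moreover have "(\<lambda>n. if n = 0 then 1 else 0 :: complex) sums 1"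
        using sums_single[of 0 "\<lambda>_. 1::complex"] by simp
      ultimately have "(CLINT \<omega>|M. iexp (w * X b \<omega>)) * of_real (exp (w\<^sup>2 / 2)) = 1"
        using sums_unique2 by fastforce
      then have "(CLINT \<omega>|M. iexp (w * X b \<omega>)) = inverse (of_real (exp (w\<^sup>2 / 2)))"
        by (metis inverse_unique mult.commute)
      then show ?thesis by (simp add: of_real_inverse[symmetric] exp_minus[symmetric])
    qed
    show ?thesis
      using one[of "_ * c b"] True by (intro exI[of _ "(c b)\<^sup>2"]) (simp add: mult.assoc[symmetric] power_mult_distrib)
  next
    case False
    define s where "s = Max A"
    have s: "s \<in> A" "\<And>t. t \<in> A \<Longrightarrow> t \<le> s" "s < b" using insert.hyps False by (auto simp: s_def)
    define \<rho> where "\<rho> = exp (- \<alpha> * (b - s))"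
    define c' where "c' t = c t + (if t = s then c b * \<rho> else 0)" for t
    obtain Q where Q: "\<And>\<theta>. (CLINT \<omega>|M. iexp (\<theta> * (\<Sum>t\<in>A. c' t * X t \<omega>))) = of_real (exp (- (\<theta>\<^sup>2 * Q) / 2))"
      using insert.IH[of c'] by blast
    have c': "(\<Sum>t\<in>A. c' t * X t \<omega>) = (\<Sum>t\<in>A. c t * X t \<omega>) + c b * \<rho> * X s \<omega>" for \<omega>
    proof -
      have "(\<Sum>t\<in>A. c' t * X t \<omega>) = (\<Sum>t\<in>A. c t * X t \<omega> + (if t = s then c b * \<rho> * X s \<omega> else 0))"
        by (rule sum.cong) (auto simp: c'_def algebra_simps)
      then show ?thesis using insert.hyps(1) s(1) by (simp add: sum.distrib)
    qed
    have b: "b \<notin> A" using insert.hyps(2) by blast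
    have "(CLINT \<omega>|M. iexp (\<theta> * (\<Sum>t\<in>insert b A. c t * X t \<omega>))) = of_real (exp (- (\<theta>\<^sup>2 * (Q + (c b)\<^sup>2 * (1 - \<rho>\<^sup>2))) / 2))" for \<theta>
    proof -
      have Y: "(\<lambda>\<omega>. \<theta> * (\<Sum>t\<in>A. c t * X t \<omega>)) \<in> borel_measurable (past s)"
        using s(2) by (intro borel_measurable_times borel_measurable_sum borel_measurable_const X_past)
      have "(CLINT \<omega>|M. iexp (\<theta> * (\<Sum>t\<in>insert b A. c t * X t \<omega>))) =
          (CLINT \<omega>|M. iexp (\<theta> * (\<Sum>t\<in>A. c t * X t \<omega>) + (\<theta> * c b) * X b \<omega>))"
        using insert.hyps(1) b by (simp add: algebra_simps)
      also have "\<dots> = of_real (exp (- ((\<theta> * c b)\<^sup>2 * (1 - \<rho>\<^sup>2)) / 2)) *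
          (CLINT \<omega>|M. iexp (\<theta> * (\<Sum>t\<in>A. c t * X t \<omega>) + (\<theta> * c b) * \<rho> * X s \<omega>))"
        unfolding \<rho>_def by (rule hermite_char_step[OF q1 _ Y]) (use s(3) in simp)
      also have "(CLINT \<omega>|M. iexp (\<theta> * (\<Sum>t\<in>A. c t * X t \<omega>) + (\<theta> * c b) * \<rho> * X s \<omega>)) =
          (CLINT \<omega>|M. iexp (\<theta> * (\<Sum>t\<in>A. c' t * X t \<omega>)))"
        unfolding c' by (simp add: distrib_left mult.assoc)
      also have "of_real (exp (- ((\<theta> * c b)\<^sup>2 * (1 - \<rho>\<^sup>2)) / 2)) * \<dots> = of_real (exp (- (\<theta>\<^sup>2 * (Q + (c b)\<^sup>2 * (1 - \<rho>\<^sup>2))) / 2))"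
        unfolding Q of_real_mult[symmetric] exp_add[symmetric]
        by (rule arg_cong[of _ _ "\<lambda>w. of_real (exp w)"]) (simp add: power_mult_distrib algebra_simps add_divide_distrib diff_divide_distrib)
      finally show ?thesis .
    qed
    then show ?thesis by blast
  qed
qed

theorem ornstein_uhlenbeck_q_process:
  assumes q1: "q = 1" shows "ornstein_uhlenbeck \<alpha> M X"
  unfolding ornstein_uhlenbeck_def gaussian_process_def
proof (intro conjI allI impI prob_space_axioms X_measurable mean_zero)
  fix T :: "real set" and c :: "real \<Rightarrow> real" assume "finite T"
  then obtain Q where Q: "\<And>\<theta>. (CLINT \<omega>|M. iexp (\<theta> * (\<Sum>t\<in>T. c t * X t \<omega>))) = of_real (exp (- (\<theta>\<^sup>2 * Q) / 2))"
    using gaussian_char[OF q1] by blast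
  show "gaussian_law (distr M borel (\<lambda>\<omega>. \<Sum>t\<in>T. c t * X t \<omega>))"
  proof (rule gaussian_law_of_char)
    show "real_distribution (distr M borel (\<lambda>\<omega>. \<Sum>t\<in>T. c t * X t \<omega>))"
      by (rule real_distribution_distr) measurable
    show "char (distr M borel (\<lambda>\<omega>. \<Sum>t\<in>T. c t * X t \<omega>)) \<theta> = of_real (exp (- (\<theta>\<^sup>2 * Q) / 2))" for \<theta>
      unfolding char_def by (subst integral_distr) (simp_all add: Q[simplified])
  qed
next
  have le: "covariance M (X s) (X t) = exp (- \<alpha> * \<bar>t - s\<bar>) * (\<integral>\<omega>. (X 0 \<omega>)\<^sup>2 \<partial>M)" if "s \<le> t" for s t
    using linear_step[OF that X_past[OF order_refl] all_moments_X, of 1] that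
      expectation_stationary[of "\<lambda>x. x\<^sup>2" s]
    by (simp add: covariance_def mean_zero power2_eq_square)
  fix s t
  show "covariance M (X s) (X t) = exp (- \<alpha> * \<bar>t - s\<bar>) * (\<integral>\<omega>. (X 0 \<omega>)\<^sup>2 \<partial>M)"
    using le[of s t] le[of t s] by (cases "s \<le> t") (simp_all add: covariance_def mult.commute abs_minus_commute)
qed

end

section \<open>Hermite polynomials under the standard normal law\<close>

lemma std_normal_moment_rec:
  "(\<integral>x. x ^ Suc n \<partial>std_normal_distribution) = real n * (\<integral>x. x ^ (n - 1) \<partial>std_normal_distribution)"
proof (cases "even n")
  case True
  then have o: "odd (Suc n)" "n = 0 \<or> odd (n - 1)" by (auto elim!: evenE)
  have "real n * (\<integral>x. x ^ (n - 1) \<partial>std_normal_distribution) = 0"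
    using o(2) integral_std_normal_distribution_moment_odd[of "n - 1"] by auto
  then show ?thesis unfolding integral_std_normal_distribution_moment_odd[OF o(1)] by simp
next
  case False
  then obtain k where n: "n = 2 * k + 1" by (elim oddE)
  have "(\<integral>x. x ^ (2 * Suc k) \<partial>std_normal_distribution) = fact (2 * Suc k) / (2 ^ Suc k * fact (Suc k))"
    by (rule std_normal_distribution_even_moments)
  also have "\<dots> = real (2 * k + 1) * (fact (2 * k) / (2 ^ k * fact k))"
  proof -
    have "(fact (2 * Suc k) :: real) = (2 * real (Suc k)) * (real (2 * k + 1) * fact (2 * k))"
      by (simp add: algebra_simps)
    moreover have "(2 ^ Suc k * fact (Suc k) :: real) = (2 * real (Suc k)) * (2 ^ k * fact k)" by simp
    ultimately show ?thesis by (simp only: mult_divide_mult_cancel_left_if) simp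
  qed
  also have "fact (2 * k) / (2 ^ k * fact k) = (\<integral>x. x ^ (2 * k) \<partial>std_normal_distribution)"
    by (rule std_normal_distribution_even_moments(1)[symmetric])
  finally show ?thesis by (simp add: n)
qed

text \<open>The Appell property of the Hermite polynomials, which is special to q = 1.\<close>

lemma pderiv_q_hermite_poly_one:
  "pderiv (q_hermite_poly 1 (Suc n)) = Polynomial.smult (real (Suc n)) (q_hermite_poly 1 n)"
proof (induction n rule: less_induct)
  case (less n)
  show ?case
  proof (cases n)
    case 0
    then show ?thesis by (simp add: pderiv_pCons one_pCons)
  next
    case (Suc m)
    have x: "pderiv [:0, 1::real:] = 1" by (simp add: pderiv_pCons one_pCons)
    let ?H = "q_hermite_poly 1"
    have "pderiv (?H (Suc n)) = pderiv ([:0, 1:] * ?H (Suc m) - Polynomial.smult (real (Suc m)) (?H m))"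
      by (simp add: Suc q_int_one)
    also have "\<dots> = ?H (Suc m) + [:0, 1:] * Polynomial.smult (real (Suc m)) (?H m) - Polynomial.smult (real (Suc m)) (pderiv (?H m))"
      using less[of m] Suc by (simp only: pderiv_diff pderiv_mult pderiv_smult x mult_1_right mult_1_left add.commute)
    also have "Polynomial.smult (real (Suc m)) (pderiv (?H m)) = Polynomial.smult (real (Suc m)) (Polynomial.smult (q_int 1 m) (?H (m - 1)))"
      using less[of "m - 1"] Suc by (cases m) (simp_all add: q_int_one)
    also have "?H (Suc m) + [:0, 1:] * Polynomial.smult (real (Suc m)) (?H m) - \<dots> =
       ?H (Suc m) + Polynomial.smult (real (Suc m)) ([:0, 1:] * ?H m - Polynomial.smult (q_int 1 m) (?H (m - 1)))"
      by (simp only: mult_smult_right smult_diff_right)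
    also have "[:0, 1:] * ?H m - Polynomial.smult (q_int 1 m) (?H (m - 1)) = ?H (Suc m)"
      using q_hermite_poly_rec[of 1 m] by simp
    also have "?H (Suc m) + Polynomial.smult (real (Suc m)) (?H (Suc m)) = Polynomial.smult (real (Suc (Suc m))) (?H (Suc m))"
      by (simp only: of_nat_Suc[of "Suc m"] smult_add_left smult_1_left)
    finally show ?thesis unfolding Suc .
  qed
qed

context stationary_moments
begin

text \<open>Stein's identity for polynomials. On monomials it is the moment recursion of the normal
  law, and both sides are linear.\<close>

lemma mean_stein:
  assumes "distr M borel (X 0) = std_normal_distribution"
  shows "mean ([:0, 1:] * p) = mean (pderiv p)"
proof -
  have mom: "mean (monom 1 n) = (\<integral>x. x ^ n \<partial>std_normal_distribution)" for n
    unfolding assms[symmetric] mean_def by (subst integral_distr) (simp_all add: poly_monom)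
  have m: "mean ([:0, 1:] * monom 1 n) = mean (pderiv (monom 1 n))" for n
  proof -
    have "[:0, 1::real:] * monom 1 n = monom 1 (Suc n)" by (simp add: monom_Suc)
    moreover have "pderiv (monom (1::real) n) = Polynomial.smult (real n) (monom 1 (n - 1))"
      by (simp add: pderiv_monom smult_monom)
    ultimately show ?thesis by (simp add: mom std_normal_moment_rec del: power_Suc)
  qed
  have pderiv_sum: "pderiv (sum f I) = (\<Sum>i\<in>I. pderiv (f i))" for f :: "nat \<Rightarrow> real poly" and I
    by (induction I rule: infinite_finite_induct) (simp_all add: pderiv_add)
  define q where "q = (\<Sum>i\<le>degree p. Polynomial.smult (coeff p i) (monom 1 i))"
  have "p = q" using poly_as_sum_of_monoms[of p] by (simp add: q_def smult_monom)
  moreover have "mean ([:0, 1:] * q) = mean (pderiv q)"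
    unfolding q_def sum_distrib_left pderiv_sum mult_smult_right pderiv_smult mean_sum mean_simps m ..
  ultimately show ?thesis by simp
qed

text \<open>E H_(n+1) = E (x H_n) - n E H_(n-1), and Stein's identity turns E (x H_n) into E H_n' =
  n E H_(n-1).\<close>

lemma mean_hermite_normal:
  assumes "distr M borel (X 0) = std_normal_distribution"
  shows "mean (q_hermite_poly 1 (Suc n)) = 0"
proof -
  let ?H = "q_hermite_poly 1"
  have "mean (?H (Suc n)) = mean ([:0, 1:] * ?H n) - q_int 1 n * mean (?H (n - 1))"
    unfolding q_hermite_poly_rec mean_simps by simp
  also have "\<dots> = 0"
    unfolding mean_stein[OF assms] by (cases n) (simp_all only: pderiv_q_hermite_poly_one mean_simps, simp_all add: q_int_one)
  finally show ?thesis .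
qed

end

section \<open>The q-normal density\<close>

lemma q_int_geometric: "(1 - q) * q_int q n = 1 - q ^ n"
proof (induction n)
  case (Suc n)
  have "(1 - q) * q_int q (Suc n) = (1 - q) + q * ((1 - q) * q_int q n)"
    by (simp add: q_int_Suc algebra_simps)
  also have "\<dots> = 1 - q ^ Suc n" unfolding Suc by (simp add: algebra_simps)
  finally show ?case .
qed simp

text \<open>The numbers \<open>W n j\<close> will be the sine coefficients of order \<open>j\<close> of the product of the
  rescaled \<open>n\<close>-th q-Hermite polynomial with the theta series below; the recursion in \<open>n\<close> alone
  shows that the first coefficient vanishes for \<open>n > 0\<close>.\<close>

lemma theta_coefficient_vanishes:
  fixes q :: real and W :: "nat \<Rightarrow> nat \<Rightarrow> real"
  assumes W0: "\<And>n. W n 0 = 0"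
    and Wodd: "\<And>k. W 0 (2 * k + 1) = (-1) ^ k * q ^ (k * (k + 1) div 2)" and Weven: "\<And>k. W 0 (2 * k) = 0"
    and rec: "\<And>n j. W (Suc n) (Suc j) = W n (Suc (Suc j)) + W n j - (1 - q ^ n) * W (n - 1) (Suc j)"
  shows "W (Suc n) 1 = 0"
proof -
  \<comment> \<open>The claim about the first coefficient is not inductive by itself. What is proved
    is the whole table: W n (n + 1 + 2 l) = A n l, and zero for j \<le> n or n + j even.\<close>
  define A where "A n l = (-1) ^ l * q ^ (l * (l + 1) div 2) * (\<Prod>i=1..n. 1 - q ^ (l + i))" for n l :: nat
  have tri: "Suc l * (Suc l + 1) div 2 = l * (l + 1) div 2 + Suc l" for l :: nat
  proof -
    have "Suc l * (Suc l + 1) = l * (l + 1) + 2 * Suc l" by simp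
    then show ?thesis by (simp del: mult_Suc mult_Suc_right)
  qed
  have shift: "(\<Prod>i=1..Suc n. 1 - q ^ (l + i)) = (1 - q ^ (l + 1)) * (\<Prod>i=1..n. 1 - q ^ (Suc l + i))" for n l
    by (induction n) (simp_all add: mult_ac)
  have A_rec: "A (Suc n) l = A n (Suc l) + A n l - (1 - q ^ n) * A (n - 1) (Suc l)" for n l
  proof (cases n)
    case 0
    show ?thesis unfolding A_def tri power_add 0 by (simp add: algebra_simps)
  next
    case (Suc m)
    define p where "p = (\<Prod>i=1..m. 1 - q ^ (Suc l + i))"
    define e where "e = (-1) ^ l * q ^ (l * (l + 1) div 2)"
    have e': "(-1) ^ Suc l * q ^ (Suc l * (Suc l + 1) div 2) = - (e * q ^ Suc l)"
      unfolding e_def tri power_add by simp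
    have pn: "(\<Prod>i=1..n. 1 - q ^ (Suc l + i)) = p * (1 - q ^ (l + n + 1))"
      by (simp add: Suc p_def)
    have 1: "A (Suc n) l = e * ((1 - q ^ (l + 1)) * (p * (1 - q ^ (l + n + 1))))"
      unfolding A_def shift[where n=n and l=l] pn e_def ..
    have 2: "A n (Suc l) = - (e * q ^ Suc l) * (p * (1 - q ^ (l + n + 1)))"
      unfolding A_def e' pn ..
    have 3: "A n l = e * ((1 - q ^ (l + 1)) * p)"
      unfolding A_def Suc shift[where n=m and l=l] e_def p_def ..
    have 4: "A (n - 1) (Suc l) = - (e * q ^ Suc l) * p"
      unfolding A_def e' p_def Suc by simp
    show ?thesis unfolding 1 2 3 4 by (simp add: algebra_simps power_add)
  qed
  have "(\<forall>j. j \<le> n \<or> even (n + j) \<longrightarrow> W n j = 0) \<and> (\<forall>l. W n (n + 1 + 2 * l) = A n l)" for n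
  proof (induction n rule: less_induct)
    case (less n)
    show ?case
    proof (cases n)
      case 0
      have "W 0 j = 0" if "even j" for j using Weven that by (auto elim!: evenE)
      then show ?thesis using Wodd by (auto simp: 0 A_def W0)
    next
      case (Suc m)
      have z: "W m j = 0" if "j \<le> m \<or> even (m + j)" for j using less[of m] Suc that by blast
      have a: "W m (m + 1 + 2 * l) = A m l" for l using less[of m] Suc by blast
      have z': "(1 - q ^ m) * W (m - 1) j = 0" if "j \<le> m - 1 \<or> even (m - 1 + j)" for j
        using less[of "m - 1"] Suc that by (cases m) auto
      have a': "(1 - q ^ m) * W (m - 1) (m + 2 * l) = (1 - q ^ m) * A (m - 1) l" for l
      proof (cases m)
        case (Suc m')
        then show ?thesis using less[of m'] \<open>n = Suc m\<close> by simp
      qed simp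
      have "W n j = 0" if j: "j \<le> n \<or> even (n + j)" for j
      proof (cases j)
        case 0
        then show ?thesis by (simp add: W0)
      next
        case (Suc i)
        have r: "W n j = W m (Suc (Suc i)) + W m i - (1 - q ^ m) * W (m - 1) (Suc i)"
          using rec[of m i] \<open>n = Suc m\<close> Suc by simp
        show ?thesis
        proof (cases "even (n + j)")
          case True
          then have "even (m + Suc (Suc i))" "even (m + i)" using \<open>n = Suc m\<close> Suc by auto
          moreover have "m = 0 \<or> even (m - 1 + Suc i)" using True \<open>n = Suc m\<close> Suc by (cases m) auto
          ultimately show ?thesis unfolding r using z[of "Suc (Suc i)"] z[of i] z'[of "Suc i"] by (cases m) auto
        next
          case False
          then have le: "i \<le> m" "even (m + Suc i)" using j \<open>n = Suc m\<close> Suc by auto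
          show ?thesis
          \<comment> \<open>At j = n - 1 the lowest nonzero coefficients of the two preceding rows
            meet and cancel; at all smaller j every term is zero.\<close>
          proof (cases "Suc i = m")
            case True
            have "W m (Suc (Suc i)) = A m 0" using a[of 0] True by simp
            moreover have "(1 - q ^ m) * W (m - 1) (Suc i) = (1 - q ^ m) * A (m - 1) 0" using a'[of 0] True by simp
            moreover have "A m 0 = (1 - q ^ m) * A (m - 1) 0" using True by (cases m) (simp_all add: A_def)
            moreover have "W m i = 0" using z[of i] le by simp
            ultimately show ?thesis unfolding r by linarith
          next
            case ne: False
            then have "Suc (Suc i) \<le> m" using le by (metis Suc_leI even_Suc le_neq_implies_less add_Suc_right even_add)
            then have "Suc i \<le> m - 1" "i \<le> m" by linarith+
            then show ?thesis unfolding r using z[of "Suc (Suc i)"] z[of i] z'[of "Suc i"] \<open>Suc (Suc i) \<le> m\<close> by simp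
          qed
        qed
      qed
      moreover have "W n (n + 1 + 2 * l) = A n l" for l
      proof -
        have "W n (n + 1 + 2 * l) = W m (m + 1 + 2 * Suc l) + W m (m + 1 + 2 * l) - (1 - q ^ m) * W (m - 1) (m + 2 * Suc l)"
          using rec[of m "m + 1 + 2 * l"] Suc by simp
        then show ?thesis unfolding a a' using A_rec[of m l] Suc by simp
      qed
      ultimately show ?thesis by blast
    qed
  qed
  then show ?thesis by (metis One_nat_def Suc_leI zero_less_Suc)
qed

text \<open>For q > 0 this is Jacobi's theta function theta_1 with nome sqrt q, divided by 2
  q^(1/8).\<close>

definition theta :: "real \<Rightarrow> real \<Rightarrow> real" where
  "theta q x = (\<Sum>k. (-1) ^ k * q ^ (k * (k + 1) div 2) * sin (real (2 * k + 1) * x))"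

lemma theta_term_bound:
  fixes q y :: real
  assumes "\<bar>q\<bar> < 1"
  shows "\<bar>(-1) ^ k * q ^ (k * (k + 1) div 2) * sin y\<bar> \<le> \<bar>q\<bar> ^ k"
proof -
  have "k \<le> k * (k + 1) div 2" by (cases k) (auto simp: div_le_mono)
  then have "\<bar>q\<bar> ^ (k * (k + 1) div 2) \<le> \<bar>q\<bar> ^ k" using assms by (intro power_decreasing) auto
  then have "\<bar>q\<bar> ^ (k * (k + 1) div 2) * \<bar>sin y\<bar> \<le> \<bar>q\<bar> ^ k * 1" by (intro mult_mono) auto
  then show ?thesis by (simp add: abs_mult power_abs)
qed

lemma theta_summable:
  assumes "\<bar>q\<bar> < 1"
  shows "summable (\<lambda>k. \<bar>(-1) ^ k * q ^ (k * (k + 1) div 2) * sin (real (2 * k + 1) * x)\<bar>)"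
  by (rule summable_comparison_test'[where g="\<lambda>k. \<bar>q\<bar> ^ k" and N=0])
     (use assms theta_term_bound[OF assms] in \<open>auto simp: summable_geometric\<close>)

lemma theta_bounded:
  assumes "\<bar>q\<bar> < 1" shows "\<bar>theta q x\<bar> \<le> 1 / (1 - \<bar>q\<bar>)"
proof -
  have "\<bar>theta q x\<bar> \<le> (\<Sum>k. \<bar>(-1) ^ k * q ^ (k * (k + 1) div 2) * sin (real (2 * k + 1) * x)\<bar>)"
    unfolding theta_def by (rule summable_rabs[OF theta_summable[OF assms]])
  also have "\<dots> \<le> (\<Sum>k. \<bar>q\<bar> ^ k)"
    using assms by (intro suminf_le theta_term_bound theta_summable summable_geometric) auto
  also have "\<dots> = 1 / (1 - \<bar>q\<bar>)" using assms by (intro suminf_geometric) simp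
  finally show ?thesis .
qed

lemma theta_measurable [measurable]: "theta q \<in> borel_measurable borel"
  unfolding theta_def by measurable

text \<open>Needed because the substitution for the density runs through -cos, which is increasing
  on [0, pi], while the density is written with arccos.\<close>

lemma theta_reflect: "theta q (pi - x) = theta q x"
proof -
  have "sin (real (2 * k + 1) * (pi - x)) = sin (real (2 * k + 1) * x)" for k
  proof -
    have "real (2 * k + 1) * (pi - x) = (pi - real (2 * k + 1) * x) + 2 * real k * pi"
      by (simp add: algebra_simps)
    then have "sin (real (2 * k + 1) * (pi - x)) = sin (pi - real (2 * k + 1) * x)"
      by (simp only: sin_add cos_2npi sin_2npi mult_1_right mult_zero_right add_0_right)
    then show ?thesis by simp
  qed
  then show ?thesis by (simp add: theta_def)
qed

text \<open>Normalized to a probability so that the determinacy theorem applies with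
  \<open>circle\<close> as one of its two spaces.\<close>

definition circle :: "real measure" where
  "circle = density lborel (\<lambda>x. ennreal (indicator {0..pi} x / pi))"

lemma prob_space_circle: "prob_space circle"
proof
  have "emeasure circle (space circle) = (\<integral>\<^sup>+x. ennreal (1 / pi) * indicator {0..pi} x \<partial>lborel)"
    unfolding circle_def
    by (subst emeasure_density) (auto intro!: nn_integral_cong split: split_indicator)
  also have "\<dots> = 1"
    by (subst nn_integral_cmult_indicator) (auto simp: ennreal_mult[symmetric])
  finally show "emeasure circle (space circle) = 1" .
qed

lemma sets_circle [measurable_cong]: "sets circle = sets borel"
  by (simp add: circle_def)

lemma integral_circle:
  fixes g :: "real \<Rightarrow> real"
  assumes "g \<in> borel_measurable borel"
  shows "(\<integral>x. g x \<partial>circle) = (\<integral>x. g x * indicator {0..pi} x \<partial>lborel) / pi"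
proof -
  have "(\<integral>x. g x \<partial>circle) = (\<integral>x. (indicator {0..pi} x / pi) *\<^sub>R g x \<partial>lborel)"
    unfolding circle_def using assms by (subst integral_density) auto
  also have "\<dots> = (\<integral>x. (1 / pi) * (g x * indicator {0..pi} x) \<partial>lborel)"
    by (rule Bochner_Integration.integral_cong) auto
  finally show ?thesis by simp
qed

lemma integrable_circle_bounded:
  fixes g :: "real \<Rightarrow> real"
  assumes "g \<in> borel_measurable borel" "\<And>x. \<bar>g x\<bar> \<le> C"
  shows "integrable circle g"
proof -
  interpret prob_space circle by (rule prob_space_circle)
  show ?thesis by (rule integrable_const_bound[where B=C]) (use assms in auto)
qed

lemma integral_circle_cos:
  "(\<integral>x. cos (of_int k * x) \<partial>circle) = (if k = 0 then 1 else 0)"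
proof (cases "k = 0")
  case True
  interpret prob_space circle by (rule prob_space_circle)
  show ?thesis using True by (simp add: prob_space)
next
  case False
  have "(\<integral>x. cos (of_int k * x) * indicator {0..pi} x \<partial>lborel) = sin (of_int k * pi) / of_int k - sin (of_int k * 0) / of_int k"
  proof (rule integral_FTC_Icc_real)
    show "((\<lambda>x. sin (of_int k * x) / of_int k) has_real_derivative cos (of_int k * x)) (at x)" for x
      using False by (auto intro!: derivative_eq_intros)
  qed (auto intro!: continuous_intros)
  then show ?thesis using False by (subst integral_circle) (simp_all add: sin_npi_int[of k, unfolded mult.commute[of pi]])
qed

lemma integral_circle_sin_sin:
  "(\<integral>x. 2 * (sin (real j * x) * sin (real k * x)) \<partial>circle) = (if j = k \<and> j \<noteq> 0 then 1 else 0)"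
proof -
  have "(\<integral>x. 2 * (sin (real j * x) * sin (real k * x)) \<partial>circle) =
      (\<integral>x. cos (of_int (int j - int k) * x) - cos (of_int (int j + int k) * x) \<partial>circle)"
    by (rule Bochner_Integration.integral_cong) (simp_all add: sin_times_sin left_diff_distrib distrib_right)
  also have "\<dots> = (\<integral>x. cos (of_int (int j - int k) * x) \<partial>circle) - (\<integral>x. cos (of_int (int j + int k) * x) \<partial>circle)"
    by (intro Bochner_Integration.integral_diff integrable_circle_bounded[where C=1]) auto
  also have "\<dots> = (if j = k \<and> j \<noteq> 0 then 1 else 0)"
    unfolding integral_circle_cos by auto
  finally show ?thesis .
qed

lemma integral_circle_sin_theta:
  assumes q: "\<bar>q\<bar> < 1"
  shows "(\<integral>x. 2 * (sin (real j * x) * theta q x) \<partial>circle) =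
    (if odd j then (-1) ^ (j div 2) * q ^ ((j div 2) * (j div 2 + 1) div 2) else 0)"
proof -
  let ?c = "\<lambda>k. (-1) ^ k * q ^ (k * (k + 1) div 2) :: real"
  let ?f = "\<lambda>k x. 2 * (sin (real j * x) * (?c k * sin (real (2 * k + 1) * x)))"
  have b: "\<bar>?f k x\<bar> \<le> 2 * \<bar>q\<bar> ^ k" for k x
  proof -
    have "\<bar>sin (real j * x)\<bar> * \<bar>?c k * sin (real (2 * k + 1) * x)\<bar> \<le> 1 * \<bar>q\<bar> ^ k"
      by (intro mult_mono theta_term_bound q) auto
    then show ?thesis by (simp add: abs_mult)
  qed
  have "(\<integral>x. 2 * (sin (real j * x) * theta q x) \<partial>circle) = (\<integral>x. (\<Sum>k. ?f k x) \<partial>circle)"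
    unfolding theta_def
    by (intro Bochner_Integration.integral_cong refl)
       (simp only: suminf_mult[OF summable_rabs_cancel[OF theta_summable[OF q]]]
          suminf_mult[OF summable_mult[OF summable_rabs_cancel[OF theta_summable[OF q]]]])
  also have "\<dots> = (\<Sum>k. \<integral>x. ?f k x \<partial>circle)"
  proof (rule integral_suminf)
    show i: "integrable circle (?f k)" for k
      by (rule integrable_circle_bounded[OF _ b]) measurable
    show "AE x in circle. summable (\<lambda>k. norm (?f k x))"
    proof (rule AE_I2)
      fix x show "summable (\<lambda>k. norm (?f k x))"
        by (rule summable_comparison_test'[where g="\<lambda>k. 2 * \<bar>q\<bar> ^ k" and N=0])
           (use q b in \<open>auto intro!: summable_mult summable_geometric\<close>)
    qed
    interpret prob_space circle by (rule prob_space_circle)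
    show "summable (\<lambda>k. \<integral>x. norm (?f k x) \<partial>circle)"
    proof (rule summable_comparison_test'[where g="\<lambda>k. 2 * \<bar>q\<bar> ^ k" and N=0])
      fix k
      have "(\<integral>x. norm (?f k x) \<partial>circle) \<le> (\<integral>x. 2 * \<bar>q\<bar> ^ k \<partial>circle)"
      proof (rule integral_mono)
        show "norm (?f k x) \<le> 2 * \<bar>q\<bar> ^ k" for x unfolding real_norm_def by (rule b)
      qed (intro integrable_norm i, simp)
      then show "norm (\<integral>x. norm (?f k x) \<partial>circle) \<le> 2 * \<bar>q\<bar> ^ k"
        by (simp add: prob_space)
    qed (use q in \<open>auto intro!: summable_mult summable_geometric\<close>)
  qed
  also have "(\<lambda>k. \<integral>x. ?f k x \<partial>circle) = (\<lambda>k. ?c k * (if j = 2 * k + 1 then 1 else 0))"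
  proof
    fix k
    have "(\<integral>x. ?f k x \<partial>circle) = (\<integral>x. ?c k * (2 * (sin (real j * x) * sin (real (2 * k + 1) * x))) \<partial>circle)"
      by (rule Bochner_Integration.integral_cong) (simp_all only: mult_ac)
    also have "\<dots> = ?c k * (\<integral>x. 2 * (sin (real j * x) * sin (real (2 * k + 1) * x)) \<partial>circle)"
      by (rule integral_mult_right_zero)
    also have "\<dots> = ?c k * (if j = 2 * k + 1 then 1 else 0)"
      unfolding integral_circle_sin_sin by simp
    finally show "(\<integral>x. ?f k x \<partial>circle) = ?c k * (if j = 2 * k + 1 then 1 else 0)" .
  qed
  also have "(\<Sum>k. ?c k * (if j = 2 * k + 1 then 1 else 0)) = (if odd j then ?c (j div 2) else 0)"
  proof (cases "odd j")
    case True
    then have "(\<lambda>k. ?c k * (if j = 2 * k + 1 then 1 else 0)) = (\<lambda>k. if k = j div 2 then ?c k else 0)"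
      by (auto simp: fun_eq_iff)
    then show ?thesis using True sums_single[of "j div 2" ?c] by (simp add: sums_iff)
  next
    case False
    have "j \<noteq> 2 * k + 1" for k using False by presburger
    then show ?thesis using False by simp
  qed
  finally show ?thesis .
qed

text \<open>Multiplication by 2 cos x shifts the frequency of a sine up and down, so the q-Hermite
  recurrence becomes a recursion for sine coefficients; the required integral is the coefficient of
  frequency 1.\<close>

lemma integral_circle_q_hermite:
  assumes q: "\<bar>q\<bar> < 1"
  shows "(\<integral>x. 2 * sin x * theta q x * q_hermite q n (- (2 / sqrt (1 - q)) * cos x) \<partial>circle) = (if n = 0 then 1 else 0)"
proof -
  define \<sigma> where "\<sigma> = sqrt (1 - q)"
  have s: "\<sigma> > 0" "\<sigma>\<^sup>2 = 1 - q" using q by (simp_all add: \<sigma>_def)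
  let ?y = "\<lambda>x. - (2 / \<sigma>) * cos x"
  \<comment> \<open>The continuous q-Hermite polynomial of Rogers at cos x. The sign (-1)^n undoes
    the minus sign in the argument, and powers of \<sigma> turn [n]_q into 1 - q^n.\<close>
  define h where "h n x = (-1) ^ n * (\<sigma> ^ n * q_hermite q n (?y x))" for n x
  have h_rec: "h (Suc n) x = 2 * cos x * h n x - (1 - q ^ n) * h (n - 1) x" for n x
  proof -
    have sy: "\<sigma> * ?y x = - 2 * cos x" using s by simp
    have "q_hermite q (Suc n) (?y x) = ?y x * q_hermite q n (?y x) - q_int q n * q_hermite q (n - 1) (?y x)"
      using q_hermite_rec[of "?y x" q n] by simp
    then have "h (Suc n) x = (-1) ^ Suc n * \<sigma> ^ n * (\<sigma> * ?y x) * q_hermite q n (?y x)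
       - (-1) ^ Suc n * \<sigma> ^ Suc n * q_int q n * q_hermite q (n - 1) (?y x)"
      unfolding h_def by (simp only: right_diff_distrib power_Suc mult_ac)
    also have "(-1) ^ Suc n * \<sigma> ^ n * (\<sigma> * ?y x) * q_hermite q n (?y x) = 2 * cos x * h n x"
      unfolding sy h_def by simp
    also have "(-1) ^ Suc n * \<sigma> ^ Suc n * q_int q n * q_hermite q (n - 1) (?y x) = (1 - q ^ n) * h (n - 1) x"
    proof (cases n)
      case (Suc m)
      have "(-1) ^ Suc n * \<sigma> ^ Suc n * q_int q n * q_hermite q (n - 1) (?y x) = (\<sigma>\<^sup>2 * q_int q n) * h (n - 1) x"
        unfolding h_def Suc by (simp add: power2_eq_square)
      then show ?thesis unfolding s(2) q_int_geometric .
    qed simp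
    finally show ?thesis .
  qed
  have h0: "h 0 x = 1" for x by (simp add: h_def)
  have hm[measurable]: "h n \<in> borel_measurable borel" for n unfolding h_def by measurable
  have hb: "\<exists>C. \<forall>x. \<bar>h n x\<bar> \<le> C" for n
  proof (induction n rule: less_induct)
    case (less n)
    show ?case
    proof (cases n)
      case 0
      then show ?thesis using h0 by auto
    next
      case (Suc m)
      obtain C where C: "\<And>x. \<bar>h m x\<bar> \<le> C" using less Suc by blast
      have "m - 1 < n" using Suc by simp
      from less[OF this] obtain D where D: "\<And>x. \<bar>h (m - 1) x\<bar> \<le> D" by blast
      have "\<bar>h n x\<bar> \<le> 2 * C + \<bar>1 - q ^ m\<bar> * D" for x
      proof -
        have "\<bar>h n x\<bar> \<le> \<bar>2 * cos x * h m x\<bar> + \<bar>(1 - q ^ m) * h (m - 1) x\<bar>" unfolding Suc h_rec by simp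
        also have "\<dots> = 2 * (\<bar>cos x\<bar> * \<bar>h m x\<bar>) + \<bar>1 - q ^ m\<bar> * \<bar>h (m - 1) x\<bar>" by (simp add: abs_mult)
        also have "\<dots> \<le> 2 * (1 * C) + \<bar>1 - q ^ m\<bar> * D"
          using C D by (intro add_mono mult_left_mono mult_mono) auto
        finally show ?thesis by simp
      qed
      then show ?thesis by blast
    qed
  qed
  define W where "W n j = (\<integral>x. h n x * (2 * (sin (real j * x) * theta q x)) \<partial>circle)" for n j
  have i: "integrable circle (\<lambda>x. h n x * (2 * (sin (real j * x) * theta q x)))" for n j
  proof -
    obtain C where C: "\<And>x. \<bar>h n x\<bar> \<le> C" using hb by blast
    show ?thesis
    proof (rule integrable_circle_bounded)
      fix x
      have "\<bar>sin (real j * x)\<bar> * \<bar>theta q x\<bar> \<le> 1 * (1 / (1 - \<bar>q\<bar>))"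
        by (intro mult_mono theta_bounded q) auto
      then have "\<bar>h n x\<bar> * (2 * (\<bar>sin (real j * x)\<bar> * \<bar>theta q x\<bar>)) \<le> C * (2 * (1 / (1 - \<bar>q\<bar>)))"
        using C[of x] by (intro mult_mono) auto
      then show "\<bar>h n x * (2 * (sin (real j * x) * theta q x))\<bar> \<le> C * (2 * (1 / (1 - \<bar>q\<bar>)))"
        by (simp add: abs_mult)
    qed measurable
  qed
  have rec: "W (Suc n) (Suc j) = W n (Suc (Suc j)) + W n j - (1 - q ^ n) * W (n - 1) (Suc j)" for n j
  proof -
    have tr: "2 * cos x * sin (real (Suc j) * x) = sin (real (Suc (Suc j)) * x) + sin (real j * x)" for x
    proof -
      have "sin (real (Suc j) * x + x) + sin (real (Suc j) * x - x) = 2 * cos x * sin (real (Suc j) * x)"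
        unfolding sin_add sin_diff by simp
      then show ?thesis by (simp add: algebra_simps)
    qed
    have "W (Suc n) (Suc j) = (\<integral>x. h n x * (2 * (sin (real (Suc (Suc j)) * x) * theta q x))
       + h n x * (2 * (sin (real j * x) * theta q x)) - (1 - q ^ n) * (h (n - 1) x * (2 * (sin (real (Suc j) * x) * theta q x))) \<partial>circle)"
      unfolding W_def
    proof (intro Bochner_Integration.integral_cong refl)
      fix x
      have "h (Suc n) x * (2 * (sin (real (Suc j) * x) * theta q x)) = h n x * (2 * ((2 * cos x * sin (real (Suc j) * x)) * theta q x))
        - (1 - q ^ n) * (h (n - 1) x * (2 * (sin (real (Suc j) * x) * theta q x)))"
      proof -
        have "(2 * C * H - d * G) * (2 * (S * T)) = H * (2 * ((2 * C * S) * T)) - d * (G * (2 * (S * T)))"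
          for C H d G S T :: real by (simp add: algebra_simps)
        then show ?thesis unfolding h_rec .
      qed
      then show "h (Suc n) x * (2 * (sin (real (Suc j) * x) * theta q x)) = h n x * (2 * (sin (real (Suc (Suc j)) * x) * theta q x))
       + h n x * (2 * (sin (real j * x) * theta q x)) - (1 - q ^ n) * (h (n - 1) x * (2 * (sin (real (Suc j) * x) * theta q x)))"
        unfolding tr by (simp only: distrib_left distrib_right)
    qed
    also have "\<dots> = W n (Suc (Suc j)) + W n j - (1 - q ^ n) * W (n - 1) (Suc j)"
      unfolding W_def using i[of n "Suc (Suc j)"] i[of n j] i[of "n - 1" "Suc j"]
      by (simp only: Bochner_Integration.integral_add Bochner_Integration.integral_diff
          Bochner_Integration.integrable_add integrable_mult_right integral_mult_right_zero)
    finally show ?thesis .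
  qed
  have W1: "W n 1 = (if n = 0 then 1 else 0)"
  proof (cases n)
    case 0
    then show ?thesis using integral_circle_sin_theta[OF q, of 1] by (simp add: W_def h0)
  next
    case (Suc m)
    have "W (Suc m) 1 = 0"
    proof (rule theta_coefficient_vanishes[where q=q])
      show "W n 0 = 0" for n by (simp add: W_def)
      show "W 0 (2 * k + 1) = (-1) ^ k * q ^ (k * (k + 1) div 2)" for k
        using integral_circle_sin_theta[OF q, of "2 * k + 1"] by (simp add: W_def h0)
      show "W 0 (2 * k) = 0" for k
        using integral_circle_sin_theta[OF q, of "2 * k"] by (simp add: W_def h0)
    qed (rule rec)
    then show ?thesis using Suc by simp
  qed
  have "(\<integral>x. 2 * sin x * theta q x * q_hermite q n (?y x) \<partial>circle) = (\<integral>x. ((-1) ^ n / \<sigma> ^ n) * (h n x * (2 * (sin (real 1 * x) * theta q x))) \<partial>circle)"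
  proof (intro Bochner_Integration.integral_cong refl)
    fix x
    have "((-1) ^ n / \<sigma> ^ n) * h n x = q_hermite q n (?y x)"
      using s by (simp add: h_def power_mult_distrib[symmetric])
    then have "((-1) ^ n / \<sigma> ^ n) * (h n x * (2 * (sin (real 1 * x) * theta q x))) = q_hermite q n (?y x) * (2 * (sin (real 1 * x) * theta q x))"
      by (simp only: mult.assoc[symmetric])
    then show "2 * sin x * theta q x * q_hermite q n (?y x) = ((-1) ^ n / \<sigma> ^ n) * (h n x * (2 * (sin (real 1 * x) * theta q x)))"
      by (simp add: mult_ac)
  qed
  also have "\<dots> = ((-1) ^ n / \<sigma> ^ n) * W n 1" unfolding W_def by (rule integral_mult_right_zero)
  also have "\<dots> = (if n = 0 then 1 else 0)" unfolding W1 by simp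
  finally show ?thesis unfolding \<sigma>_def .
qed

text \<open>With \<open>x = 2 cos t / sqrt (1 - q)\<close> this is the sine expansion of the density. That it is
  nonnegative is not read off the series: it follows from the existence of the process. The
  inner indicator only serves measurability.\<close>

definition q_normal_function :: "real \<Rightarrow> real \<Rightarrow> real" where
  "q_normal_function q x = indicator {- 2 / sqrt (1 - q)..2 / sqrt (1 - q)} x * (sqrt (1 - q) / pi *
     theta q (indicator {- 2 / sqrt (1 - q)..2 / sqrt (1 - q)} x *\<^sub>R arccos (x * sqrt (1 - q) / 2)))"

lemma q_normal_function_measurable [measurable]:
  assumes "q < 1" shows "q_normal_function q \<in> borel_measurable borel"
proof -
  let ?I = "{- 2 / sqrt (1 - q)..2 / sqrt (1 - q)}"
  have s: "sqrt (1 - q) > 0" using assms by simp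
  have "continuous_on ?I (\<lambda>x. arccos (x * sqrt (1 - q) / 2))"
  proof (intro continuous_on_arccos continuous_intros ballI conjI)
    fix x assume "x \<in> ?I"
    then have x: "- 2 / sqrt (1 - q) \<le> x" "x \<le> 2 / sqrt (1 - q)" by simp_all
    have "- 2 / sqrt (1 - q) * sqrt (1 - q) \<le> x * sqrt (1 - q)"
      by (rule mult_right_mono[OF x(1)]) (use s in simp)
    moreover have "x * sqrt (1 - q) \<le> 2 / sqrt (1 - q) * sqrt (1 - q)"
      by (rule mult_right_mono[OF x(2)]) (use s in simp)
    ultimately have "- 2 \<le> x * sqrt (1 - q)" "x * sqrt (1 - q) \<le> 2" using s by simp_all
    then show "- 1 \<le> x * sqrt (1 - q) / 2" "x * sqrt (1 - q) / 2 \<le> 1" by simp_all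
  qed simp
  then have [measurable]: "(\<lambda>x. indicator ?I x *\<^sub>R arccos (x * sqrt (1 - q) / 2)) \<in> borel_measurable borel"
    by (intro borel_measurable_continuous_on_indicator) auto
  show ?thesis unfolding q_normal_function_def by measurable
qed

text \<open>The substitution y = -2 cos x / sqrt (1 - q); its derivative supplies the factor sin x,
  and the constants combine to the density 1/pi of \<open>circle\<close>.\<close>

lemma integral_q_normal_function:
  fixes g :: "real \<Rightarrow> real"
  assumes q: "\<bar>q\<bar> < 1" and g[measurable]: "g \<in> borel_measurable borel" and b: "\<And>x. \<bar>g x\<bar> \<le> C"
  shows "integrable lborel (\<lambda>x. q_normal_function q x * g x)"
    and "(\<integral>x. q_normal_function q x * g x \<partial>lborel) =
      (\<integral>x. 2 * sin x * theta q x * g (- (2 / sqrt (1 - q)) * cos x) \<partial>circle)"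
proof -
  define \<sigma> where "\<sigma> = sqrt (1 - q)"
  have s: "\<sigma> > 0" using q by (simp add: \<sigma>_def)
  let ?g = "\<lambda>x. - (2 / \<sigma>) * cos x"
  let ?f = "\<lambda>x. q_normal_function q x * g x"
  have [measurable]: "q_normal_function q \<in> borel_measurable borel" using q by simp
  have fI: "?f x * indicator {?g 0..?g pi} x = ?f x" for x
    by (auto simp: q_normal_function_def \<sigma>_def[symmetric] indicator_def)
  have C: "0 \<le> C" using b[of 0] by linarith
  have bound: "\<bar>?f x\<bar> \<le> (\<sigma> / pi * (1 / (1 - \<bar>q\<bar>))) * C" for x
  proof -
    have "\<bar>q_normal_function q x\<bar> \<le> 1 * (\<sigma> / pi * (1 / (1 - \<bar>q\<bar>)))"
      unfolding q_normal_function_def \<sigma>_def[symmetric] abs_mult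
      using s theta_bounded[OF q] by (intro mult_mono) (auto simp: indicator_def)
    then show ?thesis unfolding abs_mult using b[of x] C s q by (intro mult_mono) auto
  qed
  have si: "set_integrable lborel {?g 0..?g pi} ?f"
    unfolding set_integrable_def
  proof (rule Bochner_Integration.integrable_bound)
    show "integrable lborel (\<lambda>x. indicator {?g 0..?g pi} x *\<^sub>R ((\<sigma> / pi * (1 / (1 - \<bar>q\<bar>))) * C))"
      by (intro integrable_scaleR_left integrable_real_indicator) (auto simp: emeasure_lborel_Icc_eq)
    show "AE x in lborel. norm (indicator {?g 0..?g pi} x *\<^sub>R ?f x) \<le> norm (indicator {?g 0..?g pi} x *\<^sub>R ((\<sigma> / pi * (1 / (1 - \<bar>q\<bar>))) * C))"
    proof (rule AE_I2)
      fix x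
      have "\<bar>?f x\<bar> \<le> \<bar>(\<sigma> / pi * (1 / (1 - \<bar>q\<bar>))) * C\<bar>" using bound[of x] by linarith
      then show "norm (indicator {?g 0..?g pi} x *\<^sub>R ?f x) \<le> norm (indicator {?g 0..?g pi} x *\<^sub>R ((\<sigma> / pi * (1 / (1 - \<bar>q\<bar>))) * C))"
        by (simp add: indicator_def)
    qed
  qed measurable
  moreover have "(\<lambda>x. indicator {?g 0..?g pi} x *\<^sub>R ?f x) = ?f"
  proof
    show "indicator {?g 0..?g pi} x *\<^sub>R ?f x = ?f x" for x
      unfolding real_scaleR_def using fI[of x] by (subst mult.commute)
  qed
  ultimately show "integrable lborel (\<lambda>x. q_normal_function q x * g x)"
    unfolding set_integrable_def by (simp only:)
  have "(\<integral>x. ?f x \<partial>lborel) = (LBINT x. ?f x * indicator {?g 0..?g pi} x)" unfolding fI ..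
  also have "\<dots> = (LBINT x. ?f (?g x) * ((2 / \<sigma>) * sin x) * indicator {0..pi} x)"
  proof (rule integral_substitution(2)[where g="?g" and a=0 and b=pi and f="?f", OF si])
    show "(?g has_real_derivative (2 / \<sigma>) * sin x) (at x)" for x
      using s by (auto intro!: derivative_eq_intros)
    show "0 \<le> 2 / \<sigma> * sin x" if "x \<in> {0..pi}" for x
      using that s by (intro mult_nonneg_nonneg sin_ge_zero) auto
  qed (use s in \<open>auto intro!: continuous_intros\<close>)
  also have "\<dots> = (LBINT x. (2 * sin x * theta q x * g (?g x)) * indicator {0..pi} x / pi)"
  proof (rule Bochner_Integration.integral_cong[OF refl])
    fix x
    show "?f (?g x) * ((2 / \<sigma>) * sin x) * indicator {0..pi} x = (2 * sin x * theta q x * g (?g x)) * indicator {0..pi} x / pi"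
    proof (cases "x \<in> {0..pi}")
      case True
      have e: "?g x = (- 2 * cos x) / \<sigma>" by simp
      have "?g x \<in> {- 2 / \<sigma>..2 / \<sigma>}"
        unfolding e atLeastAtMost_iff
        by (intro conjI divide_right_mono) (use s cos_ge_minus_one[of x] cos_le_one[of x] in linarith)+
      moreover have "?g x * \<sigma> / 2 = - cos x" using s by simp
      moreover have "arccos (- cos x) = pi - x"
        using True arccos_minus[of "cos x"] arccos_cos[of x] by simp
      ultimately have "q_normal_function q (?g x) = \<sigma> / pi * theta q x"
        unfolding q_normal_function_def \<sigma>_def[symmetric] by (simp add: theta_reflect)
      then show ?thesis using s True by simp
    qed simp
  qed
  also have "\<dots> = (\<integral>x. 2 * sin x * theta q x * g (?g x) \<partial>circle)"
    by (subst integral_circle) simp_all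
  finally show "(\<integral>x. q_normal_function q x * g x \<partial>lborel) =
      (\<integral>x. 2 * sin x * theta q x * g (- (2 / sqrt (1 - q)) * cos x) \<partial>circle)"
    unfolding \<sigma>_def .
qed

context q_process
begin

lemma moments_of_hermite:
  fixes N :: "'b measure" and V Y :: "'b \<Rightarrow> real"
  assumes Z: "all_moments M Z" and i: "\<And>n. integrable N (\<lambda>x. Y x * V x ^ n)"
    and eq: "\<And>n. expectation (\<lambda>\<omega>. Z \<omega> * q_hermite q n (X t \<omega>)) = (\<integral>x. Y x * q_hermite q n (V x) \<partial>N)"
  shows "expectation (\<lambda>\<omega>. Z \<omega> * X t \<omega> ^ n) = (\<integral>x. Y x * V x ^ n \<partial>N)"
proof -
  have iq: "integrable N (\<lambda>x. Y x * q_hermite q k (V x))" for k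
  proof -
    have "integrable N (\<lambda>x. \<Sum>j\<le>degree (q_hermite_poly q k). coeff (q_hermite_poly q k) j * (Y x * V x ^ j))"
      using i by auto
    also have "(\<lambda>x. \<Sum>j\<le>degree (q_hermite_poly q k). coeff (q_hermite_poly q k) j * (Y x * V x ^ j)) = (\<lambda>x. Y x * q_hermite q k (V x))"
      by (simp add: poly_q_hermite_poly[symmetric] poly_altdef sum_distrib_left mult_ac del: poly_q_hermite_poly)
    finally show ?thesis .
  qed
  obtain c where c: "monom 1 n = (\<Sum>k\<le>n. Polynomial.smult (c k) (q_hermite_poly q k))"
    using monic_basis_span[OF monic_basis_q_hermite_poly, of "monom 1 n" n q] by (auto simp: degree_monom_eq)
  have e: "x ^ n = (\<Sum>k\<le>n. c k * q_hermite q k x)" for x :: real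
    using arg_cong[OF c, of "\<lambda>p. poly p x"] by (simp add: poly_monom poly_sum)
  have "expectation (\<lambda>\<omega>. Z \<omega> * X t \<omega> ^ n) = expectation (\<lambda>\<omega>. \<Sum>k\<le>n. c k * (Z \<omega> * q_hermite q k (X t \<omega>)))"
    unfolding e by (simp add: sum_distrib_left mult_ac)
  also have "\<dots> = (\<Sum>k\<le>n. c k * expectation (\<lambda>\<omega>. Z \<omega> * q_hermite q k (X t \<omega>)))"
    using all_moments_integrable[OF all_moments_mult[OF Z P_all_moments]] by simp
  also have "\<dots> = (\<integral>x. (\<Sum>k\<le>n. c k * (Y x * q_hermite q k (V x))) \<partial>N)"
    using iq by (simp add: eq)
  also have "\<dots> = (\<integral>x. Y x * V x ^ n \<partial>N)"
    unfolding e by (simp add: sum_distrib_left mult_ac)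
  finally show ?thesis .
qed

text \<open>Both sides have mean 1 on H_0 and 0 on all other q-Hermite polynomials, hence equal
  moments. The determinacy theorem is applied with the weight on the circle whose sign is still
  unknown.\<close>

lemma marginal_q_normal_function:
  assumes q: "\<bar>q\<bar> < 1" and B[measurable]: "B \<in> sets borel"
  shows "measure (marginal M X) B = (\<integral>x. q_normal_function q x * indicator B x \<partial>lborel)"
proof -
  let ?V = "\<lambda>x. - (2 / sqrt (1 - q)) * cos x" and ?Y = "\<lambda>x. 2 * sin x * theta q x"
  have Vb: "\<bar>?V x\<bar> \<le> 2 / sqrt (1 - q)" for x
    using q mult_left_mono[OF abs_cos_le_one[of x], of "2 / sqrt (1 - q)"] by (simp add: abs_mult)
  have Yb: "\<bar>?Y x\<bar> \<le> 2 * 1 * (1 / (1 - \<bar>q\<bar>))" for x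
    unfolding abs_mult using theta_bounded[OF q, of x] by (intro mult_mono) auto
  have bnd: "integrable circle (\<lambda>x. ?Y x * g (?V x))"
    if [measurable]: "g \<in> borel_measurable borel" and "\<And>x. \<bar>x\<bar> \<le> 2 / sqrt (1 - q) \<Longrightarrow> \<bar>g x\<bar> \<le> C" for g :: "real \<Rightarrow> real" and C
  proof (rule integrable_circle_bounded)
    show "\<bar>?Y x * g (?V x)\<bar> \<le> 2 * 1 * (1 / (1 - \<bar>q\<bar>)) * C" for x
      unfolding abs_mult[of "?Y x"] using that(2)[OF Vb[of x]] Yb[of x] q by (intro mult_mono) auto
  qed measurable
  have "expectation (\<lambda>\<omega>. 1 * indicator B (X 0 \<omega>)) = (\<integral>x. ?Y x * indicator B (?V x) \<partial>circle)"
  proof (rule restricted_integral_eq_of_moments[OF prob_space_axioms prob_space_circle])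
    show "integrable M (\<lambda>\<omega>. 1 * exp (c * \<bar>X 0 \<omega>\<bar>))" for c
      using all_moments_integrable[OF all_moments_exp[of c 0]] by simp
    show "integrable circle (\<lambda>x. ?Y x * exp (c * \<bar>?V x\<bar>))" for c
    proof (rule bnd)
      fix x :: real assume "\<bar>x\<bar> \<le> 2 / sqrt (1 - q)"
      then have "c * \<bar>x\<bar> \<le> \<bar>c\<bar> * (2 / sqrt (1 - q))" by (meson abs_ge_self abs_ge_zero mult_mono order_trans mult_right_mono mult_left_mono)
      then show "\<bar>exp (c * \<bar>x\<bar>)\<bar> \<le> exp (\<bar>c\<bar> * (2 / sqrt (1 - q)))" by simp
    qed measurable
    show "expectation (\<lambda>\<omega>. 1 * X 0 \<omega> ^ n) = (\<integral>x. ?Y x * ?V x ^ n \<partial>circle)" for n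
    proof (rule moments_of_hermite)
      show "integrable circle (\<lambda>x. ?Y x * ?V x ^ n)" for n
      proof (rule bnd)
        fix x :: real assume "\<bar>x\<bar> \<le> 2 / sqrt (1 - q)"
        then show "\<bar>x ^ n\<bar> \<le> (2 / sqrt (1 - q)) ^ n" unfolding power_abs by (rule power_mono) simp
      qed measurable
      show "expectation (\<lambda>\<omega>. 1 * q_hermite q n (X 0 \<omega>)) = (\<integral>x. ?Y x * q_hermite q n (?V x) \<partial>circle)" for n
        unfolding integral_circle_q_hermite[OF q]
        using mean_q_hermite_Suc by (cases n) (auto simp: mean_def prob_space)
    qed (rule all_moments_const[OF finite_measure_axioms])
  qed measurable
  also have "\<dots> = (\<integral>x. q_normal_function q x * indicator B x \<partial>lborel)"
    by (rule integral_q_normal_function(2)[symmetric, OF q, where C=1]) (auto simp: indicator_def)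
  finally have "expectation (\<lambda>\<omega>. indicator B (X 0 \<omega>)) = (\<integral>x. q_normal_function q x * indicator B x \<partial>lborel)"
    by simp
  moreover have "measure (marginal M X) B = (\<integral>x. indicat_real B x \<partial>marginal M X)"
    by (simp add: marginal_def)
  moreover have "(\<integral>x. indicat_real B x \<partial>marginal M X) = expectation (\<lambda>\<omega>. indicat_real B (X 0 \<omega>))"
    unfolding marginal_def by (subst integral_distr) simp_all
  ultimately show ?thesis by simp
qed

lemma q_normal_density_exists:
  assumes q: "\<bar>q\<bar> < 1"
  shows "\<exists>f. q_normal_density q f \<and> marginal M X = density lborel (\<lambda>x. ennreal (f x))"
proof -
  \<comment> \<open>The definition of the density asks for nonnegativity at every point; the series
    gives it almost everywhere.\<close>
  define f where "f x = max 0 (q_normal_function q x)" for x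
  have [measurable]: "q_normal_function q \<in> borel_measurable borel" using q by simp
  have [measurable]: "f \<in> borel_measurable borel" unfolding f_def by measurable
  have i: "integrable lborel (\<lambda>x. q_normal_function q x * indicator B x)" if "B \<in> sets borel" for B
    by (rule integral_q_normal_function(1)[OF q, where C=1]) (use that in \<open>auto simp: indicator_def\<close>)
  \<comment> \<open>The set where the function is negative has, as its integral there, a
    probability; so this integral is zero.\<close>
  have "AE x in lborel. 0 \<le> q_normal_function q x"
  proof -
    let ?B = "{x. q_normal_function q x < 0}"
    have B: "?B \<in> sets borel" by measurable
    have "integrable lborel (\<lambda>x. - (q_normal_function q x * indicator ?B x))" using i[OF B] by simp
    moreover have "(\<integral>x. - (q_normal_function q x * indicator ?B x) \<partial>lborel) = 0"
    proof (rule antisym)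
      show "(\<integral>x. - (q_normal_function q x * indicator ?B x) \<partial>lborel) \<le> 0"
        using marginal_q_normal_function[OF q B] measure_nonneg[of "marginal M X" ?B] by simp
      show "0 \<le> (\<integral>x. - (q_normal_function q x * indicator ?B x) \<partial>lborel)"
        by (rule Bochner_Integration.integral_nonneg) (auto simp: indicator_def)
    qed
    ultimately have "AE x in lborel. - (q_normal_function q x * indicator ?B x) = 0"
      by (subst (asm) integral_nonneg_eq_0_iff_AE) (auto simp: indicator_def)
    then show ?thesis by eventually_elim (auto simp: indicator_def split: if_splits)
  qed
  then have ff: "AE x in lborel. q_normal_function q x = f x" by eventually_elim (simp add: f_def)
  interpret D: prob_space "marginal M X" unfolding marginal_def by (rule prob_space_distr) simp
  have marg: "marginal M X = density lborel (\<lambda>x. ennreal (f x))"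
  proof (rule measure_eqI)
    fix B assume "B \<in> sets (marginal M X)"
    then have B[measurable]: "B \<in> sets borel" by (simp add: marginal_def)
    have ae: "AE x in lborel. q_normal_function q x * indicator B x = f x * indicator B x"
      using ff by eventually_elim simp
    have fB: "integrable lborel (\<lambda>x. f x * indicator B x)"
      using i[OF B] ae by (subst (asm) integrable_cong_AE) auto
    have "emeasure (marginal M X) B = ennreal (\<integral>x. q_normal_function q x * indicator B x \<partial>lborel)"
      using marginal_q_normal_function[OF q B] by (simp add: D.emeasure_eq_measure)
    also have "(\<integral>x. q_normal_function q x * indicator B x \<partial>lborel) = (\<integral>x. f x * indicator B x \<partial>lborel)"
      using ae by (intro integral_cong_AE) auto
    also have "ennreal \<dots> = (\<integral>\<^sup>+x. ennreal (f x * indicator B x) \<partial>lborel)"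
      by (rule nn_integral_eq_integral[symmetric, OF fB]) (simp add: f_def)
    also have "\<dots> = emeasure (density lborel (\<lambda>x. ennreal (f x))) B"
      by (subst emeasure_density) (auto intro!: nn_integral_cong simp: indicator_def)
    finally show "emeasure (marginal M X) B = emeasure (density lborel (\<lambda>x. ennreal (f x))) B" .
  qed (simp add: marginal_def)
  have "q_normal_density q f"
    unfolding q_normal_density_def
  proof (intro conjI allI impI)
    show "prob_space (density lborel (\<lambda>x. ennreal (f x)))" using D.prob_space_axioms marg by simp
    show "f x = 0" if "x \<notin> {- 2 / sqrt (1 - q)..2 / sqrt (1 - q)}" for x
      using that by (simp add: f_def q_normal_function_def)
    show "(\<integral>x. f x * (q_hermite q m x * q_hermite q n x) \<partial>lborel) = 0" if "m \<noteq> n" for m n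
    proof -
      have "(\<integral>x. f x * (q_hermite q m x * q_hermite q n x) \<partial>lborel) = (\<integral>x. q_hermite q m x * q_hermite q n x \<partial>marginal M X)"
        unfolding marg by (subst integral_density) (auto simp: f_def)
      also have "\<dots> = mean (q_hermite_poly q m * q_hermite_poly q n)"
        unfolding marginal_def mean_def by (subst integral_distr) simp_all
      also have "\<dots> = 0" using mean_q_hermite_orth[OF mean_q_hermite_Suc] that by simp
      finally show ?thesis .
    qed
  qed (auto simp: f_def)
  then show ?thesis using marg by blast
qed

end

section \<open>The q-Mehler kernel\<close>

lemma (in pair_prob_space) integral_product_functions:
  fixes f :: "'a \<Rightarrow> real" and g :: "'b \<Rightarrow> real"
  assumes f: "integrable M1 f" and g: "integrable M2 g"
  shows "integrable (M1 \<Otimes>\<^sub>M M2) (\<lambda>z. f (fst z) * g (snd z))"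
    and "(\<integral>z. f (fst z) * g (snd z) \<partial>(M1 \<Otimes>\<^sub>M M2)) = integral\<^sup>L M1 f * integral\<^sup>L M2 g"
proof -
  have [measurable]: "f \<in> borel_measurable M1" "g \<in> borel_measurable M2" using f g by auto
  show i: "integrable (M1 \<Otimes>\<^sub>M M2) (\<lambda>z. f (fst z) * g (snd z))"
  proof (rule Fubini_integrable)
    show "integrable M1 (\<lambda>x. \<integral>y. norm (f (fst (x, y)) * g (snd (x, y))) \<partial>M2)"
      using f by (simp add: abs_mult)
    show "AE x in M1. integrable M2 (\<lambda>y. f (fst (x, y)) * g (snd (x, y)))" using g by simp
  qed measurable
  show "(\<integral>z. f (fst z) * g (snd z) \<partial>(M1 \<Otimes>\<^sub>M M2)) = integral\<^sup>L M1 f * integral\<^sup>L M2 g"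
    by (subst integral_fst'[OF i, symmetric]) simp
qed

text \<open>\<open>k\<close> is not assumed nonnegative: the lemma serves to establish the sign of
  the Mehler kernel from its integrals over rectangles.\<close>

lemma measure_eq_integral_generated:
  fixes N :: "(real \<times> real) measure" and k :: "real \<times> real \<Rightarrow> real"
  assumes D: "prob_space D" "sets D = sets (borel \<Otimes>\<^sub>M borel)" and N: "sets N = sets (borel \<Otimes>\<^sub>M borel)"
    and k: "integrable N k"
    and rect: "\<And>A B. A \<in> sets borel \<Longrightarrow> B \<in> sets borel \<Longrightarrow> measure D (A \<times> B) = (\<integral>z. k z * indicator (A \<times> B) z \<partial>N)"
    and E: "E \<in> sets N"
  shows "measure D E = (\<integral>z. k z * indicator E z \<partial>N)"
proof -
  interpret D: prob_space D by fact
  let ?G = "{A \<times> B | A B. A \<in> sets borel \<and> B \<in> sets (borel :: real measure)} :: (real \<times> real) set set"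
  have sD: "space D = UNIV" using sets_eq_imp_space_eq[OF D(2)] by (simp add: space_pair_measure)
  have sN: "space N = UNIV" using sets_eq_imp_space_eq[OF N] by (simp add: space_pair_measure)
  have i: "integrable N (\<lambda>z. k z * indicator F z)" if "F \<in> sets N" for F
    using integrable_mult_indicator[OF that k] by (simp add: mult.commute)
  have st: "Int_stable ?G"
  proof (rule Int_stableI)
    fix a b assume "a \<in> ?G" "b \<in> ?G"
    then obtain A B A' B' where "a = A \<times> B" "b = A' \<times> B'" "A \<in> sets borel" "B \<in> sets borel" "A' \<in> sets borel" "B' \<in> sets borel"
      by blast
    then have "a \<inter> b = (A \<inter> A') \<times> (B \<inter> B')" "A \<inter> A' \<in> sets borel" "B \<inter> B' \<in> sets borel" by auto
    then show "a \<inter> b \<in> ?G" by blast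
  qed
  have sets_eq: "sets N = sigma_sets UNIV ?G"
    unfolding N sets_pair_measure by simp
  have Es: "E \<in> sigma_sets UNIV ?G" using E unfolding sets_eq .
  have GP: "?G \<subseteq> Pow UNIV" by simp
  show ?thesis
    using st GP Es
  proof (induction rule: sigma_sets_induct_disjoint)
    case (basic F)
    then show ?case using rect by blast
  next
    case (compl F)
    then have F: "F \<in> sets N" "F \<in> sets D" using sets_eq N D(2) by auto
    have "measure D (UNIV - F) = 1 - measure D F" using D.prob_compl[OF F(2)] by (simp add: sD)
    also have "1 = (\<integral>z. k z \<partial>N)" using rect[of UNIV UNIV] D.prob_space by (simp add: sD)
    also have "(\<integral>z. k z \<partial>N) - measure D F = (\<integral>z. k z - k z * indicator F z \<partial>N)"
      using k i[OF F(1)] compl by simp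
    also have "\<dots> = (\<integral>z. k z * indicator (UNIV - F) z \<partial>N)"
      by (rule Bochner_Integration.integral_cong) (auto simp: indicator_def)
    finally show ?case .
  next
    case (union F)
    have F: "F n \<in> sets N" "F n \<in> sets D" for n using union(2) sets_eq N D(2) by auto
    have "(\<lambda>n. measure D (F n)) sums measure D (\<Union>n. F n)"
      using F(2) union(1) by (intro D.finite_measure_UNION) auto
    moreover have "(\<integral>z\<in>(\<Union>n. F n). k z \<partial>N) = (\<Sum>n. (\<integral>z\<in>F n. k z \<partial>N))"
    proof (rule lebesgue_integral_countable_add)
      show "F n \<in> sets N" for n by (rule F)
      show "F m \<inter> F n = {}" if "m \<noteq> n" for m n using union(1) that by (auto simp: disjoint_family_on_def)
      show "set_integrable N (\<Union>n. F n) k"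
        unfolding set_integrable_def using i[of "\<Union>n. F n"] F by (simp add: mult.commute)
    qed
    ultimately show ?case
      using union(3) by (simp add: set_lebesgue_integral_def mult.commute sums_iff)
  qed simp
qed

context q_process
begin

abbreviation "\<mu> \<equiv> marginal M X"

lemma prob_space_marginal: "prob_space \<mu>"
  unfolding marginal_def by (rule prob_space_distr) simp

lemma sets_marginal [measurable_cong, simp]: "sets \<mu> = sets borel"
  by (simp add: marginal_def)

lemma integral_marginal:
  fixes g :: "real \<Rightarrow> real"
  assumes "g \<in> borel_measurable borel"
  shows "(\<integral>x. g x \<partial>\<mu>) = expectation (\<lambda>\<omega>. g (X t \<omega>))"
  unfolding marginal_def using assms expectation_stationary[OF assms, of t] by (subst integral_distr) simp_all

lemma integrable_marginal:
  fixes g :: "real \<Rightarrow> real"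
  assumes "g \<in> borel_measurable borel"
  shows "integrable \<mu> g \<longleftrightarrow> integrable M (\<lambda>\<omega>. g (X t \<omega>))"
  unfolding marginal_def using assms integrable_stationary[OF assms, of t] by (subst integrable_distr_eq) simp_all

text \<open>\<open>fst\<close> is the starting point and \<open>snd\<close> the end point, in the
  order of the pair (X_s, X_t).\<close>

definition mehler_term :: "real \<Rightarrow> nat \<Rightarrow> real \<times> real \<Rightarrow> real" where
  "mehler_term \<rho> n z = \<rho> ^ n * q_hermite q n (snd z) * q_hermite q n (fst z) / q_fact q n"

text \<open>Convergence is shown almost everywhere for the product of the marginals; at other points
  the value of the sum is left open.\<close>

definition mehler :: "real \<Rightarrow> real \<times> real \<Rightarrow> real" where
  "mehler \<rho> z = (\<Sum>n. mehler_term \<rho> n z)"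

lemma mehler_measurable [measurable]:
  "mehler_term \<rho> n \<in> borel_measurable (borel \<Otimes>\<^sub>M borel)" "mehler \<rho> \<in> borel_measurable (borel \<Otimes>\<^sub>M borel)"
proof -
  show [measurable]: "mehler_term \<rho> n \<in> borel_measurable (borel \<Otimes>\<^sub>M borel)" for n
    unfolding mehler_term_def by measurable
  show "mehler \<rho> \<in> borel_measurable (borel \<Otimes>\<^sub>M borel)"
    unfolding mehler_def by measurable
qed

text \<open>By \<open>2 a b \<le> a\<^sup>2 + b\<^sup>2\<close>; this replaces pointwise bounds on the q-Hermite polynomials.\<close>

lemma hermite_product_bound:
  assumes q: "-1 < q" and g[measurable]: "g \<in> borel_measurable borel" and g2: "integrable \<mu> (\<lambda>x. (g x)\<^sup>2)"
  shows "integrable \<mu> (\<lambda>x. q_hermite q n x * g x)"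
    and "(\<integral>x. \<bar>q_hermite q n x * g x\<bar> \<partial>\<mu>) \<le> sqrt (q_fact q n) * (1 + (\<integral>x. (g x)\<^sup>2 \<partial>\<mu>)) / 2"
proof -
  define d where "d = sqrt (q_fact q n)"
  have d: "d > 0" "d\<^sup>2 = q_fact q n" using q_fact_pos[OF q, of n] by (simp_all add: d_def)
  have H2: "integrable \<mu> (\<lambda>x. (q_hermite q n x)\<^sup>2)"
    by (subst integrable_marginal[where t=0], simp, intro all_moments_integrable am_intros P_all_moments)
  have "(\<integral>x. (q_hermite q n x)\<^sup>2 \<partial>\<mu>) = mean (q_hermite_poly q n * q_hermite_poly q n)"
    by (subst integral_marginal[where t=0]) (simp_all add: mean_def power2_eq_square)
  then have HE: "(\<integral>x. (q_hermite q n x)\<^sup>2 \<partial>\<mu>) = d\<^sup>2"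
    using mean_q_hermite_orth[OF mean_q_hermite_Suc, of n n] d by simp
  have i: "integrable \<mu> (\<lambda>x. d / 2 * ((q_hermite q n x)\<^sup>2 / d\<^sup>2 + (g x)\<^sup>2))"
    using H2 g2 by simp
  have b: "\<bar>q_hermite q n x * g x\<bar> \<le> d / 2 * ((q_hermite q n x)\<^sup>2 / d\<^sup>2 + (g x)\<^sup>2)" for x
  proof -
    have "0 \<le> (\<bar>q_hermite q n x\<bar> / d - \<bar>g x\<bar>)\<^sup>2" by simp
    then have "2 * (\<bar>q_hermite q n x\<bar> / d * \<bar>g x\<bar>) \<le> (q_hermite q n x)\<^sup>2 / d\<^sup>2 + (g x)\<^sup>2"
      unfolding power2_diff by (simp add: power_divide)
    then have "d / 2 * (2 * (\<bar>q_hermite q n x\<bar> / d * \<bar>g x\<bar>)) \<le> d / 2 * ((q_hermite q n x)\<^sup>2 / d\<^sup>2 + (g x)\<^sup>2)"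
      using d by (intro mult_left_mono) auto
    moreover have "d / 2 * (2 * (\<bar>q_hermite q n x\<bar> / d * \<bar>g x\<bar>)) = \<bar>q_hermite q n x * g x\<bar>"
      using d by (simp add: abs_mult)
    ultimately show ?thesis by simp
  qed
  show ii: "integrable \<mu> (\<lambda>x. q_hermite q n x * g x)"
  proof (rule Bochner_Integration.integrable_bound[OF i])
    show "AE x in \<mu>. norm (q_hermite q n x * g x) \<le> norm (d / 2 * ((q_hermite q n x)\<^sup>2 / d\<^sup>2 + (g x)\<^sup>2))"
    proof (rule AE_I2)
      fix x show "norm (q_hermite q n x * g x) \<le> norm (d / 2 * ((q_hermite q n x)\<^sup>2 / d\<^sup>2 + (g x)\<^sup>2))"
        using b[of x] unfolding real_norm_def by (rule order_trans[OF _ abs_ge_self])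
    qed
  qed measurable
  have "(\<integral>x. \<bar>q_hermite q n x * g x\<bar> \<partial>\<mu>) \<le> (\<integral>x. d / 2 * ((q_hermite q n x)\<^sup>2 / d\<^sup>2 + (g x)\<^sup>2) \<partial>\<mu>)"
    using ii i b by (intro integral_mono) auto
  also have "\<dots> = d / 2 * (d\<^sup>2 / d\<^sup>2 + (\<integral>x. (g x)\<^sup>2 \<partial>\<mu>))"
    using H2 g2 by (simp add: HE)
  also have "\<dots> = sqrt (q_fact q n) * (1 + (\<integral>x. (g x)\<^sup>2 \<partial>\<mu>)) / 2" using d by (simp add: d_def)
  finally show "(\<integral>x. \<bar>q_hermite q n x * g x\<bar> \<partial>\<mu>) \<le> sqrt (q_fact q n) * (1 + (\<integral>x. (g x)\<^sup>2 \<partial>\<mu>)) / 2" .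
qed

context
  fixes \<rho> :: real
  assumes q: "-1 < q" and \<rho>: "0 \<le> \<rho>" "\<rho> < 1"
begin

interpretation \<mu>: prob_space \<mu> by (rule prob_space_marginal)
interpretation PP: pair_prob_space \<mu> \<mu> ..

text \<open>Each of the two factors contributes at most a multiple of sqrt ([n]_q!), which cancels
  the denominator and leaves the geometric factor \<rho>^n.\<close>

lemma mehler_term_integral:
  assumes g1[measurable]: "g1 \<in> borel_measurable borel" "integrable \<mu> (\<lambda>x. (g1 x)\<^sup>2)"
    and g2[measurable]: "g2 \<in> borel_measurable borel" "integrable \<mu> (\<lambda>x. (g2 x)\<^sup>2)"
  shows "integrable (\<mu> \<Otimes>\<^sub>M \<mu>) (\<lambda>z. mehler_term \<rho> n z * (g1 (fst z) * g2 (snd z)))"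
    and "(\<integral>z. mehler_term \<rho> n z * (g1 (fst z) * g2 (snd z)) \<partial>(\<mu> \<Otimes>\<^sub>M \<mu>)) =
      \<rho> ^ n / q_fact q n * ((\<integral>x. q_hermite q n x * g1 x \<partial>\<mu>) * (\<integral>x. q_hermite q n x * g2 x \<partial>\<mu>))"
    and "(\<integral>z. \<bar>mehler_term \<rho> n z * (g1 (fst z) * g2 (snd z))\<bar> \<partial>(\<mu> \<Otimes>\<^sub>M \<mu>)) \<le>
      \<rho> ^ n * ((1 + (\<integral>x. (g1 x)\<^sup>2 \<partial>\<mu>)) * (1 + (\<integral>x. (g2 x)\<^sup>2 \<partial>\<mu>)))"
proof -
  note b1 = hermite_product_bound[OF q g1, of n] and b2 = hermite_product_bound[OF q g2, of n]
  have f: "q_fact q n > 0" by (rule q_fact_pos[OF q])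
  have e: "mehler_term \<rho> n z * (g1 (fst z) * g2 (snd z)) = \<rho> ^ n / q_fact q n * ((q_hermite q n (fst z) * g1 (fst z)) * (q_hermite q n (snd z) * g2 (snd z)))" for z
    by (simp add: mehler_term_def)
  note p = PP.integral_product_functions[OF b1(1) b2(1)]
  note pa = PP.integral_product_functions[OF integrable_abs[OF b1(1)] integrable_abs[OF b2(1)]]
  show "integrable (\<mu> \<Otimes>\<^sub>M \<mu>) (\<lambda>z. mehler_term \<rho> n z * (g1 (fst z) * g2 (snd z)))"
    unfolding e using p(1) by (intro integrable_mult_right)
  show "(\<integral>z. mehler_term \<rho> n z * (g1 (fst z) * g2 (snd z)) \<partial>(\<mu> \<Otimes>\<^sub>M \<mu>)) =
      \<rho> ^ n / q_fact q n * ((\<integral>x. q_hermite q n x * g1 x \<partial>\<mu>) * (\<integral>x. q_hermite q n x * g2 x \<partial>\<mu>))"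
    unfolding e integral_mult_right_zero p(2) ..
  have "(\<integral>z. \<bar>mehler_term \<rho> n z * (g1 (fst z) * g2 (snd z))\<bar> \<partial>(\<mu> \<Otimes>\<^sub>M \<mu>)) =
    (\<integral>z. \<rho> ^ n / q_fact q n * (\<bar>q_hermite q n (fst z) * g1 (fst z)\<bar> * \<bar>q_hermite q n (snd z) * g2 (snd z)\<bar>) \<partial>(\<mu> \<Otimes>\<^sub>M \<mu>))"
    unfolding e using f \<rho> by (intro Bochner_Integration.integral_cong) (simp_all add: abs_mult)
  also have "\<dots> = \<rho> ^ n / q_fact q n * ((\<integral>x. \<bar>q_hermite q n x * g1 x\<bar> \<partial>\<mu>) * (\<integral>x. \<bar>q_hermite q n x * g2 x\<bar> \<partial>\<mu>))"
    unfolding integral_mult_right_zero pa(2) ..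
  also have "\<dots> \<le> \<rho> ^ n / q_fact q n * ((sqrt (q_fact q n) * (1 + (\<integral>x. (g1 x)\<^sup>2 \<partial>\<mu>)) / 2) * (sqrt (q_fact q n) * (1 + (\<integral>x. (g2 x)\<^sup>2 \<partial>\<mu>)) / 2))"
    using f \<rho> by (intro mult_left_mono mult_mono b1(2) b2(2)) auto
  also have "\<dots> = \<rho> ^ n / q_fact q n * (sqrt (q_fact q n))\<^sup>2 * ((1 + (\<integral>x. (g1 x)\<^sup>2 \<partial>\<mu>)) * (1 + (\<integral>x. (g2 x)\<^sup>2 \<partial>\<mu>))) / 4"
    by (simp add: power2_eq_square)
  also have "\<dots> = \<rho> ^ n * ((1 + (\<integral>x. (g1 x)\<^sup>2 \<partial>\<mu>)) * (1 + (\<integral>x. (g2 x)\<^sup>2 \<partial>\<mu>))) / 4" using f by simp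
  also have "\<dots> \<le> \<rho> ^ n * ((1 + (\<integral>x. (g1 x)\<^sup>2 \<partial>\<mu>)) * (1 + (\<integral>x. (g2 x)\<^sup>2 \<partial>\<mu>)))"
    using \<rho> by (simp add: mult_nonneg_nonneg add_nonneg_nonneg)
  finally show "(\<integral>z. \<bar>mehler_term \<rho> n z * (g1 (fst z) * g2 (snd z))\<bar> \<partial>(\<mu> \<Otimes>\<^sub>M \<mu>)) \<le>
      \<rho> ^ n * ((1 + (\<integral>x. (g1 x)\<^sup>2 \<partial>\<mu>)) * (1 + (\<integral>x. (g2 x)\<^sup>2 \<partial>\<mu>)))" .
qed

lemma mehler_AE_summable: "AE z in \<mu> \<Otimes>\<^sub>M \<mu>. summable (\<lambda>n. \<bar>mehler_term \<rho> n z\<bar>)"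
proof -
  \<comment> \<open>For the weights 1 the bound has the constant (1 + 1)(1 + 1) = 4.\<close>
  have m: "(\<integral>\<^sup>+z. ennreal \<bar>mehler_term \<rho> n z\<bar> \<partial>(\<mu> \<Otimes>\<^sub>M \<mu>)) \<le> ennreal (4 * \<rho> ^ n)" for n
  proof -
    have i: "integrable (\<mu> \<Otimes>\<^sub>M \<mu>) (\<lambda>z. mehler_term \<rho> n z)"
      using mehler_term_integral(1)[of "\<lambda>_. 1" "\<lambda>_. 1" n] by simp
    have "(\<integral>z. \<bar>mehler_term \<rho> n z\<bar> \<partial>(\<mu> \<Otimes>\<^sub>M \<mu>)) \<le> 4 * \<rho> ^ n"
      using mehler_term_integral(3)[of "\<lambda>_. 1" "\<lambda>_. 1" n] by (simp add: \<mu>.prob_space)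
    then show ?thesis
      using i by (subst nn_integral_eq_integral) (auto intro: ennreal_leI)
  qed
  have "(\<integral>\<^sup>+z. (\<Sum>n. ennreal \<bar>mehler_term \<rho> n z\<bar>) \<partial>(\<mu> \<Otimes>\<^sub>M \<mu>)) = (\<Sum>n. \<integral>\<^sup>+z. ennreal \<bar>mehler_term \<rho> n z\<bar> \<partial>(\<mu> \<Otimes>\<^sub>M \<mu>))"
    by (rule nn_integral_suminf) measurable
  also have "\<dots> \<le> (\<Sum>n. ennreal (4 * \<rho> ^ n))" by (intro suminf_le m) auto
  also have "\<dots> = ennreal (\<Sum>n. 4 * \<rho> ^ n)"
    using \<rho> by (intro suminf_ennreal2) (auto intro!: summable_mult summable_geometric)
  also have "\<dots> < \<infinity>" by simp
  finally have "AE z in \<mu> \<Otimes>\<^sub>M \<mu>. (\<Sum>n. ennreal \<bar>mehler_term \<rho> n z\<bar>) \<noteq> \<infinity>"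
    by (intro nn_integral_PInf_AE) auto
  then show ?thesis by eventually_elim (auto intro: summable_suminf_not_top)
qed

lemma mehler_integral:
  assumes g1[measurable]: "g1 \<in> borel_measurable borel" "integrable \<mu> (\<lambda>x. (g1 x)\<^sup>2)"
    and g2[measurable]: "g2 \<in> borel_measurable borel" "integrable \<mu> (\<lambda>x. (g2 x)\<^sup>2)"
  shows "integrable (\<mu> \<Otimes>\<^sub>M \<mu>) (\<lambda>z. mehler \<rho> z * (g1 (fst z) * g2 (snd z)))"
    and "(\<integral>z. mehler \<rho> z * (g1 (fst z) * g2 (snd z)) \<partial>(\<mu> \<Otimes>\<^sub>M \<mu>)) =
      (\<Sum>n. \<rho> ^ n / q_fact q n * ((\<integral>x. q_hermite q n x * g1 x \<partial>\<mu>) * (\<integral>x. q_hermite q n x * g2 x \<partial>\<mu>)))"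
proof -
  let ?f = "\<lambda>n z. mehler_term \<rho> n z * (g1 (fst z) * g2 (snd z))"
  note t = mehler_term_integral[OF g1 g2]
  have s: "AE z in \<mu> \<Otimes>\<^sub>M \<mu>. summable (\<lambda>n. norm (?f n z))"
    using mehler_AE_summable by eventually_elim (simp add: abs_mult summable_mult2)
  have sn: "summable (\<lambda>n. \<integral>z. norm (?f n z) \<partial>(\<mu> \<Otimes>\<^sub>M \<mu>))"
  proof (rule summable_comparison_test'[where N=0])
    let ?c = "(1 + (\<integral>x. (g1 x)\<^sup>2 \<partial>\<mu>)) * (1 + (\<integral>x. (g2 x)\<^sup>2 \<partial>\<mu>))"
    show "summable (\<lambda>n. \<rho> ^ n * ?c)" using \<rho> by (intro summable_mult2 summable_geometric) simp
    show "norm (\<integral>z. norm (?f n z) \<partial>(\<mu> \<Otimes>\<^sub>M \<mu>)) \<le> \<rho> ^ n * ?c" for n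
      using t(3)[of n] by (simp add: Bochner_Integration.integral_nonneg)
  qed
  have ae: "AE z in \<mu> \<Otimes>\<^sub>M \<mu>. (\<Sum>n. ?f n z) = mehler \<rho> z * (g1 (fst z) * g2 (snd z))"
    using mehler_AE_summable
  proof eventually_elim
    case (elim z)
    show ?case unfolding mehler_def by (rule suminf_mult2[OF summable_rabs_cancel[OF elim], symmetric])
  qed
  have i: "integrable (\<mu> \<Otimes>\<^sub>M \<mu>) (\<lambda>z. \<Sum>n. ?f n z)" by (rule integrable_suminf[OF t(1) s sn])
  then show "integrable (\<mu> \<Otimes>\<^sub>M \<mu>) (\<lambda>z. mehler \<rho> z * (g1 (fst z) * g2 (snd z)))"
    by (rule integrable_cong_AE_imp[OF _ _ ae]) measurable
  have "(\<integral>z. mehler \<rho> z * (g1 (fst z) * g2 (snd z)) \<partial>(\<mu> \<Otimes>\<^sub>M \<mu>)) = (\<integral>z. (\<Sum>n. ?f n z) \<partial>(\<mu> \<Otimes>\<^sub>M \<mu>))"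
  proof (rule integral_cong_AE)
    show "AE z in \<mu> \<Otimes>\<^sub>M \<mu>. mehler \<rho> z * (g1 (fst z) * g2 (snd z)) = (\<Sum>n. ?f n z)"
      using ae by eventually_elim simp
  qed measurable
  also have "\<dots> = (\<Sum>n. \<integral>z. ?f n z \<partial>(\<mu> \<Otimes>\<^sub>M \<mu>))" by (rule integral_suminf[OF t(1) s sn])
  also have "\<dots> = (\<Sum>n. \<rho> ^ n / q_fact q n * ((\<integral>x. q_hermite q n x * g1 x \<partial>\<mu>) * (\<integral>x. q_hermite q n x * g2 x \<partial>\<mu>)))"
    unfolding t(2) ..
  finally show "(\<integral>z. mehler \<rho> z * (g1 (fst z) * g2 (snd z)) \<partial>(\<mu> \<Otimes>\<^sub>M \<mu>)) =
      (\<Sum>n. \<rho> ^ n / q_fact q n * ((\<integral>x. q_hermite q n x * g1 x \<partial>\<mu>) * (\<integral>x. q_hermite q n x * g2 x \<partial>\<mu>)))" .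
qed

text \<open>The kernel acts on H_n as multiplication by \<rho>^n, exactly as the transition of the
  process does.\<close>

lemma mehler_hermite:
  assumes g[measurable]: "g \<in> borel_measurable borel" "integrable \<mu> (\<lambda>x. (g x)\<^sup>2)"
  shows "(\<integral>z. mehler \<rho> z * (g (fst z) * q_hermite q n (snd z)) \<partial>(\<mu> \<Otimes>\<^sub>M \<mu>)) = \<rho> ^ n * (\<integral>x. q_hermite q n x * g x \<partial>\<mu>)"
proof -
  have H2: "integrable \<mu> (\<lambda>x. (q_hermite q n x)\<^sup>2)"
    by (subst integrable_marginal[where t=0], simp, intro all_moments_integrable am_intros P_all_moments)
  have o: "(\<integral>x. q_hermite q m x * q_hermite q n x \<partial>\<mu>) = (if m = n then q_fact q n else 0)" for m
    using mean_q_hermite_orth[OF mean_q_hermite_Suc, of m n]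
    by (subst integral_marginal[where t=0]) (simp_all add: mean_def)
  have "(\<integral>z. mehler \<rho> z * (g (fst z) * q_hermite q n (snd z)) \<partial>(\<mu> \<Otimes>\<^sub>M \<mu>)) =
    (\<Sum>m. if m = n then \<rho> ^ m * (\<integral>x. q_hermite q m x * g x \<partial>\<mu>) else 0)"
    unfolding mehler_integral(2)[OF g q_hermite_measurable H2] o
    using q_fact_pos[OF q] by (intro arg_cong[of _ _ suminf]) (auto simp: fun_eq_iff less_imp_neq[symmetric])
  also have "\<dots> = \<rho> ^ n * (\<integral>x. q_hermite q n x * g x \<partial>\<mu>)"
    using sums_single[of n "\<lambda>m. \<rho> ^ m * (\<integral>x. q_hermite q m x * g x \<partial>\<mu>)"] by (simp add: sums_iff)
  finally show ?thesis .
qed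

end

end

context q_process
begin

context
  fixes s t :: real
  assumes q: "\<bar>q\<bar> < 1" and st: "s < t"
begin

interpretation \<mu>: prob_space \<mu> by (rule prob_space_marginal)
interpretation PP: pair_prob_space \<mu> \<mu> ..

abbreviation (input) "r \<equiv> exp (- \<alpha> * (t - s))"

lemma mehler_range: "-1 < q" "0 \<le> r" "r < 1"
  using q st alpha_pos by auto

lemma indicator_square_integrable: "A \<in> sets borel \<Longrightarrow> integrable \<mu> (\<lambda>x. (indicat_real A x)\<^sup>2)"
  by (rule \<mu>.integrable_const_bound[where B=1]) (auto simp: indicator_def)

lemma mehler_integrable: "integrable (\<mu> \<Otimes>\<^sub>M \<mu>) (mehler r)"
  using mehler_integral(1)[OF mehler_range, of "\<lambda>_. 1" "\<lambda>_. 1"] by simp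

text \<open>With the event X_s in A as weight, both sides pair with H_n in the second variable to
  \<rho>^n E(1_A(X_s) H_n(X_s)); exponential moments turn this into equality of laws.\<close>

lemma joint_law_rectangle:
  assumes [measurable]: "A \<in> sets borel" "B \<in> sets borel"
  shows "expectation (\<lambda>\<omega>. indicator A (X s \<omega>) * indicator B (X t \<omega>)) =
    (\<integral>z. mehler r z * (indicator A (fst z) * indicator B (snd z)) \<partial>(\<mu> \<Otimes>\<^sub>M \<mu>))"
proof -
  have iA: "indicat_real A \<in> borel_measurable borel" by simp
  have aA: "all_moments M (\<lambda>\<omega>. indicat_real A (X s \<omega>))"
    by (rule all_moments_bounded[where B=1, OF finite_measure_axioms]) (auto simp: indicator_def)
  have pA: "(\<lambda>\<omega>. indicat_real A (X s \<omega>)) \<in> borel_measurable (past s)"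
    by (rule measurable_compose[OF X_past iA]) simp
  have sq: "integrable \<mu> (\<lambda>x. (g x)\<^sup>2)"
    if [measurable]: "g \<in> borel_measurable borel" and "all_moments M (\<lambda>\<omega>. g (X 0 \<omega>))" for g
    by (subst integrable_marginal[where t=0], simp, intro all_moments_integrable am_intros that)
  have i: "integrable (\<mu> \<Otimes>\<^sub>M \<mu>) (\<lambda>z. mehler r z * indicator A (fst z) * g (snd z))"
    if [measurable]: "g \<in> borel_measurable borel" and "all_moments M (\<lambda>\<omega>. g (X 0 \<omega>))" for g
    using mehler_integral(1)[OF mehler_range iA indicator_square_integrable[OF assms(1)] that(1) sq[OF that]]
    by (simp add: mult.assoc)
  have "expectation (\<lambda>\<omega>. indicator A (X s \<omega>) * indicator B (X t \<omega>)) =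
    (\<integral>z. (mehler r z * indicator A (fst z)) * indicator B (snd z) \<partial>(\<mu> \<Otimes>\<^sub>M \<mu>))"
  proof (rule restricted_integral_eq_of_moments[OF prob_space_axioms PP.prob_space_axioms])
    show "integrable M (\<lambda>\<omega>. indicat_real A (X s \<omega>) * exp (c * \<bar>X t \<omega>\<bar>))" for c
      by (intro all_moments_integrable all_moments_mult aA all_moments_exp)
    show "integrable (\<mu> \<Otimes>\<^sub>M \<mu>) (\<lambda>z. mehler r z * indicator A (fst z) * exp (c * \<bar>snd z\<bar>))" for c
      by (rule i) (auto intro: all_moments_exp)
    show "expectation (\<lambda>\<omega>. indicat_real A (X s \<omega>) * X t \<omega> ^ n) =
       (\<integral>z. mehler r z * indicator A (fst z) * snd z ^ n \<partial>(\<mu> \<Otimes>\<^sub>M \<mu>))" for n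
    proof (rule moments_of_hermite[OF aA])
      show "integrable (\<mu> \<Otimes>\<^sub>M \<mu>) (\<lambda>z. mehler r z * indicator A (fst z) * snd z ^ n)" for n
        by (rule i) (auto intro: am_intros)
      show "expectation (\<lambda>\<omega>. indicat_real A (X s \<omega>) * q_hermite q n (X t \<omega>)) =
        (\<integral>z. mehler r z * indicator A (fst z) * q_hermite q n (snd z) \<partial>(\<mu> \<Otimes>\<^sub>M \<mu>))" for n
      proof -
        have "expectation (\<lambda>\<omega>. indicat_real A (X s \<omega>) * q_hermite q n (X t \<omega>)) =
            r ^ n * expectation (\<lambda>\<omega>. indicat_real A (X s \<omega>) * q_hermite q n (X s \<omega>))"
          using st by (intro linear_step pA aA) simp
        also have "expectation (\<lambda>\<omega>. indicat_real A (X s \<omega>) * q_hermite q n (X s \<omega>)) = (\<integral>x. q_hermite q n x * indicat_real A x \<partial>\<mu>)"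
          by (subst integral_marginal[where t=s]) (simp_all add: mult.commute)
        also have "r ^ n * \<dots> = (\<integral>z. mehler r z * (indicator A (fst z) * q_hermite q n (snd z)) \<partial>(\<mu> \<Otimes>\<^sub>M \<mu>))"
          by (rule mehler_hermite[OF mehler_range iA indicator_square_integrable[OF assms(1)], symmetric])
        finally show ?thesis by (simp only: mult.assoc)
      qed
    qed
  qed measurable
  then show ?thesis by (simp only: mult.assoc)
qed

text \<open>The kernel represents the law of (X_s, X_t), so its integral over the set where it is
  negative is a probability.\<close>

lemma mehler_nonneg: "AE z in \<mu> \<Otimes>\<^sub>M \<mu>. 0 \<le> mehler r z"
proof -
  let ?D = "distr M (borel \<Otimes>\<^sub>M borel) (\<lambda>\<omega>. (X s \<omega>, X t \<omega>))"
  have sP: "sets (\<mu> \<Otimes>\<^sub>M \<mu>) = sets (borel \<Otimes>\<^sub>M borel)" by (rule sets_pair_measure_cong) simp_all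
  let ?E = "{z. mehler r z < 0}"
  have E: "?E \<in> sets (\<mu> \<Otimes>\<^sub>M \<mu>)"
  proof -
    have "{z \<in> space (borel \<Otimes>\<^sub>M borel). mehler r z < 0} \<in> sets (borel \<Otimes>\<^sub>M borel)" by measurable
    then show ?thesis unfolding sP by (simp add: space_pair_measure)
  qed
  have "measure ?D ?E = (\<integral>z. mehler r z * indicator ?E z \<partial>(\<mu> \<Otimes>\<^sub>M \<mu>))"
  proof (rule measure_eq_integral_generated[OF _ _ sP mehler_integrable _ E])
    show "prob_space ?D" by (rule prob_space_distr) measurable
    fix A B :: "real set" assume [measurable]: "A \<in> sets borel" "B \<in> sets borel"
    have "measure ?D (A \<times> B) = (\<integral>z. indicat_real (A \<times> B) z \<partial>?D)" by simp
    also have "\<dots> = expectation (\<lambda>\<omega>. indicat_real (A \<times> B) (X s \<omega>, X t \<omega>))"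
      by (rule integral_distr) measurable
    also have "\<dots> = expectation (\<lambda>\<omega>. indicat_real A (X s \<omega>) * indicat_real B (X t \<omega>))"
      by (simp add: indicator_times)
    also have "\<dots> = (\<integral>z. mehler r z * (indicator A (fst z) * indicator B (snd z)) \<partial>(\<mu> \<Otimes>\<^sub>M \<mu>))"
      by (rule joint_law_rectangle) simp_all
    finally show "measure ?D (A \<times> B) = (\<integral>z. mehler r z * indicator (A \<times> B) z \<partial>(\<mu> \<Otimes>\<^sub>M \<mu>))"
      by (simp add: indicator_times)
  qed simp
  then have le: "0 \<le> (\<integral>z. mehler r z * indicator ?E z \<partial>(\<mu> \<Otimes>\<^sub>M \<mu>))" by (metis measure_nonneg)
  have i: "integrable (\<mu> \<Otimes>\<^sub>M \<mu>) (\<lambda>z. - (mehler r z * indicator ?E z))"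
    using integrable_mult_indicator[OF E mehler_integrable] by (simp add: mult.commute)
  have nn: "0 \<le> - (mehler r z * indicator ?E z)" for z by (auto simp: indicator_def)
  have "(\<integral>z. - (mehler r z * indicator ?E z) \<partial>(\<mu> \<Otimes>\<^sub>M \<mu>)) = 0"
  proof (rule antisym)
    show "0 \<le> (\<integral>z. - (mehler r z * indicator ?E z) \<partial>(\<mu> \<Otimes>\<^sub>M \<mu>))"
      by (rule Bochner_Integration.integral_nonneg) (rule nn)
  qed (use le in simp)
  then have "AE z in \<mu> \<Otimes>\<^sub>M \<mu>. - (mehler r z * indicator ?E z) = 0"
    using integral_nonneg_eq_0_iff_AE[OF i] nn by simp
  then show ?thesis by eventually_elim (auto simp: indicator_def split: if_splits)
qed

text \<open>\<open>ennreal\<close> cuts negative values to 0, so nonnegativity is what identifies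
  the transition density with the kernel; disintegrating the joint law then gives the conditional
  law.\<close>

lemma cond_law_mehler:
  assumes f: "q_normal_density q f" and marg: "\<mu> = density lborel (\<lambda>x. ennreal (f x))"
  shows "cond_law M X s t (\<lambda>y. density lborel (\<lambda>x. ennreal (q_cond_density q f r y x)))"
  unfolding cond_law_def
proof
  fix B :: "real set" assume B[measurable]: "B \<in> sets borel"
  have [measurable]: "f \<in> borel_measurable borel" and f0: "\<And>x. 0 \<le> f x"
    using f by (simp_all add: q_normal_density_def)
  have sP: "sets (\<mu> \<Otimes>\<^sub>M \<mu>) = sets (borel \<Otimes>\<^sub>M borel)" by (rule sets_pair_measure_cong) simp_all
  define K where "K y = (\<integral>x. mehler r (y, x) * indicator B x \<partial>\<mu>)" for y
  have iB: "integrable (\<mu> \<Otimes>\<^sub>M \<mu>) (\<lambda>z. mehler r z * (indicator A (fst z) * indicator B (snd z)))"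
    if "A \<in> sets borel" for A
    by (rule mehler_integral(1)[OF mehler_range]) (use that B in \<open>auto intro: indicator_square_integrable\<close>)
  have iB1: "integrable (\<mu> \<Otimes>\<^sub>M \<mu>) (\<lambda>z. mehler r z * indicator B (snd z))"
    using iB[of UNIV] by simp
  have K_meas[measurable]: "K \<in> borel_measurable borel"
    unfolding K_def by measurable
  have K_int: "integrable \<mu> K"
    using PP.integrable_fst'[OF iB1] by (simp add: K_def[abs_def])
  have K_M: "integrable M (\<lambda>\<omega>. K (X s \<omega>))"
    using K_int by (subst (asm) integrable_marginal[where t=s]) auto
  have good: "AE y in \<mu>. measure (density lborel (\<lambda>x. ennreal (q_cond_density q f r y x))) B = K y"
    using PP.AE_pair[OF mehler_nonneg] PP.AE_integrable_fst'[OF iB1]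
  proof eventually_elim
    case (elim y)
    have k[measurable]: "(\<lambda>x. mehler r (y, x)) \<in> borel_measurable borel" by measurable
    have qc: "q_cond_density q f r y x = f x * mehler r (y, x)" for x
      by (simp add: q_cond_density_def mehler_def mehler_term_def)
    have i: "integrable \<mu> (\<lambda>x. mehler r (y, x) * indicator B x)" using elim(2) by simp
    have nn: "AE x in \<mu>. 0 \<le> mehler r (y, x) * indicator B x"
      using elim(1) by eventually_elim (simp add: indicator_def)
    have "emeasure (density lborel (\<lambda>x. ennreal (q_cond_density q f r y x))) B =
        (\<integral>\<^sup>+x. ennreal (f x) * (ennreal (mehler r (y, x)) * indicator B x) \<partial>lborel)"
      unfolding qc by (subst emeasure_density) (auto simp: ennreal_mult' f0 mult.assoc)
    also have "\<dots> = (\<integral>\<^sup>+x. ennreal (mehler r (y, x)) * indicator B x \<partial>\<mu>)"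
      unfolding marg by (subst nn_integral_density) auto
    also have "\<dots> = (\<integral>\<^sup>+x. ennreal (mehler r (y, x) * indicator B x) \<partial>\<mu>)"
      by (intro nn_integral_cong) (simp add: indicator_def)
    also have "\<dots> = ennreal (K y)" unfolding K_def by (rule nn_integral_eq_integral[OF i nn])
    finally have "emeasure (density lborel (\<lambda>x. ennreal (q_cond_density q f r y x))) B = ennreal (K y)" .
    moreover have "0 \<le> K y" unfolding K_def by (rule integral_nonneg_AE[OF nn])
    ultimately show ?case by (simp add: measure_def)
  qed
  let ?F = "sigma_gen M X {s}"
  interpret F: sigma_finite_subalgebra M ?F
    by (rule sigma_finite_subalgebra_sigma_gen) (use prob_space_axioms in auto)
  have "AE \<omega> in M. real_cond_exp M ?F (\<lambda>\<omega>'. indicator B (X t \<omega>')) \<omega> = K (X s \<omega>)"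
  proof (rule F.real_cond_exp_charact)
    fix A' assume "A' \<in> sets ?F"
    then have "A' \<in> sigma_sets (space M) {X s -` B \<inter> space M | B. B \<in> sets borel}"
      by (simp add: sets_sigma_gen)
    then obtain A where A[measurable]: "A \<in> sets borel" and A': "A' = X s -` A \<inter> space M"
      using sigma_sets_vimage_commute[of "X s" "space M" UNIV "sets borel"] sets.sigma_sets_eq[of "borel :: real measure"]
      by auto
    have "(\<integral>\<omega>\<in>A'. indicator B (X t \<omega>) \<partial>M) = expectation (\<lambda>\<omega>. indicat_real A (X s \<omega>) * indicator B (X t \<omega>))"
      unfolding set_lebesgue_integral_def
      by (rule Bochner_Integration.integral_cong) (auto simp: A' indicator_def)
    also have "\<dots> = (\<integral>z. mehler r z * (indicator A (fst z) * indicator B (snd z)) \<partial>(\<mu> \<Otimes>\<^sub>M \<mu>))"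
      by (rule joint_law_rectangle) simp_all
    also have "\<dots> = (\<integral>y. (\<integral>x. mehler r (y, x) * (indicator A y * indicator B x) \<partial>\<mu>) \<partial>\<mu>)"
      by (subst PP.integral_fst'[OF iB[OF A], symmetric]) simp
    also have "\<dots> = (\<integral>y. indicator A y * K y \<partial>\<mu>)"
    proof (intro Bochner_Integration.integral_cong refl)
      fix y
      have "(\<integral>x. mehler r (y, x) * (indicator A y * indicator B x) \<partial>\<mu>) = (\<integral>x. indicator A y * (mehler r (y, x) * indicator B x) \<partial>\<mu>)"
        by (intro Bochner_Integration.integral_cong refl) (simp only: mult_ac)
      then show "(\<integral>x. mehler r (y, x) * (indicator A y * indicator B x) \<partial>\<mu>) = indicator A y * K y"
        unfolding K_def integral_mult_right_zero .
    qed
    also have "\<dots> = expectation (\<lambda>\<omega>. indicator A (X s \<omega>) * K (X s \<omega>))"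
      by (rule integral_marginal) measurable
    also have "\<dots> = (\<integral>\<omega>\<in>A'. K (X s \<omega>) \<partial>M)"
      unfolding set_lebesgue_integral_def
      by (rule Bochner_Integration.integral_cong) (auto simp: A' indicator_def)
    finally show "(\<integral>\<omega>\<in>A'. indicator B (X t \<omega>) \<partial>M) = (\<integral>\<omega>\<in>A'. K (X s \<omega>) \<partial>M)" .
  next
    show "integrable M (\<lambda>\<omega>. indicat_real B (X t \<omega>))"
      by (rule integrable_const_bound[where B=1]) (auto simp: indicator_def)
    show "(\<lambda>\<omega>. K (X s \<omega>)) \<in> borel_measurable ?F"
      by (rule measurable_compose[OF measurable_sigma_gen_component K_meas]) simp
  qed (rule K_M)
  moreover have "AE \<omega> in M. measure (density lborel (\<lambda>x. ennreal (q_cond_density q f r (X s \<omega>) x))) B = K (X s \<omega>)"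
  proof -
    have "\<mu> = distr M borel (X s)" by (simp add: marginal_def stationary[of s])
    then have "AE y in distr M borel (X s). measure (density lborel (\<lambda>x. ennreal (q_cond_density q f r y x))) B = K y"
      using good by (simp only:)
    then show ?thesis by (rule AE_distrD[rotated]) simp
  qed
  ultimately show "AE \<omega> in M. real_cond_exp M ?F (\<lambda>\<omega>'. indicator B (X t \<omega>')) \<omega> =
      measure (density lborel (\<lambda>x. ennreal (q_cond_density q f r (X s \<omega>) x))) B"
    by eventually_elim simp
qed

end

theorem q_ornstein_uhlenbeck_q_process:
  assumes "\<bar>q\<bar> < 1" "stationary_markov M X"
  shows "q_ornstein_uhlenbeck q \<alpha> M X"
proof -
  obtain f where f: "q_normal_density q f" "\<mu> = density lborel (\<lambda>x. ennreal (f x))"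
    using q_normal_density_exists[OF assms(1)] by blast
  then show ?thesis
    unfolding q_ornstein_uhlenbeck_def using cond_law_mehler[OF assms(1) _ f] assms(2) by blast
qed

text \<open>H_2 = x^2 - 1 has norm [2]_q! = 0 at q = -1, hence X_t is 1 or -1. All probabilities
  follow from means and correlations.\<close>

theorem two_point_SMC_q_process:
  assumes q: "q = -1" and sm: "stationary_markov M X"
  shows "two_point_SMC \<alpha> M X"
proof -
  have "mean (q_hermite_poly q 2 * q_hermite_poly q 2) = 0"
    using mean_q_hermite_orth[OF mean_q_hermite_Suc, of 2 2] by (simp add: q q_fact_Suc q_int_Suc numeral_2_eq_2)
  then have "AE \<omega> in M. poly (q_hermite_poly q 2) (X 0 \<omega>) = 0" by (simp only: mean_square_eq_0_iff)
  then have "AE \<omega> in M. X 0 \<omega> \<in> {-1, 1}"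
  proof eventually_elim
    case (elim \<omega>)
    then have "(X 0 \<omega>)\<^sup>2 = 1" by (simp add: numeral_2_eq_2)
    then show ?case by (auto simp: power2_eq_1_iff)
  qed
  then have ae: "AE \<omega> in M. X t \<omega> \<in> {-1, 1}" for t
    by (subst AE_stationary) simp_all
  have one: "prob {\<omega> \<in> space M. X t \<omega> = e} = 1 / 2" if "e \<in> {-1, 1}" for t e
  proof -
    have "prob {\<omega> \<in> space M. X t \<omega> = e} = expectation (indicator {\<omega> \<in> space M. X t \<omega> = e})" by simp
    \<comment> \<open>On {-1, 1} the indicator of e is (1 + e x) / 2; the joint indicator below is
      the product of two such factors.\<close>
    also have "\<dots> = expectation (\<lambda>\<omega>. (1 + e * X t \<omega>) / 2)"
    proof (rule integral_cong_AE)
      show "AE \<omega> in M. indicat_real {\<omega> \<in> space M. X t \<omega> = e} \<omega> = (1 + e * X t \<omega>) / 2"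
        using ae[of t] AE_space by eventually_elim (use that in \<open>auto simp: indicator_def\<close>)
    qed measurable
    also have "\<dots> = 1 / 2" using all_moments_integrable[OF all_moments_X[of t]] mean_zero[of t] by (simp add: prob_space)
    finally show ?thesis .
  qed
  have two: "prob {\<omega> \<in> space M. X t \<omega> = e \<and> X s \<omega> = d} = (1 + e * d * exp (- \<alpha> * (t - s))) / 4"
    if st: "s < t" and ed: "e \<in> {-1, 1}" "d \<in> {-1, 1}" for s t e d
  proof -
    have sq: "expectation (\<lambda>\<omega>. X s \<omega> * X s \<omega>) = 1"
    proof -
      have "expectation (\<lambda>\<omega>. X s \<omega> * X s \<omega>) = expectation (\<lambda>\<omega>. 1)"
      proof (rule integral_cong_AE)
        show "AE \<omega> in M. X s \<omega> * X s \<omega> = 1" using ae[of s] by eventually_elim auto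
      qed measurable
      then show ?thesis by (simp add: prob_space)
    qed
    have xy: "expectation (\<lambda>\<omega>. X s \<omega> * X t \<omega>) = exp (- \<alpha> * (t - s))"
      using linear_step[OF _ X_past[OF order_refl] all_moments_X, of s t 1] st sq by simp
    have i: "integrable M (\<lambda>\<omega>. X s \<omega> * X t \<omega>)" "integrable M (X s)" "integrable M (X t)"
      by (intro all_moments_integrable am_intros)+
    have "prob {\<omega> \<in> space M. X t \<omega> = e \<and> X s \<omega> = d} = expectation (indicator {\<omega> \<in> space M. X t \<omega> = e \<and> X s \<omega> = d})" by simp
    also have "\<dots> = expectation (\<lambda>\<omega>. (1 + e * X t \<omega> + d * X s \<omega> + e * d * (X s \<omega> * X t \<omega>)) / 4)"
    proof (rule integral_cong_AE)
      show "AE \<omega> in M. indicat_real {\<omega> \<in> space M. X t \<omega> = e \<and> X s \<omega> = d} \<omega> = (1 + e * X t \<omega> + d * X s \<omega> + e * d * (X s \<omega> * X t \<omega>)) / 4"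
        using ae[of t] ae[of s] AE_space by eventually_elim (use ed in \<open>auto simp: indicator_def\<close>)
    qed measurable
    also have "\<dots> = (1 + e * d * exp (- \<alpha> * (t - s))) / 4" using i by (simp add: prob_space mean_zero xy)
    finally show ?thesis .
  qed
  have cp: "\<P>(\<omega> in M. X t \<omega> = e \<bar> X s \<omega> = d) = 1 / 2 + e * d * exp (- \<alpha> * (t - s)) / 2"
    if "s < t" "e \<in> {-1, 1}" "d \<in> {-1, 1}" for s t e d
    unfolding cond_prob_def two[OF that] one[OF that(3)] by (simp add: add_divide_distrib)
  show ?thesis
    unfolding two_point_SMC_def using sm ae one by (simp add: cp)
qed

end

section \<open>The characterization\<close>

lemma stationary_moments_SMPR:
  assumes "SMPR M X" shows "stationary_moments M X"
proof -
  have sm: "stationary_markov M X" and mo: "\<And>n::nat. integrable M (\<lambda>\<omega>. X 0 \<omega> ^ n)"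
    using assms by (auto simp: SMPR_def)
  then have "prob_space M" and m: "\<And>t. X t \<in> borel_measurable M" and d: "\<And>t. distr M borel (X t) = marginal M X"
    by (auto simp: stationary_markov_def markov_process_def)
  then interpret prob_space M by simp
  show ?thesis
    by unfold_locales (use mo m d in \<open>auto simp: marginal_def\<close>)
qed

text \<open>Serves to contradict regularity when two indices coincide: the changed polynomial still
  solves the regression equations but is no longer orthogonal to p_i.\<close>

lemma (in stationary_moments) correlation_system_add:
  assumes cs: "correlation_system M X \<alpha> p" and ij: "i < j" "enat j < support_size M X" and eq: "\<alpha> i = \<alpha> j"
  shows "correlation_system M X \<alpha> (p(j := p j + p i))"
  unfolding correlation_system_def
proof (intro conjI allI impI)
  have i: "enat i < support_size M X" using ij by (meson enat_ord_simps(2) order_less_trans)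
  have p: "degree (p n) = n" "lead_coeff (p n) = 1"
    "\<And>s t. s < t \<Longrightarrow> AE \<omega> in M. real_cond_exp M (past s) (\<lambda>\<omega>'. poly (p n) (X t \<omega>')) \<omega> = exp (- \<alpha> n * (t - s)) * poly (p n) (X s \<omega>)"
    if "enat n < support_size M X" for n
    using cs that unfolding correlation_system_def by blast+
  show "\<alpha> 0 = 0" using cs by (simp add: correlation_system_def)
  fix n assume n: "enat n < support_size M X"
  have d: "degree (p i) < degree (p j)" using p(1)[OF i] p(1)[OF ij(2)] ij(1) by simp
  have "degree (p j + p i) = j" using degree_add_eq_left[OF d] p(1)[OF ij(2)] by simp
  moreover have "lead_coeff (p j + p i) = 1" using lead_coeff_add_le[of "p i" "p j"] d p(2)[OF ij(2)] by (simp add: add.commute)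
  ultimately show "degree ((p(j := p j + p i)) n) = n" "lead_coeff ((p(j := p j + p i)) n) = 1"
    using p(1,2)[OF n] by (simp_all only: fun_upd_apply split: if_split) simp_all
  fix s t :: real assume st: "s < t"
  show "AE \<omega> in M. real_cond_exp M (past s) (\<lambda>\<omega>'. poly ((p(j := p j + p i)) n) (X t \<omega>')) \<omega> =
      exp (- \<alpha> n * (t - s)) * poly ((p(j := p j + p i)) n) (X s \<omega>)"
  proof (cases "n = j")
    case True
    interpret F: sigma_finite_subalgebra M "past s"
      by (rule sigma_finite_subalgebra_sigma_gen) (use prob_space_axioms in auto)
    have "AE \<omega> in M. real_cond_exp M (past s) (\<lambda>\<omega>'. poly (p j) (X t \<omega>') + poly (p i) (X t \<omega>')) \<omega> =
        real_cond_exp M (past s) (\<lambda>\<omega>'. poly (p j) (X t \<omega>')) \<omega> + real_cond_exp M (past s) (\<lambda>\<omega>'. poly (p i) (X t \<omega>')) \<omega>"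
      by (intro F.real_cond_exp_add integrable_poly)
    then show ?thesis using p(3)[OF i st] p(3)[OF ij(2) st]
    proof eventually_elim
      case (elim \<omega>)
      then show ?case using True eq by (simp add: algebra_simps)
    qed
  qed (use p(3)[OF n st] in simp)
qed

context regular_process
begin

lemma q_process_of_orthogonality:
  assumes H: "\<And>n. mean (q_hermite_poly q (Suc n)) = 0"
    and q: "-1 \<le> q" "q \<le> 1" and c: "0 < c" "\<And>n. enat n < v \<Longrightarrow> \<alpha> n = real n * c"
  shows "q_process M X q c"
proof (rule q_processI[OF _ q c])
  fix n
  show "AE \<omega> in M. poly (P n) (X 0 \<omega>) = q_hermite q n (X 0 \<omega>)"
    using monic_orthogonal_unique[OF monic _ monic_basis_q_hermite_poly, of n q] P_orth mean_q_hermite_orth[OF H]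
    by simp
qed

lemma mean_q_hermite_two_point:
  assumes "two_point_SMC c M X" shows "mean (q_hermite_poly (-1) (Suc n)) = 0"
proof -
  have "AE \<omega> in M. X 0 \<omega> \<in> {-1, 1}" using assms by (simp add: two_point_SMC_def)
  then have sq: "AE \<omega> in M. (X 0 \<omega>)\<^sup>2 = 1" by eventually_elim auto
  note H = q_hermite_minus_one_null[OF sq]
  show ?thesis
  proof (cases n)
    case 0
    then show ?thesis using mean_x(1) by simp
  next
    case (Suc m)
    show ?thesis unfolding mean_def
      by (rule integral_eq_zero_AE) (use H[of m] Suc in simp)
  qed
qed

text \<open>The moments 0 and 1 exclude the Dirac case and identify the Gaussian marginal as
  standard normal.\<close>

lemma mean_q_hermite_ornstein_uhlenbeck:
  assumes "ornstein_uhlenbeck c M X" shows "mean (q_hermite_poly 1 (Suc n)) = 0"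
proof (rule mean_hermite_normal)
  have "gaussian_law (distr M borel (\<lambda>\<omega>. \<Sum>t\<in>T. w t * X t \<omega>))" if "finite T" for T w
    using assms that by (simp add: ornstein_uhlenbeck_def gaussian_process_def)
  from this[of "{0}" "\<lambda>_. 1"] have g: "gaussian_law (distr M borel (X 0))" by simp
  let ?\<nu> = "distr M borel (X 0)"
  have m: "(\<integral>x. x \<partial>?\<nu>) = 0" "(\<integral>x. x\<^sup>2 \<partial>?\<nu>) = 1"
    using moment_1 moment_2 by (subst integral_distr; simp)+
  show "?\<nu> = std_normal_distribution"
    using g unfolding gaussian_law_def
  proof (elim disjE exE conjE)
    fix e assume e: "?\<nu> = return borel e"
    have "e = 0" "e\<^sup>2 = 1" using m unfolding e by (simp_all add: integral_return)
    then show ?thesis by simp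
  next
    fix e \<sigma> :: real assume s: "0 < \<sigma>" and d: "?\<nu> = density lborel (\<lambda>x. ennreal (normal_density e \<sigma> x))"
    have "(\<integral>x. x \<partial>?\<nu>) = (\<integral>x. normal_density e \<sigma> x * x \<partial>lborel)"
      unfolding d by (subst integral_density) (auto simp: normal_density_nonneg)
    then have e: "e = 0" using m(1) has_bochner_integral_integral_eq[OF normal_moment_nz_1[OF s, of e]] by simp
    have "(\<integral>x. x\<^sup>2 \<partial>?\<nu>) = (\<integral>x. normal_density e \<sigma> x * (x - e) ^ (2 * 1) \<partial>lborel)"
      unfolding d by (subst integral_density) (auto simp: normal_density_nonneg e)
    then have "\<sigma>\<^sup>2 = 1" using m(2) has_bochner_integral_integral_eq[OF normal_moment_even[OF s, of e 1]] s by simp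
    then have "\<sigma> = 1" using s by (simp add: power2_eq_1_iff)
    then show ?thesis using d e by simp
  qed
qed

lemma mean_q_hermite_q_ornstein_uhlenbeck:
  assumes "q_ornstein_uhlenbeck q c M X" shows "mean (q_hermite_poly q (Suc n)) = 0"
proof -
  obtain f where f: "q_normal_density q f" "marginal M X = density lborel (\<lambda>x. ennreal (f x))"
    using assms by (auto simp: q_ornstein_uhlenbeck_def)
  have [measurable]: "f \<in> borel_measurable borel" and f0: "\<And>x. 0 \<le> f x"
    and o: "\<And>m n. m \<noteq> n \<Longrightarrow> (\<integral>x. f x * (q_hermite q m x * q_hermite q n x) \<partial>lborel) = 0"
    using f(1) by (simp_all add: q_normal_density_def)
  have "mean (q_hermite_poly q (Suc n)) = (\<integral>x. q_hermite q (Suc n) x \<partial>marginal M X)"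
    unfolding marginal_def mean_def by (subst integral_distr) simp_all
  also have "\<dots> = (\<integral>x. f x * (q_hermite q (Suc n) x * q_hermite q 0 x) \<partial>lborel)"
    unfolding f(2) by (subst integral_density) (auto simp: f0)
  also have "\<dots> = 0" by (rule o) simp
  finally show ?thesis .
qed

end

theorem theorem4:
  fixes M :: "'a measure" and X :: "real \<Rightarrow> 'a \<Rightarrow> real" and \<alpha> :: "nat \<Rightarrow> real"
  assumes "RSMPR M X \<alpha>"
    and "(\<integral>\<omega>. X 0 \<omega> \<partial>M) = 0"
    and "(\<integral>\<omega>. X 0 \<omega> ^ 3 \<partial>M) = 0"
    and "(\<integral>\<omega>. X 0 \<omega> ^ 2 \<partial>M) = 1"
  shows "quadratic_harness M X \<longleftrightarrow>
    (\<exists>a>0.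
       (\<forall>n::nat. 1 \<le> n \<and> enat n < support_size M X \<longrightarrow> \<alpha> n = real n * a) \<and>
       (\<exists>q. -1 \<le> q \<and> q \<le> 1 \<and>
          (q = -1 \<longrightarrow> two_point_SMC a M X) \<and>
          (q = 1 \<longrightarrow> ornstein_uhlenbeck a M X) \<and>
          (-1 < q \<and> q < 1 \<longrightarrow> q_ornstein_uhlenbeck q a M X)))"
proof -
  have smpr: "SMPR M X" and reg: "\<And>p. correlation_system M X \<alpha> p \<Longrightarrow> orthogonal_system M X p"
    using assms(1) unfolding RSMPR_def by blast+
  obtain p where cs: "correlation_system M X \<alpha> p" using assms(1) unfolding RSMPR_def by blast
  have sm: "stationary_markov M X" using smpr by (simp add: SMPR_def)
  interpret stationary_moments M X by (rule stationary_moments_SMPR[OF smpr])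
  obtain P where P: "monic_basis P" "\<And>n. enat n < support_size M X \<Longrightarrow> P n = p n"
    "\<And>n. eigenfunction (poly (P n)) (\<alpha> n)" "\<And>m n. m \<noteq> n \<Longrightarrow> mean (P m * P n) = 0"
    "\<And>n. 0 < mean (P n * P n) \<longleftrightarrow> enat n < support_size M X"
    "\<And>n. \<not> enat n < support_size M X \<Longrightarrow> AE \<omega> in M. poly (P n) (X 0 \<omega>) = 0"
    using orthogonal_extension[OF cs reg[OF cs]] by blast
  have a0: "\<alpha> 0 = 0" using cs by (simp add: correlation_system_def)
  interpret regular_process M X P \<alpha> "support_size M X"
  proof unfold_locales
    fix i j :: nat assume ij: "i < j" "enat j < support_size M X"
    then have i: "enat i < support_size M X" by (meson enat_ord_simps(2) order_less_trans)
    \<comment> \<open>If the indices agreed, p_j + p_i would be admissible, but its inner product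
      with p_i is the positive norm of p_i.\<close>
    show "\<alpha> i \<noteq> \<alpha> j"
    proof
      assume "\<alpha> i = \<alpha> j"
      then have os: "orthogonal_system M X (p(j := p j + p i))"
        by (intro reg correlation_system_add[OF cs ij])
      have "j \<noteq> i" using ij(1) by simp
      with os[unfolded orthogonal_system_def, rule_format, of j i] i ij(2)
      have "(\<integral>x. poly (p j + p i) x * poly (p i) x \<partial>marginal M X) = 0" by simp
      then have "mean ((P j + P i) * P i) = 0"
        unfolding P(2)[OF i] P(2)[OF ij(2)] mean_def marginal_def by (simp add: integral_distr)
      then have "mean (P i * P i) = 0" using P(4)[of j i] ij(1) by (simp add: distrib_right)
      then show False using P(5)[of i] i by simp
    qed
  qed (use P(1,3-6) a0 assms(2-4) in \<open>simp_all only:\<close>)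
  show ?thesis
  proof
    assume "quadratic_harness M X"
    then obtain q a where qa: "q_process M X q a" "\<And>n. enat n < support_size M X \<Longrightarrow> \<alpha> n = real n * a"
      using quadratic_harness_imp_q_process by blast
    interpret Q: q_process M X q a by (rule qa(1))
    show "\<exists>a>0. (\<forall>n::nat. 1 \<le> n \<and> enat n < support_size M X \<longrightarrow> \<alpha> n = real n * a) \<and>
       (\<exists>q. -1 \<le> q \<and> q \<le> 1 \<and> (q = -1 \<longrightarrow> two_point_SMC a M X) \<and> (q = 1 \<longrightarrow> ornstein_uhlenbeck a M X) \<and>
          (-1 < q \<and> q < 1 \<longrightarrow> q_ornstein_uhlenbeck q a M X))"
      using qa(2) Q.alpha_pos Q.q_bounds Q.two_point_SMC_q_process[OF _ sm] Q.ornstein_uhlenbeck_q_process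
        Q.q_ornstein_uhlenbeck_q_process[OF _ sm]
      by (intro exI[of _ a] conjI exI[of _ q]) auto
  next
    assume "\<exists>a>0. (\<forall>n::nat. 1 \<le> n \<and> enat n < support_size M X \<longrightarrow> \<alpha> n = real n * a) \<and>
       (\<exists>q. -1 \<le> q \<and> q \<le> 1 \<and> (q = -1 \<longrightarrow> two_point_SMC a M X) \<and> (q = 1 \<longrightarrow> ornstein_uhlenbeck a M X) \<and>
          (-1 < q \<and> q < 1 \<longrightarrow> q_ornstein_uhlenbeck q a M X))"
    then obtain a q where a: "0 < a" "\<And>n. 1 \<le> n \<Longrightarrow> enat n < support_size M X \<Longrightarrow> \<alpha> n = real n * a"
      and q: "-1 \<le> q" "q \<le> 1" "q = -1 \<Longrightarrow> two_point_SMC a M X" "q = 1 \<Longrightarrow> ornstein_uhlenbeck a M X"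
        "-1 < q \<Longrightarrow> q < 1 \<Longrightarrow> q_ornstein_uhlenbeck q a M X" by blast
    have \<alpha>: "\<alpha> n = real n * a" if "enat n < support_size M X" for n
      using a(2)[OF _ that] a0 by (cases n) auto
    \<comment> \<open>This is a property of the marginal law, and each family states enough about
      its marginal to decide it; orthogonality then identifies the regression polynomials.\<close>
    have "mean (q_hermite_poly q (Suc n)) = 0" for n
    proof -
      consider "q = -1" | "q = 1" | "-1 < q" "q < 1" using q(1,2) by linarith
      then show ?thesis
      proof cases
        case 1
        then show ?thesis using mean_q_hermite_two_point[OF q(3)] by simp
      next
        case 2
        then show ?thesis using mean_q_hermite_ornstein_uhlenbeck[OF q(4)] by simp
      next
        case 3
        then show ?thesis using mean_q_hermite_q_ornstein_uhlenbeck[OF q(5)] by simp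
      qed
    qed
    then interpret Q: q_process M X q a
      using q(1,2) a(1) \<alpha> by (intro q_process_of_orthogonality)
    show "quadratic_harness M X" by (rule Q.quadratic_harness_q_process)
  qed
qed

end
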